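(* Let $\theta$ be an inner function in $\mathbb{D}$. If $\{\lambda_n\}\subset\mathbb{D}$, $\lambda_n\to\zeta\in\mathbb{T}$ and $\{k_{\lambda_n}\}$ is overcomplete in $K_\theta$, then $\zeta\in\bigcap_{n=0}^{\infty}AC_n(\theta)$.
   Context: $\mathbb{D}$ is the open unit disc, $\mathbb{T}$ the unit circle, $H^2=H^2(\mathbb{D})$ the Hardy space. For an inner function $\theta$ in $\mathbb{D}$, the model space is $K_\theta=H^2\ominus\theta H^2$, and for $\lambda\in\mathbb{D}$, $k_\lambda(z)=\frac{1-\overline{\theta(\lambda)}\theta(z)}{1-\overline{\lambda}z}$ is the reproducing kernel of $K_\theta$ at $\lambda$. A sequence $\{x_n\}$ in a separable Banach space $X$ is overcomplete if every (infinite) subsequence $\{x_{n_k}\}$ is complete in $X$, i.e. has dense linear span. Let $z_j$ be the zeros of $\theta$ (counting multiplicities) and $\nu$ the positive singular measure on $\mathbb{T}$ generating the singular inner factor of $\theta$. For an integer $n\ge0$, the Ahern--Clark set of order $n$, $AC_n(\theta)$, is the set of $\zeta\in\mathbb{T}$ such that $\sum_j\frac{1-|z_j|^2}{|\zeta-z_j|^{2n+2}}+\int_{\mathbb{T}}\frac{d\nu(z)}{|\zeta-z|^{2n+2}}<\infty$. *)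

theory Defs
  imports "HOL-Complex_Analysis.Complex_Analysis"
begin

text \<open>
  The open unit disc is \<open>ball 0 1\<close> and the unit circle is \<open>sphere 0 1\<close>. Functions on the disc
  are total functions of type \<open>complex \<Rightarrow> complex\<close> whose values off the disc are irrelevant:
  every notion below depends only on the restriction to the disc.
\<close>

text \<open>Arc length on the circle, of total mass \<open>2 * pi\<close>.\<close>

definition circle_measure :: "complex measure" where
  "circle_measure =
     distr (restrict_space lborel {-pi..pi}) (restrict_space borel (sphere 0 1)) cis"

definition inner_function :: "(complex \<Rightarrow> complex) \<Rightarrow> bool" where
  "inner_function \<theta> \<longleftrightarrow>
     \<theta> holomorphic_on ball 0 1 \<and> bounded (\<theta> ` ball 0 1) \<and>
     (AE \<xi> in circle_measure.
        \<exists>l. cmod l = 1 \<and> ((\<lambda>r. \<theta> (of_real r * \<xi>)) \<longlongrightarrow> l) (at_left 1))"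

definition taylor_coeff :: "(complex \<Rightarrow> complex) \<Rightarrow> nat \<Rightarrow> complex" where
  "taylor_coeff f n = (deriv ^^ n) f 0 / fact n"

definition H2 :: "(complex \<Rightarrow> complex) set" where
  "H2 = {f. f holomorphic_on ball 0 1 \<and> summable (\<lambda>n. (cmod (taylor_coeff f n))\<^sup>2)}"

definition H2_inner :: "(complex \<Rightarrow> complex) \<Rightarrow> (complex \<Rightarrow> complex) \<Rightarrow> complex" where
  "H2_inner f g = (\<Sum>n. taylor_coeff f n * cnj (taylor_coeff g n))"

definition H2_norm :: "(complex \<Rightarrow> complex) \<Rightarrow> real" where
  "H2_norm f = sqrt (\<Sum>n. (cmod (taylor_coeff f n))\<^sup>2)"

definition model_space :: "(complex \<Rightarrow> complex) \<Rightarrow> (complex \<Rightarrow> complex) set" where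
  "model_space \<theta> = {f \<in> H2. \<forall>g\<in>H2. H2_inner f (\<lambda>z. \<theta> z * g z) = 0}"

definition model_kernel :: "(complex \<Rightarrow> complex) \<Rightarrow> complex \<Rightarrow> complex \<Rightarrow> complex" where
  "model_kernel \<theta> w = (\<lambda>z. (1 - cnj (\<theta> w) * \<theta> z) / (1 - cnj w * z))"

text \<open>
  Completeness and overcompleteness of a sequence of functions in a subspace \<open>X\<close> of \<open>H2\<close>,
  with the norm inherited from \<open>H2\<close>: the finite complex linear combinations are dense in \<open>X\<close>.
\<close>

definition complete_seq_in ::
    "(complex \<Rightarrow> complex) set \<Rightarrow> (nat \<Rightarrow> complex \<Rightarrow> complex) \<Rightarrow> bool" where
  "complete_seq_in X x \<longleftrightarrow>
     (\<forall>f\<in>X. \<forall>\<epsilon>>0. \<exists>m (c :: nat \<Rightarrow> complex).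
        H2_norm (\<lambda>z. f z - (\<Sum>i<m. c i * x i z)) < \<epsilon>)"

definition overcomplete_in ::
    "(complex \<Rightarrow> complex) set \<Rightarrow> (nat \<Rightarrow> complex \<Rightarrow> complex) \<Rightarrow> bool" where
  "overcomplete_in X x \<longleftrightarrow>
     (\<forall>n. x n \<in> X) \<and>
     (\<forall>r :: nat \<Rightarrow> nat. strict_mono r \<longrightarrow> complete_seq_in X (x \<circ> r))"

definition disc_zeros :: "(complex \<Rightarrow> complex) \<Rightarrow> complex set" where
  "disc_zeros \<theta> = {a \<in> ball 0 1. \<theta> a = 0}"

definition zero_mult :: "(complex \<Rightarrow> complex) \<Rightarrow> complex \<Rightarrow> nat" where
  "zero_mult \<theta> a = nat (zorder \<theta> a)"

definition blaschke_factor :: "complex \<Rightarrow> complex \<Rightarrow> complex" where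
  "blaschke_factor a z =
     (if a = 0 then z else of_real (cmod a) / a * ((a - z) / (1 - cnj a * z)))"

definition singular_inner :: "complex measure \<Rightarrow> complex \<Rightarrow> complex" where
  "singular_inner \<nu> z = exp (- (LINT \<xi>|\<nu>. (\<xi> + z) / (\<xi> - z)))"

definition singular_on_circle :: "complex measure \<Rightarrow> bool" where
  "singular_on_circle \<nu> \<longleftrightarrow>
     (\<exists>N \<in> sets circle_measure.
        emeasure circle_measure N = 0 \<and> emeasure \<nu> (sphere 0 1 - N) = 0)"

text \<open>
  \<open>\<nu>\<close> is the finite positive singular Borel measure on the circle that generates the singular
  inner factor of \<open>\<theta>\<close>, i.e. \<open>\<theta> = \<gamma> B S\<close> is the canonical factorization, where \<open>\<gamma>\<close> is a
  unimodular constant, \<open>B\<close> the Blaschke product of the zeros of \<open>\<theta>\<close> (repeated according to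
  multiplicity) and \<open>S = singular_inner \<nu>\<close>. Every inner function has exactly one such \<open>\<nu>\<close>.
  The infinite product is unconditional: the limit is along the finite sets of zeros.
\<close>

definition generates_singular_factor :: "complex measure \<Rightarrow> (complex \<Rightarrow> complex) \<Rightarrow> bool" where
  "generates_singular_factor \<nu> \<theta> \<longleftrightarrow>
     sets \<nu> = sets (restrict_space borel (sphere 0 1)) \<and>
     finite_measure \<nu> \<and> singular_on_circle \<nu> \<and>
     (\<exists>\<gamma> B. cmod \<gamma> = 1 \<and>
        (\<forall>z\<in>ball 0 1.
           ((\<lambda>F. \<Prod>a\<in>F. blaschke_factor a z ^ zero_mult \<theta> a) \<longlongrightarrow> B z)
             (finite_subsets_at_top (disc_zeros \<theta>)) \<and>
           \<theta> z = \<gamma> * B z * singular_inner \<nu> z))"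

text \<open>
  The integrand is formed with the division of \<^typ>\<open>ennreal\<close>, where \<open>1 / 0 = \<infinity>\<close>, so that an
  atom of \<open>\<nu>\<close> at \<open>\<zeta>\<close> makes the integral infinite (with real division it would be ignored).
  In the sum, \<open>\<zeta> - a\<close> is never zero.
\<close>

definition ahern_clark ::
    "(complex \<Rightarrow> complex) \<Rightarrow> complex measure \<Rightarrow> nat \<Rightarrow> complex set" where
  "ahern_clark \<theta> \<nu> n =
     {\<zeta> \<in> sphere 0 1.
        (\<lambda>a. real (zero_mult \<theta> a) * ((1 - (cmod a)\<^sup>2) / cmod (\<zeta> - a) ^ (2 * n + 2)))
          summable_on disc_zeros \<theta> \<and>
        (\<integral>\<^sup>+ \<xi>. 1 / ennreal (cmod (\<zeta> - \<xi>) ^ (2 * n + 2)) \<partial>\<nu>) < \<infinity>}"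

end

theory Submission
  imports Defs
begin

text \<open>
  Every overcomplete system is rigid in the following sense: a nonzero element of the space cannot be
  orthogonal to infinitely many of its members. For reproducing kernels this says that a nonzero
  \<open>f\<close> in the model space \<open>K\<close> cannot vanish at infinitely many of the points \<open>w n\<close>. A gliding hump
  argument turns this into a principle of uniform boundedness (\<open>overcomplete_equibounded\<close>): if \<open>V\<close> is
  any subspace of \<open>K\<close>, closed or not, and the scaled evaluations \<open>c n * f (w n)\<close> are bounded in \<open>n\<close>
  for each \<open>f\<close> in \<open>V\<close>, then they are uniformly bounded on the unit ball of \<open>V\<close>. Otherwise one builds,
  by small corrections inside \<open>V\<close>, functions that stay close to a fixed nonzero one and vanish at more
  and more of the points. The approximation of that fixed function by finite combinations of kernels
  only sees finitely many of the points, so no limit function has to be formed.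

  Take for \<open>V\<close> the functions of \<open>K\<close> that are analytic at \<open>\<zeta>\<close> and vanish there to order \<open>N\<close>, and
  \<open>c n = 1 / (w n - \<zeta>) ^ N\<close>. The scaled evaluations converge to the \<open>N\<close>-th Taylor coefficient, which is
  therefore bounded on \<open>V\<close>. Removing the vanishing conditions one by one shows that for every \<open>N\<close>
  the functional that takes \<open>f\<close> to its \<open>N\<close>-th derivative at \<open>\<zeta>\<close> is bounded on all functions of \<open>K\<close>
  analytic at \<open>\<zeta>\<close> (\<open>overcomplete_boundary_derivative_bound\<close>).

  This is tested on divisors \<open>t\<close> of \<open>\<theta>\<close> that are analytic at \<open>\<zeta>\<close>. The backward shift
  \<open>(t - t 0) / z\<close> belongs to \<open>K\<close> and has norm at most 1, whence the derivatives of \<open>t\<close> at \<open>\<zeta>\<close>, and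
  with them those of the logarithmic derivative of \<open>t\<close>, are bounded independently of \<open>t\<close>
  (\<open>divisor_derivative_bound\<close>, \<open>log_derivative_bound\<close>).

  If \<open>t\<close> is a finite Blaschke product, the derivatives of its logarithmic derivative are sums over its
  zeros. In the coordinate \<open>\<omega> = \<i> * cnj (\<zeta> / (\<zeta> - a) - 1 / 2)\<close> they amount to bounds for the sums of
  \<open>Im (\<omega> ^ p)\<close>, for all \<open>p\<close>. These terms change sign, but every finite set of zeros may be used, so
  the sums of their absolute values are bounded too. Since \<open>Im (\<omega> ^ (k + 1))\<close> and \<open>Im (\<omega> ^ (k + 2))\<close>
  cannot both be small, together with \<open>Im \<omega>\<close> they control \<open>Im \<omega> * cmod \<omega> ^ k\<close>, which is
  essentially the summand in the Ahern--Clark condition of order \<open>N\<close> for \<open>k = 2 * N\<close>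
  (\<open>ahern_clark_zeros\<close>).

  If \<open>t\<close> is the singular inner function of the part of \<open>\<nu>\<close> on a set \<open>A\<close> at positive distance from
  \<open>\<zeta>\<close>, one gets a bound, independent of \<open>A\<close>, for the integral of \<open>2 * \<xi> / (\<xi> - \<zeta>) ^ (2 * N + 2)\<close>
  over \<open>A\<close>. Near \<open>\<zeta>\<close> the phase of this integrand is almost constant, so the integral of the modulus
  is bounded, and \<open>A\<close> may grow to a punctured arc (\<open>ahern_clark_singular\<close>). An atom of \<open>\<nu>\<close> at \<open>\<zeta>\<close>
  itself has to be excluded separately: the uniform boundedness principle for the bounded functions in
  \<open>K\<close>, applied to the kernels, gives \<open>1 - (cmod (\<theta> (w n)))\<^sup>2 \<le> C * (1 - (cmod (w n))\<^sup>2)\<close>, and an atom would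
  make \<open>\<theta> (w n)\<close> too small for that (\<open>overcomplete_no_atom\<close>).
\<close>

section \<open>Taylor coefficients on the disc\<close>

lemma higher_deriv_eq_power_series_coeff:
  fixes f :: "complex \<Rightarrow> complex"
  assumes "r > 0" and "\<And>z. z \<in> ball c r \<Longrightarrow> (\<lambda>n. a n * (z - c) ^ n) sums f z"
  shows "(deriv ^^ n) f c = fact n * a n"
proof -
  define F where "F = Abs_fps a"
  have "\<forall>\<^sub>F u in nhds 0. (\<lambda>n. fps_nth F n * u ^ n) sums (f \<circ> (\<lambda>x. c + x)) u"
    unfolding eventually_nhds
  proof (intro exI[of _ "ball 0 r"] conjI ballI)
    fix u :: complex assume "u \<in> ball 0 r"
    then have "c + u \<in> ball c r" by (simp add: dist_norm)
    from assms(2)[OF this] show "(\<lambda>n. fps_nth F n * u ^ n) sums (f \<circ> (\<lambda>x. c + x)) u"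
      by (simp add: F_def)
  qed (use assms(1) in auto)
  then have "(f \<circ> (\<lambda>x. c + x)) has_fps_expansion F" by (rule has_fps_expansionI)
  then have "fps_nth F n = (deriv ^^ n) (f \<circ> (\<lambda>x. c + x)) 0 / fact n"
    by (rule fps_nth_fps_expansion)
  then show ?thesis by (simp add: F_def flip: higher_deriv_shift_0)
qed

abbreviation (input) disc :: "complex set" where "disc \<equiv> ball 0 1"

lemma sums_taylor_coeff:
  assumes "f holomorphic_on disc" "z \<in> disc"
  shows "(\<lambda>n. taylor_coeff f n * z ^ n) sums f z"
  using holomorphic_power_series[OF assms] by (simp add: taylor_coeff_def)

lemma taylor_coeffI:
  assumes "\<And>z. z \<in> disc \<Longrightarrow> (\<lambda>n. a n * z ^ n) sums f z"
  shows "taylor_coeff f n = a n"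
  using higher_deriv_eq_power_series_coeff[of 1 0 a f n] assms by (simp add: taylor_coeff_def)

lemma taylor_coeff_cong:
  assumes "g holomorphic_on disc" "\<And>z. z \<in> disc \<Longrightarrow> f z = g z"
  shows "taylor_coeff f = taylor_coeff g"
  using assms by (intro ext taylor_coeffI) (simp add: sums_taylor_coeff)

lemma taylor_coeff_add:
  assumes "f holomorphic_on disc" "g holomorphic_on disc"
  shows "taylor_coeff (\<lambda>z. f z + g z) n = taylor_coeff f n + taylor_coeff g n"
  using assms by (intro taylor_coeffI) (auto simp: algebra_simps intro!: sums_add sums_taylor_coeff)

lemma taylor_coeff_cmult:
  assumes "f holomorphic_on disc"
  shows "taylor_coeff (\<lambda>z. c * f z) n = c * taylor_coeff f n"
  using assms by (intro taylor_coeffI) (auto simp: mult.assoc intro!: sums_mult sums_taylor_coeff)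

lemma taylor_coeff_0: "taylor_coeff f 0 = f 0"
  by (simp add: taylor_coeff_def)

lemma taylor_coeff_const: "taylor_coeff (\<lambda>z. c) n = (if n = 0 then c else 0)"
proof (rule taylor_coeffI)
  fix z :: complex
  show "(\<lambda>n. (if n = 0 then c else 0) * z ^ n) sums c"
    using sums_finite[of "{0::nat}" "\<lambda>n. (if n = 0 then c else 0) * z ^ n"] by simp
qed

lemma taylor_coeff_times_z:
  assumes "f holomorphic_on disc"
  shows "taylor_coeff (\<lambda>z. z * f z) (Suc n) = taylor_coeff f n"
proof -
  have "taylor_coeff (\<lambda>z. z * f z) m = (case m of 0 \<Rightarrow> 0 | Suc k \<Rightarrow> taylor_coeff f k)" for m
  proof (rule taylor_coeffI)
    fix z assume "z \<in> disc"
    from sums_mult[OF sums_taylor_coeff[OF assms this], of z]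
    have "(\<lambda>n. taylor_coeff f n * z ^ Suc n) sums (z * f z)" by (simp add: mult_ac)
    then show "(\<lambda>n. (case n of 0 \<Rightarrow> 0 | Suc k \<Rightarrow> taylor_coeff f k) * z ^ n) sums (z * f z)"
      using sums_Suc_iff[of "\<lambda>n. (case n of 0 \<Rightarrow> 0 | Suc k \<Rightarrow> taylor_coeff f k) * z ^ n" "z * f z"]
      by simp
  qed
  then show ?thesis by simp
qed

section \<open>The Hilbert space structure\<close>

lemma H2_holomorphic: "f \<in> H2 \<Longrightarrow> f holomorphic_on disc"
  by (simp add: H2_def)

lemma H2_summable: "f \<in> H2 \<Longrightarrow> summable (\<lambda>n. (cmod (taylor_coeff f n))\<^sup>2)"
  by (simp add: H2_def)

lemma H2_norm_nonneg [simp]: "f \<in> H2 \<Longrightarrow> 0 \<le> H2_norm f"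
  unfolding H2_norm_def by (auto intro!: suminf_nonneg H2_summable)

lemma H2_norm_power2: "f \<in> H2 \<Longrightarrow> (H2_norm f)\<^sup>2 = (\<Sum>n. (cmod (taylor_coeff f n))\<^sup>2)"
  unfolding H2_norm_def by (auto intro!: suminf_nonneg H2_summable)

lemma H2_sum_le:
  assumes "f \<in> H2" "finite A"
  shows "(\<Sum>n\<in>A. (cmod (taylor_coeff f n))\<^sup>2) \<le> (H2_norm f)\<^sup>2"
  using assms by (auto simp: H2_norm_power2 intro!: sum_le_suminf H2_summable)

lemma H2I_bounded_sums:
  assumes "f holomorphic_on disc"
    and "\<And>N. (\<Sum>n<N. (cmod (taylor_coeff f n))\<^sup>2) \<le> C\<^sup>2" and "0 \<le> C"
  shows "f \<in> H2" "H2_norm f \<le> C"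
proof -
  have s: "summable (\<lambda>n. (cmod (taylor_coeff f n))\<^sup>2)"
    by (rule summableI_nonneg_bounded[where x="C\<^sup>2"]) (use assms in auto)
  then show "f \<in> H2" using assms by (simp add: H2_def)
  have "(\<Sum>n. (cmod (taylor_coeff f n))\<^sup>2) \<le> C\<^sup>2"
    using s assms by (intro suminf_le_const) auto
  then show "H2_norm f \<le> C" unfolding H2_norm_def using assms(3) by (rule real_le_lsqrt[rotated])
qed

lemma sum_coeff_le:
  assumes "f \<in> H2" "g \<in> H2"
  shows "(\<Sum>n<N. cmod (taylor_coeff f n * cnj (taylor_coeff g n))) \<le> H2_norm f * H2_norm g"
proof -
  have *: "L2_set (\<lambda>n. cmod (taylor_coeff h n)) {..<N} \<le> H2_norm h" if "h \<in> H2" for h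
    using H2_sum_le[OF that, of "{..<N}"] that unfolding L2_set_def
    by (intro real_le_lsqrt) (auto intro: sum_nonneg)
  have "(\<Sum>n<N. cmod (taylor_coeff f n * cnj (taylor_coeff g n)))
      \<le> L2_set (\<lambda>n. cmod (taylor_coeff f n)) {..<N} * L2_set (\<lambda>n. cmod (taylor_coeff g n)) {..<N}"
    using L2_set_mult_ineq[of "\<lambda>n. cmod (taylor_coeff f n)" "\<lambda>n. cmod (taylor_coeff g n)" "{..<N}"]
    by (simp add: norm_mult)
  also have "\<dots> \<le> H2_norm f * H2_norm g"
    using assms by (intro mult_mono *) (auto simp: L2_set_nonneg)
  finally show ?thesis .
qed

lemma H2_inner_summable_norm:
  assumes "f \<in> H2" "g \<in> H2"
  shows "summable (\<lambda>n. norm (taylor_coeff f n * cnj (taylor_coeff g n)))"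
  by (rule summableI_nonneg_bounded[where x="H2_norm f * H2_norm g"])
     (use sum_coeff_le[OF assms] in auto)

lemma H2_inner_summable:
  assumes "f \<in> H2" "g \<in> H2"
  shows "summable (\<lambda>n. taylor_coeff f n * cnj (taylor_coeff g n))"
  using H2_inner_summable_norm[OF assms] by (rule summable_norm_cancel)

lemma H2_cauchy_schwarz:
  assumes "f \<in> H2" "g \<in> H2"
  shows "cmod (H2_inner f g) \<le> H2_norm f * H2_norm g"
proof -
  have "cmod (H2_inner f g) \<le> (\<Sum>n. norm (taylor_coeff f n * cnj (taylor_coeff g n)))"
    unfolding H2_inner_def by (rule summable_norm[OF H2_inner_summable_norm[OF assms]])
  also have "\<dots> \<le> H2_norm f * H2_norm g"
    using H2_inner_summable_norm[OF assms] sum_coeff_le[OF assms] by (intro suminf_le_const) auto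
  finally show ?thesis .
qed

lemma H2_inner_self: "f \<in> H2 \<Longrightarrow> H2_inner f f = of_real ((H2_norm f)\<^sup>2)"
  unfolding H2_inner_def
  by (simp add: H2_norm_power2 H2_summable complex_norm_square[symmetric] flip: suminf_of_real of_real_power)

lemma H2_inner_commute: "f \<in> H2 \<Longrightarrow> g \<in> H2 \<Longrightarrow> H2_inner g f = cnj (H2_inner f g)"
proof -
  assume "f \<in> H2" "g \<in> H2"
  from H2_inner_summable[OF this]
  have "(\<lambda>n. cnj (taylor_coeff f n * cnj (taylor_coeff g n))) sums cnj (H2_inner f g)"
    unfolding H2_inner_def by (subst sums_cnj) (rule summable_sums)
  then show ?thesis unfolding H2_inner_def by (intro sums_unique[symmetric]) (simp add: mult.commute)
qed

lemma H2_add: 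
  assumes "f \<in> H2" "g \<in> H2" shows "(\<lambda>z. f z + g z) \<in> H2"
proof -
  have h: "(\<lambda>z. f z + g z) holomorphic_on disc"
    using H2_holomorphic[OF assms(1)] H2_holomorphic[OF assms(2)] by (rule holomorphic_on_add)
  have "summable (\<lambda>n. (cmod (taylor_coeff f n + taylor_coeff g n))\<^sup>2)"
  proof (rule summable_comparison_test')
    show "summable (\<lambda>n. 2 * ((cmod (taylor_coeff f n))\<^sup>2 + (cmod (taylor_coeff g n))\<^sup>2))"
      by (intro summable_mult summable_add H2_summable assms)
    fix n
    have "(cmod (taylor_coeff f n + taylor_coeff g n))\<^sup>2
        \<le> (cmod (taylor_coeff f n) + cmod (taylor_coeff g n))\<^sup>2"
      by (intro power_mono norm_triangle_ineq) auto
    also have "\<dots> \<le> 2 * ((cmod (taylor_coeff f n))\<^sup>2 + (cmod (taylor_coeff g n))\<^sup>2)"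
      using sum_squares_bound[of "cmod (taylor_coeff f n)" "cmod (taylor_coeff g n)"]
      by (simp add: power2_sum)
    finally show "norm ((cmod (taylor_coeff f n + taylor_coeff g n))\<^sup>2)
        \<le> 2 * ((cmod (taylor_coeff f n))\<^sup>2 + (cmod (taylor_coeff g n))\<^sup>2)" by simp
  qed
  then show ?thesis using h assms by (simp add: H2_def taylor_coeff_add)
qed

lemma H2_cmult: 
  assumes "f \<in> H2" shows "(\<lambda>z. c * f z) \<in> H2"
  using assms unfolding H2_def
  by (auto simp: taylor_coeff_cmult norm_mult power_mult_distrib intro!: holomorphic_intros summable_mult)

lemma H2_const: "(\<lambda>z. c) \<in> H2"
  unfolding H2_def by (auto simp: taylor_coeff_const intro!: summable_finite[of "{0}"] split: if_splits)

lemma H2_diff: "f \<in> H2 \<Longrightarrow> g \<in> H2 \<Longrightarrow> (\<lambda>z. f z - g z) \<in> H2"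
  using H2_add[OF _ H2_cmult[of g "-1"]] by simp

lemma H2_sum: "finite A \<Longrightarrow> (\<And>i. i \<in> A \<Longrightarrow> x i \<in> H2) \<Longrightarrow> (\<lambda>z. \<Sum>i\<in>A. x i z) \<in> H2"
  by (induction A rule: finite_induct) (auto simp: H2_const intro!: H2_add)

lemma H2_inner_add_left:
  assumes "f \<in> H2" "g \<in> H2" "h \<in> H2"
  shows "H2_inner (\<lambda>z. f z + g z) h = H2_inner f h + H2_inner g h"
  unfolding H2_inner_def using assms
  by (simp add: taylor_coeff_add H2_holomorphic distrib_right suminf_add H2_inner_summable)

lemma H2_inner_cmult_left:
  assumes "f \<in> H2" "h \<in> H2"
  shows "H2_inner (\<lambda>z. c * f z) h = c * H2_inner f h"
  unfolding H2_inner_def using assms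
  by (simp add: taylor_coeff_cmult H2_holomorphic mult.assoc suminf_mult H2_inner_summable)

lemma H2_inner_add_right:
  assumes "f \<in> H2" "g \<in> H2" "h \<in> H2"
  shows "H2_inner h (\<lambda>z. f z + g z) = H2_inner h f + H2_inner h g"
  using H2_inner_commute[OF H2_add[OF assms(1,2)] assms(3)] H2_inner_commute[OF assms(1,3)]
    H2_inner_commute[OF assms(2,3)] H2_inner_add_left[OF assms] by simp

lemma H2_inner_cmult_right:
  assumes "f \<in> H2" "h \<in> H2"
  shows "H2_inner h (\<lambda>z. c * f z) = cnj c * H2_inner h f"
  using H2_inner_commute[OF H2_cmult[OF assms(1)] assms(2)] H2_inner_commute[OF assms]
    H2_inner_cmult_left[OF assms] by simp

lemma H2_inner_zero_left: "H2_inner (\<lambda>z. 0) h = 0"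
  unfolding H2_inner_def by (simp add: taylor_coeff_const)

lemma H2_inner_sum_left:
  assumes "finite A" "\<And>i. i \<in> A \<Longrightarrow> x i \<in> H2" "h \<in> H2"
  shows "H2_inner (\<lambda>z. \<Sum>i\<in>A. x i z) h = (\<Sum>i\<in>A. H2_inner (x i) h)"
  using assms by (induction A rule: finite_induct)
    (auto simp: H2_inner_zero_left H2_inner_add_left H2_sum)

lemma H2_norm_cmult: 
  assumes "f \<in> H2" shows "H2_norm (\<lambda>z. c * f z) = cmod c * H2_norm f"
  unfolding H2_norm_def using assms
  by (simp add: taylor_coeff_cmult H2_holomorphic norm_mult power_mult_distrib suminf_mult
        H2_summable real_sqrt_mult)

lemma H2_norm_power2_add:
  assumes "f \<in> H2" "g \<in> H2"
  shows "(H2_norm (\<lambda>z. f z + g z))\<^sup>2 = (H2_norm f)\<^sup>2 + (H2_norm g)\<^sup>2 + 2 * Re (H2_inner f g)"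
proof -
  have "of_real ((H2_norm (\<lambda>z. f z + g z))\<^sup>2) = H2_inner (\<lambda>z. f z + g z) (\<lambda>z. f z + g z)"
    using assms by (simp add: H2_inner_self H2_add)
  also have "\<dots> = H2_inner f f + H2_inner g g + (H2_inner f g + cnj (H2_inner f g))"
    using assms by (simp add: H2_inner_add_left H2_inner_add_right H2_add H2_inner_commute[of f g])
  also have "\<dots> = of_real ((H2_norm f)\<^sup>2 + (H2_norm g)\<^sup>2 + 2 * Re (H2_inner f g))"
    using assms by (simp add: H2_inner_self complex_add_cnj)
  finally show ?thesis using of_real_eq_iff by blast
qed

lemma H2_norm_triangle:
  assumes "f \<in> H2" "g \<in> H2"
  shows "H2_norm (\<lambda>z. f z + g z) \<le> H2_norm f + H2_norm g"
proof (rule power2_le_imp_le)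
  have "Re (H2_inner f g) \<le> H2_norm f * H2_norm g"
    using H2_cauchy_schwarz[OF assms] complex_Re_le_cmod order_trans by blast
  then show "(H2_norm (\<lambda>z. f z + g z))\<^sup>2 \<le> (H2_norm f + H2_norm g)\<^sup>2"
    using assms by (simp add: H2_norm_power2_add power2_sum)
qed (use assms in auto)

lemma H2_norm_eq_0:
  assumes "f \<in> H2" "H2_norm f = 0" "z \<in> disc" shows "f z = 0"
proof -
  have "taylor_coeff f n = 0" for n
    using H2_sum_le[OF assms(1), of "{n}"] assms(2) by simp
  then show ?thesis using sums_taylor_coeff[OF H2_holomorphic[OF assms(1)] assms(3)] by (simp add: sums_iff)
qed

lemma szego_kernel:
  assumes "w \<in> disc"
  shows "(\<lambda>z. 1 / (1 - cnj w * z)) \<in> H2"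
    and "f \<in> H2 \<Longrightarrow> H2_inner f (\<lambda>z. 1 / (1 - cnj w * z)) = f w"
proof -
  have s: "(\<lambda>n. cnj w ^ n * z ^ n) sums (1 / (1 - cnj w * z))" if "z \<in> disc" for z
  proof -
    have "cmod (cnj w * z) < 1" using mult_strict_mono'[of "cmod w" 1 "cmod z" 1] that assms by (simp add: norm_mult)
    from geometric_sums[OF this] show ?thesis by (simp add: power_mult_distrib)
  qed
  then have c: "taylor_coeff (\<lambda>z. 1 / (1 - cnj w * z)) n = cnj w ^ n" for n by (rule taylor_coeffI)
  have h: "(\<lambda>z. 1 / (1 - cnj w * z)) holomorphic_on disc"
    using power_series_holomorphic[of 0 1 "\<lambda>n. cnj w ^ n"] s by simp
  have "summable (\<lambda>n. ((cmod w)\<^sup>2) ^ n)"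
    using assms by (intro summable_geometric) (simp add: power_less_one_iff abs_square_less_1)
  then show "(\<lambda>z. 1 / (1 - cnj w * z)) \<in> H2"
    using h unfolding H2_def mem_Collect_eq c by (simp add: norm_power power_mult[symmetric] mult.commute[of 2])
  assume "f \<in> H2"
  then show "H2_inner f (\<lambda>z. 1 / (1 - cnj w * z)) = f w"
    unfolding H2_inner_def using sums_taylor_coeff[OF H2_holomorphic assms, of f]
    by (simp add: c sums_iff)
qed

lemma H2_eval_bounded:
  assumes "w \<in> disc" obtains B where "0 \<le> B" "\<And>f. f \<in> H2 \<Longrightarrow> cmod (f w) \<le> B * H2_norm f"
proof
  let ?s = "\<lambda>z. 1 / (1 - cnj w * z)"
  show "0 \<le> H2_norm ?s" using szego_kernel[OF assms] by simp
  fix f assume "f \<in> H2"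
  then show "cmod (f w) \<le> H2_norm ?s * H2_norm f"
    using H2_cauchy_schwarz[of f ?s] szego_kernel[OF assms] by (simp add: mult.commute)
qed

section \<open>Multiplication by bounded functions\<close>

lemma space_circle_measure: "space circle_measure = sphere 0 1"
  by (simp add: circle_measure_def space_restrict_space)

lemma sets_circle_measure: "sets circle_measure = sets (restrict_space borel (sphere 0 1))"
  by (simp add: circle_measure_def)

lemma cis_measurable_circle:
  "cis \<in> restrict_space lborel {-pi..pi} \<rightarrow>\<^sub>M restrict_space borel (sphere 0 1)"
proof (rule measurable_restrict_space2)
  have "continuous_on {-pi..pi} cis" by (intro continuous_intros)
  then have "cis \<in> borel_measurable (restrict_space borel {-pi..pi})"
    by (rule borel_measurable_continuous_on_restrict)
  then show "cis \<in> borel_measurable (restrict_space lborel {-pi..pi})"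
    by (simp add: measurable_cong_sets[OF sets_restrict_space_cong[OF sets_lborel] refl])
qed auto

lemma finite_measure_circle: "finite_measure circle_measure"
proof -
  interpret finite_measure "restrict_space lborel {-pi..pi::real}"
    by (rule finite_measureI) (simp add: emeasure_restrict_space space_restrict_space)
  show ?thesis unfolding circle_measure_def
    by (rule finite_measure_distr[OF cis_measurable_circle])
qed

lemma measurable_on_circle:
  fixes f :: "complex \<Rightarrow> 'b::{second_countable_topology,real_normed_vector}"
  assumes "sets \<nu> = sets (restrict_space borel (sphere 0 1))" "continuous_on (sphere 0 1) f"
  shows "f \<in> borel_measurable \<nu>"
  using borel_measurable_continuous_on_restrict[OF assms(2)]
  by (simp add: measurable_cong_sets[OF assms(1) refl])

lemma space_on_circle: "sets \<nu> = sets (restrict_space borel (sphere 0 1)) \<Longrightarrow> space \<nu> = sphere 0 1"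
  by (drule sets_eq_imp_space_eq) (simp add: space_restrict_space)

lemma integrable_on_circle:
  fixes f :: "complex \<Rightarrow> 'b::{second_countable_topology,banach}"
  assumes "sets \<nu> = sets (restrict_space borel (sphere 0 1))" "finite_measure \<nu>" "continuous_on (sphere 0 1) f"
  shows "integrable \<nu> f"
proof -
  interpret finite_measure \<nu> by fact
  have "bounded (f ` sphere 0 1)"
    using assms by (intro compact_imp_bounded compact_continuous_image) auto
  then obtain B where "\<And>x. x \<in> sphere 0 1 \<Longrightarrow> norm (f x) \<le> B"
    unfolding bounded_iff by blast
  then show ?thesis
    by (intro integrable_const_bound[of _ B] measurable_on_circle assms)
       (auto simp: space_on_circle[OF assms(1)])
qed

lemmas measurable_circle = measurable_on_circle[OF sets_circle_measure]
lemmas integrable_circle = integrable_on_circle[OF sets_circle_measure finite_measure_circle]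

lemma integral_circle:
  fixes f :: "complex \<Rightarrow> 'b::{second_countable_topology,banach}"
  assumes "continuous_on (sphere 0 1) f"
  shows "(LINT x|circle_measure. f x) = (LBINT t:{-pi..pi}. f (cis t))"
proof -
  have "(LINT x|circle_measure. f x) = (LINT t|restrict_space lborel {-pi..pi}. f (cis t))"
    unfolding circle_measure_def
    using assms by (intro integral_distr cis_measurable_circle borel_measurable_continuous_on_restrict)
  also have "\<dots> = (LBINT t:{-pi..pi}. f (cis t))"
    by (simp add: integral_restrict_space set_lebesgue_integral_def)
  finally show ?thesis .
qed

lemma integral_circle_monomials:
  "(LINT x|circle_measure. x ^ m * cnj (x ^ n)) = (if m = n then 2 * pi else 0)"
proof -
  have "(LINT x|circle_measure. x ^ m * cnj (x ^ n)) = (LBINT t:{-pi..pi}. cis t ^ m * cnj (cis t ^ n))"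
    by (rule integral_circle) (intro continuous_intros)
  also have "\<dots> = (LBINT t:{-pi..pi}. cis ((real m - real n) * t))"
    by (simp add: Complex.DeMoivre cis_cnj cis_mult algebra_simps)
  also have "\<dots> = (if m = n then 2 * pi else 0)"
  proof (cases "m = n")
    case False
    define k where "k = real m - real n"
    have k: "k \<noteq> 0" using False by (simp add: k_def)
    have eq: "(LBINT t:{-pi..pi}. cis (k * t)) = cis (k * pi) / (\<i> * k) - cis (k * (-pi)) / (\<i> * k)"
      unfolding set_lebesgue_integral_def
    proof (rule integral_FTC_atLeastAtMost)
      fix t :: real
      show "((\<lambda>t. cis (k * t) / (\<i> * k)) has_vector_derivative cis (k * t)) (at t within {-pi..pi})"
        using k by (auto intro!: derivative_eq_intros simp: has_vector_derivative_def scaleR_conv_of_real fun_eq_iff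
            complex_eq_iff)
    qed (auto intro!: continuous_intros)
    have "cis (k * pi) = cis (k * (-pi))"
    proof -
      have "k * pi = pi * of_int (int m - int n)" by (simp add: k_def)
      then have "sin (k * pi) = 0" using sin_npi_int by metis
      then show ?thesis by (simp add: complex_eq_iff)
    qed
    then show ?thesis using eq False by (simp add: k_def)
  next
    case True
    then show ?thesis by (simp add: set_lebesgue_integral_def scaleR_conv_of_real)
  qed
  finally show ?thesis .
qed


lemma dilation_in_disc: "0 \<le> r \<Longrightarrow> r < 1 \<Longrightarrow> x \<in> sphere 0 1 \<Longrightarrow> of_real r * x \<in> disc"
  by (simp add: norm_mult)

lemma continuous_on_dilation:
  assumes "f holomorphic_on disc" "0 \<le> r" "r < 1"
  shows "continuous_on (sphere 0 1) (\<lambda>x. f (of_real r * x))"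
  by (rule continuous_on_compose2[OF holomorphic_on_imp_continuous_on[OF assms(1)]])
     (use assms dilation_in_disc in \<open>auto intro!: continuous_intros\<close>)

lemma integral_circle_norm_power2_polynomial:
  "(LINT x|circle_measure. (\<Sum>n<N. b n * x ^ n) * cnj (\<Sum>n<N. b n * x ^ n))
     = of_real (2 * pi * (\<Sum>n<N. (cmod (b n))\<^sup>2))"
proof -
  have "(LINT x|circle_measure. (\<Sum>n<N. b n * x ^ n) * cnj (\<Sum>n<N. b n * x ^ n))
      = (LINT x|circle_measure. (\<Sum>m<N. \<Sum>n<N. (b m * cnj (b n)) * (x ^ m * cnj (x ^ n))))"
    by (simp add: sum_product mult_ac)
  also have "\<dots> = (\<Sum>m<N. \<Sum>n<N. (b m * cnj (b n)) * (LINT x|circle_measure. x ^ m * cnj (x ^ n)))"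
  proof -
    have int: "integrable circle_measure (\<lambda>x. x ^ m * cnj (x ^ n))" for m n
      by (rule integrable_circle) (intro continuous_intros)
    then have int': "integrable circle_measure (\<lambda>x. (b m * cnj (b n)) * (x ^ m * cnj (x ^ n)))" for m n
      by (rule integrable_mult_right)
    show ?thesis
      by (subst Bochner_Integration.integral_sum, intro Bochner_Integration.integrable_sum int',
          subst Bochner_Integration.integral_sum, rule int')
         (intro sum.cong refl integral_mult_right_zero)
  qed
  also have "\<dots> = (\<Sum>m<N. b m * cnj (b m) * (2 * pi))"
    by (simp only: integral_circle_monomials) (simp add: if_distrib cong: if_cong)
  also have "\<dots> = of_real (2 * pi * (\<Sum>n<N. (cmod (b n))\<^sup>2))"
    by (simp add: sum_distrib_left sum_distrib_right mult_ac flip: complex_norm_square)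
  finally show ?thesis .
qed

text \<open>
  The polynomial partial sums of \<open>f\<close> converge boundedly on the circle of radius \<open>r\<close>, so the identity
  for polynomials passes to the limit by dominated convergence.
\<close>

lemma parseval_circle:
  assumes f: "f holomorphic_on disc" and r: "0 \<le> r" "r < 1"
  shows "(\<lambda>n. (cmod (taylor_coeff f n * of_real r ^ n))\<^sup>2)
     sums ((LINT x|circle_measure. (cmod (f (of_real r * x)))\<^sup>2) / (2 * pi))"
proof -
  define b where "b n = taylor_coeff f n * of_real r ^ n" for n
  have sm: "summable (\<lambda>n. cmod (b n))"
  proof -
    obtain R where R: "r < R" "R < 1" using r dense by blast
    have "summable (\<lambda>n. taylor_coeff f n * of_real R ^ n)"
      using sums_taylor_coeff[OF f, of "of_real R"] R r by (auto simp: sums_iff)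
    from powser_insidea[OF this, of "of_real r"] R r show ?thesis by (simp add: b_def)
  qed
  define M where "M = (\<Sum>n. cmod (b n))"
  have sums: "(\<lambda>n. b n * x ^ n) sums f (of_real r * x)" if "x \<in> sphere 0 1" for x
    using sums_taylor_coeff[OF f dilation_in_disc[OF r that]]
    by (simp add: b_def power_mult_distrib mult.assoc)
  let ?s = "\<lambda>N x. \<Sum>n<N. b n * x ^ n"
  have lim: "(\<lambda>N. LINT x|circle_measure. ?s N x * cnj (?s N x))
      \<longlonglongrightarrow> (LINT x|circle_measure. f (of_real r * x) * cnj (f (of_real r * x)))"
  proof (rule integral_dominated_convergence[where w = "\<lambda>_. M * M"])
    show "(\<lambda>x. f (of_real r * x) * cnj (f (of_real r * x))) \<in> borel_measurable circle_measure"
      by (intro measurable_circle continuous_intros continuous_on_dilation f r)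
    show "(\<lambda>x. ?s N x * cnj (?s N x)) \<in> borel_measurable circle_measure" for N
      by (intro measurable_circle continuous_intros)
    show "integrable circle_measure (\<lambda>_. M * M)" by (rule integrable_circle) (rule continuous_on_const)
    show "AE x in circle_measure. (\<lambda>N. ?s N x * cnj (?s N x)) \<longlonglongrightarrow> f (of_real r * x) * cnj (f (of_real r * x))"
      using sums by (intro AE_I2 tendsto_mult lim_cnj[THEN iffD2]) (auto simp: sums_def space_circle_measure)
    fix N
    have "cmod (?s N x) \<le> M" if "x \<in> sphere 0 1" for x
    proof -
      have "cmod (?s N x) \<le> (\<Sum>n<N. cmod (b n))"
        using norm_sum[of "\<lambda>n. b n * x ^ n" "{..<N}"] that by (simp add: norm_mult norm_power)
      also have "\<dots> \<le> M" unfolding M_def by (rule sum_le_suminf[OF sm]) auto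
      finally show ?thesis .
    qed
    then show "AE x in circle_measure. norm (?s N x * cnj (?s N x)) \<le> M * M"
      by (intro AE_I2) (auto simp: norm_mult space_circle_measure simp del: cnj_sum intro!: mult_mono order_trans[OF norm_ge_zero])
  qed
  have "(LINT x|circle_measure. f (of_real r * x) * cnj (f (of_real r * x)))
      = of_real (LINT x|circle_measure. (cmod (f (of_real r * x)))\<^sup>2)"
    by (subst integral_complex_of_real[symmetric]) (simp only: complex_norm_square)
  with lim have "(\<lambda>N. complex_of_real (2 * pi * (\<Sum>n<N. (cmod (b n))\<^sup>2)))
      \<longlonglongrightarrow> of_real (LINT x|circle_measure. (cmod (f (of_real r * x)))\<^sup>2)"
    by (simp only: integral_circle_norm_power2_polynomial)
  then have "(\<lambda>N. 2 * pi * (\<Sum>n<N. (cmod (b n))\<^sup>2))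
      \<longlonglongrightarrow> (LINT x|circle_measure. (cmod (f (of_real r * x)))\<^sup>2)"
    by (simp only: tendsto_of_real_iff)
  from tendsto_divide[OF this tendsto_const, of "2 * pi"] show ?thesis
    by (simp add: sums_def b_def)
qed

lemma circle_mean_le_H2_norm:
  assumes g: "g \<in> H2" and r: "0 \<le> r" "r < 1"
  shows "(LINT x|circle_measure. (cmod (g (of_real r * x)))\<^sup>2) / (2 * pi) \<le> (H2_norm g)\<^sup>2"
proof -
  from parseval_circle[OF H2_holomorphic[OF g] r]
  have s: "summable (\<lambda>n. (cmod (taylor_coeff g n * of_real r ^ n))\<^sup>2)"
    and e: "(LINT x|circle_measure. (cmod (g (of_real r * x)))\<^sup>2) / (2 * pi)
      = (\<Sum>n. (cmod (taylor_coeff g n * of_real r ^ n))\<^sup>2)" unfolding sums_iff by auto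
  have "(\<Sum>n. (cmod (taylor_coeff g n * of_real r ^ n))\<^sup>2) \<le> (\<Sum>n. (cmod (taylor_coeff g n))\<^sup>2)"
  proof (rule suminf_le[OF _ s H2_summable[OF g]])
    fix n
    have "(cmod (taylor_coeff g n) * r ^ n)\<^sup>2 \<le> (cmod (taylor_coeff g n))\<^sup>2"
      using r by (intro power_mono mult_left_le) (auto simp: power_le_one)
    then show "(cmod (taylor_coeff g n * of_real r ^ n))\<^sup>2 \<le> (cmod (taylor_coeff g n))\<^sup>2"
      using r by (simp add: norm_mult norm_power)
  qed
  then show ?thesis using e H2_norm_power2[OF g] by simp
qed

text \<open>
  Multiplication by a function bounded by \<open>M\<close> has norm at most \<open>M\<close>: on each circle of radius \<open>r < 1\<close>
  this is Parseval's identity and a pointwise estimate, and \<open>r\<close> tends to 1 in finitely many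
  coefficients at a time.
\<close>

lemma H2_mult_bounded:
  assumes f: "f holomorphic_on disc" "\<And>z. z \<in> disc \<Longrightarrow> cmod (f z) \<le> M" and g: "g \<in> H2"
  shows "(\<lambda>z. f z * g z) \<in> H2" "H2_norm (\<lambda>z. f z * g z) \<le> M * H2_norm g"
proof -
  have M: "0 \<le> M" using f(2)[of 0] norm_ge_zero[of "f 0"] by (simp del: norm_ge_zero)
  let ?h = "\<lambda>z. f z * g z"
  have h: "?h holomorphic_on disc" using f(1) H2_holomorphic[OF g] by (rule holomorphic_on_mult)
  let ?I = "\<lambda>h r. (LINT x|circle_measure. (cmod (h (of_real r * x)))\<^sup>2) / (2 * pi)"
  have le: "(\<Sum>n<N. (cmod (taylor_coeff ?h n * of_real r ^ n))\<^sup>2) \<le> (M * H2_norm g)\<^sup>2"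
    if r: "0 \<le> r" "r < 1" for r N
  proof -
    have "(\<Sum>n<N. (cmod (taylor_coeff ?h n * of_real r ^ n))\<^sup>2) \<le> ?I ?h r"
    proof -
      from parseval_circle[OF h r]
      have "summable (\<lambda>n. (cmod (taylor_coeff ?h n * of_real r ^ n))\<^sup>2)"
        and e: "(\<Sum>n. (cmod (taylor_coeff ?h n * of_real r ^ n))\<^sup>2) = ?I ?h r"
        unfolding sums_iff by blast+
      then show ?thesis unfolding e[symmetric] by (intro sum_le_suminf) auto
    qed
    also have "\<dots> \<le> (LINT x|circle_measure. M\<^sup>2 * (cmod (g (of_real r * x)))\<^sup>2) / (2 * pi)"
    proof (intro divide_right_mono integral_mono)
      show "integrable circle_measure (\<lambda>x. (cmod (?h (of_real r * x)))\<^sup>2)"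
        by (intro integrable_circle continuous_intros continuous_on_dilation h r)
      show "integrable circle_measure (\<lambda>x. M\<^sup>2 * (cmod (g (of_real r * x)))\<^sup>2)"
        by (intro integrable_circle continuous_intros continuous_on_dilation H2_holomorphic g r)
      fix x assume "x \<in> space circle_measure"
      then have "of_real r * x \<in> disc" using dilation_in_disc r by (simp add: space_circle_measure)
      from f(2)[OF this] show "(cmod (?h (of_real r * x)))\<^sup>2 \<le> M\<^sup>2 * (cmod (g (of_real r * x)))\<^sup>2"
        unfolding norm_mult power_mult_distrib by (intro mult_right_mono power_mono) auto
    qed simp
    also have "\<dots> = M\<^sup>2 * ?I g r" by simp
    also have "\<dots> \<le> M\<^sup>2 * (H2_norm g)\<^sup>2"
      by (intro mult_left_mono circle_mean_le_H2_norm g r) simp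
    finally show ?thesis by (simp add: power_mult_distrib)
  qed
  have "(\<Sum>n<N. (cmod (taylor_coeff ?h n))\<^sup>2) \<le> (M * H2_norm g)\<^sup>2" for N
  proof (rule tendsto_upperbound)
    have "((\<lambda>r. \<Sum>n<N. (cmod (taylor_coeff ?h n * of_real r ^ n))\<^sup>2)
        \<longlongrightarrow> (\<Sum>n<N. (cmod (taylor_coeff ?h n * of_real 1 ^ n))\<^sup>2)) (at_left 1)"
      by (intro tendsto_intros)
    then show "((\<lambda>r. \<Sum>n<N. (cmod (taylor_coeff ?h n * of_real r ^ n))\<^sup>2)
        \<longlongrightarrow> (\<Sum>n<N. (cmod (taylor_coeff ?h n))\<^sup>2)) (at_left 1)" by simp
    have "\<forall>\<^sub>F r in at_left 1. r \<in> {0<..<1::real}" by (rule eventually_at_leftI[of 0]) auto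
    then show "\<forall>\<^sub>F r in at_left 1. (\<Sum>n<N. (cmod (taylor_coeff ?h n * of_real r ^ n))\<^sup>2) \<le> (M * H2_norm g)\<^sup>2"
      by eventually_elim (rule le, auto)
  qed simp
  from H2I_bounded_sums[OF h this] M g
  show "?h \<in> H2" "H2_norm ?h \<le> M * H2_norm g" by auto
qed

lemma H2_norm_const: "H2_norm (\<lambda>z. c) = cmod c"
  unfolding H2_norm_def
  using sums_finite[of "{0::nat}" "\<lambda>n. (cmod (taylor_coeff (\<lambda>z. c) n))\<^sup>2"]
  by (simp add: taylor_coeff_const sums_iff)

lemma H2_bounded:
  assumes "f holomorphic_on disc" "\<And>z. z \<in> disc \<Longrightarrow> cmod (f z) \<le> M"
  shows "f \<in> H2" "H2_norm f \<le> M"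
  using H2_mult_bounded[OF assms H2_const[of 1]] by (auto simp: H2_norm_const)

text \<open>
  This is the only place where the unimodular radial limits of an inner function enter: bounded
  convergence along the radii shows that the circle means tend to the full mass \<open>2 * pi\<close>.
\<close>

lemma inner_H2_norm:
  assumes inner: "inner_function \<theta>" and le: "\<And>z. z \<in> disc \<Longrightarrow> cmod (\<theta> z) \<le> 1"
  shows "H2_norm \<theta> = 1"
proof (rule antisym)
  have hol: "\<theta> holomorphic_on disc"
    and ae: "AE \<xi> in circle_measure. \<exists>l. cmod l = 1 \<and> ((\<lambda>r. \<theta> (of_real r * \<xi>)) \<longlongrightarrow> l) (at_left 1)"
    using inner by (auto simp: inner_function_def)
  note \<theta> = H2_bounded[OF hol le]
  show "H2_norm \<theta> \<le> 1" by (rule \<theta>(2))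
  define r where "r k = 1 - inverse (real (Suc k))" for k
  have r: "0 \<le> r k" "r k < 1" for k by (auto simp: r_def field_simps)
  have r_lim: "filterlim r (at_left 1) sequentially"
    unfolding filterlim_at
  proof (intro conjI)
    show "r \<longlonglongrightarrow> 1"
      unfolding r_def using tendsto_diff[OF tendsto_const LIMSEQ_inverse_real_of_nat, of 1] by simp
    show "\<forall>\<^sub>F k in sequentially. r k \<in> {..<1} \<and> r k \<noteq> 1"
      using r by (intro always_eventually) (auto simp: less_imp_neq)
  qed
  have "(\<lambda>k. LINT x|circle_measure. (cmod (\<theta> (of_real (r k) * x)))\<^sup>2) \<longlonglongrightarrow> (LINT x|circle_measure. 1)"
  proof (rule integral_dominated_convergence[where w = "\<lambda>_. 1"])
    show "(\<lambda>x. (cmod (\<theta> (of_real (r k) * x)))\<^sup>2) \<in> borel_measurable circle_measure" for k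
      by (intro measurable_circle continuous_intros continuous_on_dilation hol r)
    show "integrable circle_measure (\<lambda>_. 1::real)" by (rule integrable_circle) (rule continuous_on_const)
    show "AE x in circle_measure. (\<lambda>k. (cmod (\<theta> (of_real (r k) * x)))\<^sup>2) \<longlonglongrightarrow> 1"
      using ae
    proof eventually_elim
      case (elim x)
      then obtain l where l: "cmod l = 1" "((\<lambda>r. \<theta> (of_real r * x)) \<longlongrightarrow> l) (at_left 1)" by blast
      have "(\<lambda>k. (cmod (\<theta> (of_real (r k) * x)))\<^sup>2) \<longlonglongrightarrow> (cmod l)\<^sup>2"
        by (intro tendsto_intros filterlim_compose[OF l(2) r_lim])
      then show ?case using l by simp
    qed
    show "AE x in circle_measure. norm ((cmod (\<theta> (of_real (r k) * x)))\<^sup>2) \<le> 1" for k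
      using le[OF dilation_in_disc[OF r]] by (intro AE_I2) (auto simp: space_circle_measure power_le_one)
  qed simp
  moreover have "(LINT x|circle_measure. (1::real)) = 2 * pi"
    proof -
    have "complex_of_real (LINT x|circle_measure. (1::real)) = of_real (2 * pi)"
      using integral_circle_monomials[of 0 0] by (subst integral_complex_of_real[symmetric]) simp
    then show ?thesis by (simp only: of_real_eq_iff)
  qed
  moreover have "(LINT x|circle_measure. (cmod (\<theta> (of_real (r k) * x)))\<^sup>2) \<le> 2 * pi * (H2_norm \<theta>)\<^sup>2" for k
    using circle_mean_le_H2_norm[OF \<theta>(1) r, of k] by (simp add: field_simps)
  ultimately have "2 * pi \<le> 2 * pi * (H2_norm \<theta>)\<^sup>2"
    by (intro LIMSEQ_le_const2[of _ "2 * pi"]) auto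
  then have "1\<^sup>2 \<le> (H2_norm \<theta>)\<^sup>2" by simp
  then show "1 \<le> H2_norm \<theta>" by (rule power2_le_imp_le) (rule H2_norm_nonneg[OF \<theta>(1)])
qed

section \<open>Uniform boundedness\<close>

definition H2_subspace :: "(complex \<Rightarrow> complex) set \<Rightarrow> bool" where
  "H2_subspace V \<longleftrightarrow> V \<subseteq> H2 \<and> (\<forall>f\<in>V. \<forall>g\<in>V. \<forall>c. (\<lambda>z. f z + c * g z) \<in> V)"

definition linear_functional_on :: "(complex \<Rightarrow> complex) set \<Rightarrow> ((complex \<Rightarrow> complex) \<Rightarrow> complex) \<Rightarrow> bool" where
  "linear_functional_on V l \<longleftrightarrow> (\<forall>f\<in>V. \<forall>g\<in>V. \<forall>c. l (\<lambda>z. f z + c * g z) = l f + c * l g)"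

text \<open>
  \<open>H2_norm\<close> is meaningful only on \<open>H2\<close>, so \<open>V\<close> is meant to be an \<open>H2_subspace\<close>. The index type
  is arbitrary because the notion serves a sequence of functionals as well as a single one.
\<close>

definition equibounded_on ::
    "(complex \<Rightarrow> complex) set \<Rightarrow> ('i \<Rightarrow> (complex \<Rightarrow> complex) \<Rightarrow> complex) \<Rightarrow> bool" where
  "equibounded_on V \<phi> \<longleftrightarrow> (\<exists>C. \<forall>i. \<forall>f\<in>V. cmod (\<phi> i f) \<le> C * H2_norm f)"

text \<open>
  The kernel of \<open>l\<close> has codimension at most 1 in \<open>V\<close>. If \<open>l u\<close> is nonzero, then \<open>f\<close> differs from
  \<open>f - (l f / l u) * u\<close>, which lies in the kernel, by a multiple of \<open>u\<close> whose coefficient is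
  controlled by the norm of \<open>f\<close>; on \<open>u\<close> itself pointwise boundedness suffices.
\<close>

lemma equibounded_on_from_kernel:
  assumes V: "H2_subspace V" and l: "linear_functional_on V l"
    and B: "\<And>f. f \<in> V \<Longrightarrow> cmod (l f) \<le> B * H2_norm f"
    and \<phi>: "\<And>i. linear_functional_on V (\<phi> i)"
    and pw: "\<And>f. f \<in> V \<Longrightarrow> \<exists>K. \<forall>i. cmod (\<phi> i f) \<le> K"
    and ker: "equibounded_on {f \<in> V. l f = 0} \<phi>"
  shows "equibounded_on V \<phi>"
proof (cases "\<exists>u\<in>V. l u \<noteq> 0")
  case False
  then have "{f \<in> V. l f = 0} = V" by auto
  then show ?thesis using ker by simp
next
  case True
  then obtain u where u: "u \<in> V" "l u \<noteq> 0" by blast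
  obtain C where C: "\<And>i f. f \<in> V \<Longrightarrow> l f = 0 \<Longrightarrow> cmod (\<phi> i f) \<le> C * H2_norm f"
    using ker by (auto simp: equibounded_on_def)
  obtain K where K: "\<And>i. cmod (\<phi> i u) \<le> K" using pw[OF u(1)] by blast
  have K0: "0 \<le> K" using K order_trans[OF norm_ge_zero] by blast
  have VH: "f \<in> H2" if "f \<in> V" for f using V that by (auto simp: H2_subspace_def)
  show ?thesis unfolding equibounded_on_def
  proof (intro exI allI ballI)
    fix i f assume f: "f \<in> V"
    define t where "t = l f / l u"
    define h where "h = (\<lambda>z. f z + (- t) * u z)"
    have h: "h \<in> V" using V f u unfolding H2_subspace_def h_def by blast
    have "l h = l f + (- t) * l u" unfolding h_def using l f u unfolding linear_functional_on_def by blast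
    then have lh: "l h = 0" using u by (simp add: t_def)
    have t: "cmod t \<le> B * H2_norm f / cmod (l u)"
      using B[OF f] by (simp add: t_def norm_divide divide_right_mono)
    have nh: "H2_norm h \<le> H2_norm f + cmod t * H2_norm u"
      unfolding h_def using H2_norm_triangle[OF VH[OF f] H2_cmult[OF VH[OF u(1)], of "- t"]]
      by (simp only: H2_norm_cmult[OF VH[OF u(1)]] norm_minus_cancel)
    have "\<phi> i h = \<phi> i f + (- t) * \<phi> i u"
      unfolding h_def using \<phi> f u unfolding linear_functional_on_def by blast
    then have "\<phi> i f = \<phi> i h + t * \<phi> i u" by simp
    then have "cmod (\<phi> i f) \<le> cmod (\<phi> i h) + cmod t * cmod (\<phi> i u)"
      by (metis norm_mult norm_triangle_ineq)
    also have "\<dots> \<le> \<bar>C\<bar> * H2_norm h + cmod t * K"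
    proof (intro add_mono mult_left_mono K)
      have "C * H2_norm h \<le> \<bar>C\<bar> * H2_norm h" using VH[OF h] by (intro mult_right_mono) auto
      then show "cmod (\<phi> i h) \<le> \<bar>C\<bar> * H2_norm h" using C[OF h lh, of i] by simp
    qed simp
    also have "\<dots> \<le> \<bar>C\<bar> * (H2_norm f + cmod t * H2_norm u) + cmod t * K"
      using nh by (intro add_right_mono mult_left_mono) auto
    also have "\<dots> = \<bar>C\<bar> * H2_norm f + cmod t * (\<bar>C\<bar> * H2_norm u + K)" by (simp add: algebra_simps)
    also have "\<dots> \<le> \<bar>C\<bar> * H2_norm f + (B * H2_norm f / cmod (l u)) * (\<bar>C\<bar> * H2_norm u + K)"
      using t K0 VH[OF u(1)] by (intro add_left_mono mult_right_mono) auto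
    also have "\<dots> = (\<bar>C\<bar> + B / cmod (l u) * (\<bar>C\<bar> * H2_norm u + K)) * H2_norm f"
      by (simp add: algebra_simps add_divide_distrib)
    finally show "cmod (\<phi> i f) \<le> (\<bar>C\<bar> + B / cmod (l u) * (\<bar>C\<bar> * H2_norm u + K)) * H2_norm f" .
  qed
qed

lemma model_space_H2: "model_space \<theta> \<subseteq> H2"
  by (auto simp: model_space_def)

lemma model_space_subspace:
  assumes "\<theta> holomorphic_on disc" "\<And>z. z \<in> disc \<Longrightarrow> cmod (\<theta> z) \<le> 1"
  shows "H2_subspace (model_space \<theta>)"
  unfolding H2_subspace_def
proof (intro conjI ballI allI model_space_H2)
  fix f g c assume f: "f \<in> model_space \<theta>" and g: "g \<in> model_space \<theta>"
  then have H: "f \<in> H2" "g \<in> H2" by (auto simp: model_space_def)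
  then have H': "(\<lambda>z. c * g z) \<in> H2" by (intro H2_cmult)
  show "(\<lambda>z. f z + c * g z) \<in> model_space \<theta>" unfolding model_space_def
  proof (intro CollectI conjI ballI)
    show "(\<lambda>z. f z + c * g z) \<in> H2" using H H' by (intro H2_add)
    fix h assume h: "h \<in> H2"
    then have \<theta>h: "(\<lambda>z. \<theta> z * h z) \<in> H2" using H2_mult_bounded(1)[OF assms] by blast
    show "H2_inner (\<lambda>z. f z + c * g z) (\<lambda>z. \<theta> z * h z) = 0"
      using f g h by (simp add: H2_inner_add_left[OF H(1) H' \<theta>h] H2_inner_cmult_left[OF H(2) \<theta>h] model_space_def)
  qed
qed

text \<open>
  The kernel is the Szego kernel minus a multiple of \<open>\<theta>\<close> times the Szego kernel, and the latter is
  orthogonal to the model space.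
\<close>

lemma model_kernel_reproducing:
  assumes "\<theta> holomorphic_on disc" "\<And>z. z \<in> disc \<Longrightarrow> cmod (\<theta> z) \<le> 1"
    and w: "w \<in> disc" and f: "f \<in> model_space \<theta>"
  shows "H2_inner f (model_kernel \<theta> w) = f w"
proof -
  let ?s = "\<lambda>z. 1 / (1 - cnj w * z)"
  note s = szego_kernel[OF w]
  have f2: "f \<in> H2" using f by (simp add: model_space_def)
  have \<theta>s: "(\<lambda>z. \<theta> z * ?s z) \<in> H2" by (rule H2_mult_bounded(1)[OF assms(1,2) s(1)])
  have "model_kernel \<theta> w = (\<lambda>z. ?s z + (- cnj (\<theta> w)) * (\<theta> z * ?s z))"
    by (auto simp: model_kernel_def fun_eq_iff diff_divide_distrib)
  then have "H2_inner f (model_kernel \<theta> w) = H2_inner f ?s + cnj (- cnj (\<theta> w)) * H2_inner f (\<lambda>z. \<theta> z * ?s z)"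
    by (simp only: H2_inner_add_right[OF s(1) H2_cmult[OF \<theta>s] f2] H2_inner_cmult_right[OF \<theta>s f2])
  also have "H2_inner f (\<lambda>z. \<theta> z * ?s z) = 0"
  proof -
    have "H2_inner f (\<lambda>z. \<theta> z * g z) = 0" if "g \<in> H2" for g using f that by (simp add: model_space_def)
    from this[OF s(1)] show ?thesis .
  qed
  finally show ?thesis using s(2)[OF f2] by simp
qed

text \<open>
  The uniform boundedness principle, for spaces \<open>V\<close> that need not be complete. If it failed, it would
  fail on every subspace of \<open>V\<close> cut out by finitely many conditions \<open>f (w i) = 0\<close>, and for arbitrarily
  late indices, because single evaluations are bounded. Hence a given \<open>g\<close> in \<open>V\<close> can be made to vanish
  at a further, late point by adding a function of small norm that already vanishes at the earlier
  points. Iterating this from \<open>h0\<close> yields an increasing sequence \<open>r\<close> of indices and functions \<open>F m\<close>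
  with zeros at \<open>w (r i)\<close> for \<open>i < m\<close>, all within half the norm of \<open>h0\<close>. A combination of the first
  \<open>m\<close> kernels is orthogonal to \<open>F m\<close>, so it cannot be close to \<open>h0\<close>, against the completeness of the
  kernels at the points \<open>w (r i)\<close>.
\<close>

lemma overcomplete_equibounded:
  assumes \<theta>: "\<theta> holomorphic_on disc" "\<And>z. z \<in> disc \<Longrightarrow> cmod (\<theta> z) \<le> 1"
    and w: "\<And>n. w n \<in> disc"
    and oc: "overcomplete_in (model_space \<theta>) (\<lambda>n. model_kernel \<theta> (w n))"
    and V: "H2_subspace V" "V \<subseteq> model_space \<theta>"
    and pw: "\<And>f. f \<in> V \<Longrightarrow> \<exists>K. \<forall>n. cmod (c n * f (w n)) \<le> K"
  shows "equibounded_on V (\<lambda>n f. c n * f (w n))"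
proof (rule ccontr)
  assume not: "\<not> ?thesis"
  let ?\<phi> = "\<lambda>n f. c n * f (w n)"
  have VH: "f \<in> H2" if "f \<in> V" for f using V that by (auto simp: H2_subspace_def)
  have comb: "(\<lambda>z. f z + t * g z) \<in> V" if "f \<in> V" "g \<in> V" for f g t
    using V that by (auto simp: H2_subspace_def)
  define W where "W S = {f \<in> V. \<forall>i\<in>S. f (w i) = 0}" for S
  have W: "H2_subspace (W S)" for S
    using V unfolding W_def H2_subspace_def by auto
  have not_W: "\<not> equibounded_on (W S) ?\<phi>" if "finite S" for S
    using that
  proof (induction S rule: finite_induct)
    case empty
    then show ?case using not by (simp add: W_def)
  next
    case (insert a S)
    show ?case
    proof
      assume "equibounded_on (W (insert a S)) ?\<phi>"
      moreover have "W (insert a S) = {f \<in> W S. f (w a) = 0}" by (auto simp: W_def)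
      ultimately have ker: "equibounded_on {f \<in> W S. f (w a) = 0} ?\<phi>" by simp
      obtain B where B: "\<And>f. f \<in> H2 \<Longrightarrow> cmod (f (w a)) \<le> B * H2_norm f"
        using H2_eval_bounded[OF w] by blast
      have "equibounded_on (W S) ?\<phi>"
      proof (rule equibounded_on_from_kernel[OF W, where l = "\<lambda>f. f (w a)" and B = B])
        show "cmod (f (w a)) \<le> B * H2_norm f" if "f \<in> W S" for f
          using that B VH by (auto simp: W_def)
        show "\<exists>K. \<forall>i. cmod (c i * f (w i)) \<le> K" if "f \<in> W S" for f
          using that by (intro pw) (auto simp: W_def)
      qed (use ker in \<open>auto simp: linear_functional_on_def algebra_simps\<close>)
      then show False using insert.IH by blast
    qed
  qed
  have far: "\<exists>n>N. \<exists>f\<in>W S. cmod (?\<phi> n f) > C * H2_norm f" if "finite S" for S N C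
  proof (rule ccontr)
    assume "\<not> ?thesis"
    then have le: "cmod (?\<phi> n f) \<le> C * H2_norm f" if "n > N" "f \<in> W S" for n f
      using that by (meson linorder_not_less)
    have "\<exists>B. 0 \<le> B \<and> (\<forall>f\<in>H2. cmod (f (w n)) \<le> B * H2_norm f)" for n
      by (rule H2_eval_bounded[OF w[of n]]) auto
    then have "\<forall>n. \<exists>B. 0 \<le> B \<and> (\<forall>f\<in>H2. cmod (f (w n)) \<le> B * H2_norm f)" by (rule allI)
    from choice[OF this] obtain B
      where BB: "\<forall>n. 0 \<le> B n \<and> (\<forall>f\<in>H2. cmod (f (w n)) \<le> B n * H2_norm f)" by (rule exE)
    have B: "\<And>n. 0 \<le> B n" "\<And>n f. f \<in> H2 \<Longrightarrow> cmod (f (w n)) \<le> B n * H2_norm f"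
      using BB by simp_all
    define D where "D = \<bar>C\<bar> + (\<Sum>n\<le>N. cmod (c n) * B n)"
    have "cmod (?\<phi> n f) \<le> D * H2_norm f" if f: "f \<in> W S" for n f
    proof -
      have fH: "f \<in> H2" using f VH by (auto simp: W_def)
      have nn: "0 \<le> (\<Sum>n\<le>N. cmod (c n) * B n)" using B(1) by (intro sum_nonneg) auto
      show ?thesis
      proof (cases "n > N")
        case True
        have "C \<le> D" using nn by (simp add: D_def)
        then have "C * H2_norm f \<le> D * H2_norm f" using fH by (intro mult_right_mono) auto
        then show ?thesis using le[OF True f] by linarith
      next
        case False
        have "cmod (c n) * B n \<le> (\<Sum>n\<le>N. cmod (c n) * B n)"
          using False B(1) by (intro member_le_sum) auto
        then have d: "cmod (c n) * B n \<le> D" by (simp add: D_def)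
        have "cmod (?\<phi> n f) \<le> cmod (c n) * (B n * H2_norm f)"
          using B(2)[OF fH, of n] by (simp add: norm_mult mult_left_mono)
        also have "\<dots> \<le> D * H2_norm f" using d fH by (simp add: mult_right_mono flip: mult.assoc)
        finally show ?thesis .
      qed
    qed
    then show False using not_W[OF that] unfolding equibounded_on_def by blast
  qed
  have correct: "\<exists>n>N. \<exists>h\<in>W S. H2_norm h \<le> \<epsilon> \<and> g (w n) + h (w n) = 0"
    if S: "finite S" and g: "g \<in> V" and \<epsilon>: "\<epsilon> > 0" for S g \<epsilon> N
  proof -
    obtain K where K: "\<And>n. cmod (?\<phi> n g) \<le> K" using pw[OF g] by blast
    obtain n f where n: "n > N" and f: "f \<in> W S" and gt: "cmod (?\<phi> n f) > K / \<epsilon> * H2_norm f"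
      using far[OF S] by blast
    have fH: "f \<in> H2" using f VH by (auto simp: W_def)
    have K0: "0 \<le> K" using K order_trans[OF norm_ge_zero] by blast
    have "0 \<le> K / \<epsilon> * H2_norm f" using K0 \<epsilon> fH by simp
    with gt have nz: "c n \<noteq> 0" "f (w n) \<noteq> 0" by auto
    define t where "t = - (g (w n) / f (w n))"
    define h where "h = (\<lambda>z. t * f z)"
    have "h \<in> W S" using W[of S] f unfolding H2_subspace_def h_def W_def
      using comb[of f f "t - 1"] by (auto simp: algebra_simps)
    moreover have "g (w n) + h (w n) = 0" using nz by (simp add: h_def t_def)
    moreover have "H2_norm h \<le> \<epsilon>"
    proof -
      have "cmod (?\<phi> n f) * cmod t = cmod (?\<phi> n g)" using nz by (simp add: t_def norm_mult norm_divide)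
      then have 1: "cmod (?\<phi> n f) * cmod t \<le> K" using K by simp
      have 2: "K * H2_norm f \<le> \<epsilon> * cmod (?\<phi> n f)" using gt \<epsilon> by (simp add: field_simps)
      have p: "0 < cmod (?\<phi> n f)" using nz by simp
      have "cmod (?\<phi> n f) * (cmod t * H2_norm f) \<le> K * H2_norm f"
        using mult_right_mono[OF 1, of "H2_norm f"] fH by (simp add: mult.assoc)
      also have "\<dots> \<le> cmod (?\<phi> n f) * \<epsilon>" using 2 by (simp add: mult.commute)
      finally have "cmod t * H2_norm f \<le> \<epsilon>" using p mult_le_cancel_left_pos by blast
      then show ?thesis using H2_norm_cmult[OF fH] by (simp add: h_def)
    qed
    ultimately show ?thesis using n by blast
  qed
  obtain h0 where h0: "h0 \<in> V" "H2_norm h0 > 0"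
  proof -
    obtain n f where f: "f \<in> V" "cmod (?\<phi> n f) > 0"
      using far[of "{}" 0 0] by (auto simp: W_def)
    then have "f (w n) \<noteq> 0" by auto
    then have "H2_norm f \<noteq> 0" using H2_norm_eq_0[OF VH[OF f(1)] _ w] by blast
    then show ?thesis using that f VH by (simp add: order_less_le)
  qed
  (* A state is a function, the finite set of indices at which it vanishes, and the last index added. *)
  define \<delta> where "\<delta> = H2_norm h0"
  have \<delta>: "\<delta> > 0" using h0 by (simp add: \<delta>_def)
  define P where "P m s = (case s of (f, S, n) \<Rightarrow> finite S \<and> f \<in> W S \<and>
      H2_norm (\<lambda>z. f z - h0 z) \<le> \<delta> / 2 * (1 - (1/2) ^ m))"
    for m :: nat and s :: "(complex \<Rightarrow> complex) \<times> nat set \<times> nat"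
  define Q where "Q s s' = (case (s, s') of ((f, S, n), (f', S', n')) \<Rightarrow> n < n' \<and> S' = insert n' S)"
    for s s' :: "(complex \<Rightarrow> complex) \<times> nat set \<times> nat"
  have "\<exists>s. \<forall>m. P m (s m) \<and> Q (s m) (s (Suc m))"
  proof (rule dependent_nat_choice)
    have "P 0 (h0, {}, 0)" using h0 H2_norm_const[of 0] by (simp add: P_def W_def)
    then show "\<exists>s. P 0 s" by blast
    fix s m assume "P m s"
    obtain f S n where s: "s = (f, S, n)" using prod_cases3 by blast
    have S: "finite S" and f: "f \<in> W S" and nf: "H2_norm (\<lambda>z. f z - h0 z) \<le> \<delta> / 2 * (1 - (1/2) ^ m)"
      using \<open>P m s\<close> by (auto simp: P_def s)
    have fV: "f \<in> V" using f by (simp add: W_def)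
    obtain n' h where n': "n' > n" and h: "h \<in> W S" "H2_norm h \<le> \<delta> / 2 * (1/2) ^ Suc m" "f (w n') + h (w n') = 0"
      using correct[OF S fV, of "\<delta> / 2 * (1/2) ^ Suc m" n] \<delta> by auto
    define f' where "f' = (\<lambda>z. f z + h z)"
    have hV: "h \<in> V" using h by (simp add: W_def)
    have "f' \<in> W (insert n' S)"
      using comb[OF fV hV, of 1] h f by (auto simp: W_def f'_def)
    moreover have "H2_norm (\<lambda>z. f' z - h0 z) \<le> \<delta> / 2 * (1 - (1/2) ^ Suc m)"
    proof -
      have "(\<lambda>z. f' z - h0 z) = (\<lambda>z. (f z - h0 z) + h z)" by (auto simp: f'_def)
      then have "H2_norm (\<lambda>z. f' z - h0 z) \<le> H2_norm (\<lambda>z. f z - h0 z) + H2_norm h"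
        using H2_norm_triangle[OF H2_diff[OF VH[OF fV] VH[OF h0(1)]] VH[OF hV]] by simp
      also have "\<dots> \<le> \<delta> / 2 * (1 - (1/2) ^ Suc m)" using nf h(2) by (simp add: algebra_simps)
      finally show ?thesis .
    qed
    ultimately have "P (Suc m) (f', insert n' S, n') \<and> Q s (f', insert n' S, n')"
      using S n' by (simp add: P_def Q_def s)
    then show "\<exists>s'. P (Suc m) s' \<and> Q s s'" by blast
  qed
  then obtain s where s: "\<And>m. P m (s m)" "\<And>m. Q (s m) (s (Suc m))" by blast
  define F where "F m = fst (s m)" for m
  define T where "T m = fst (snd (s m))" for m
  define r where "r m = snd (snd (s (Suc m)))" for m
  have sm: "strict_mono r"
    unfolding strict_mono_Suc_iff
  proof
    fix n show "r n < r (Suc n)"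
      using s(2)[of "Suc n"] by (auto simp: r_def Q_def split: prod.splits)
  qed
  have F: "F m \<in> W (T m)" "H2_norm (\<lambda>z. F m z - h0 z) \<le> \<delta> / 2 * (1 - (1/2) ^ m)" for m
    using s(1)[of m] by (auto simp: P_def F_def T_def split: prod.splits)
  have T_Suc: "T (Suc m) = insert (r m) (T m)" for m
    using s(2)[of m] by (auto simp: Q_def T_def r_def split: prod.splits)
  have T: "r ` {..<m} \<subseteq> T m" for m
    by (induction m) (auto simp: T_Suc lessThan_Suc)
  have zero: "F m (w (r i)) = 0" if "i < m" for i m
    using F(1)[of m] T[of m] that by (auto simp: W_def)
  (* Completeness along r gives a combination ?p of m kernels close to h0; F m is orthogonal to it. *)
  let ?k = "\<lambda>i. model_kernel \<theta> (w (r i))"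
  have k: "?k i \<in> H2" for i using oc model_space_H2 unfolding overcomplete_in_def by blast
  have "complete_seq_in (model_space \<theta>) ((\<lambda>n. model_kernel \<theta> (w n)) \<circ> r)"
    using oc sm unfolding overcomplete_in_def by blast
  moreover have "h0 \<in> model_space \<theta>" "\<delta> / 4 > 0" using h0 V \<delta> by auto
  ultimately obtain m a where app: "H2_norm (\<lambda>z. h0 z - (\<Sum>i<m. a i * ?k i z)) < \<delta> / 4"
    unfolding complete_seq_in_def by fastforce
  let ?p = "\<lambda>z. \<Sum>i<m. a i * ?k i z"
  have pH: "?p \<in> H2" by (intro H2_sum H2_cmult k) auto
  have FV: "F m \<in> V" using F(1) by (simp add: W_def)
  note FH = VH[OF FV] and hH = VH[OF h0(1)]
  have "H2_inner ?p (F m) = (\<Sum>i<m. a i * H2_inner (?k i) (F m))"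
    by (subst H2_inner_sum_left) (auto intro!: H2_cmult k FH sum.cong H2_inner_cmult_left)
  also have "\<dots> = 0"
  proof (intro sum.neutral ballI)
    fix i assume "i \<in> {..<m}"
    have "H2_inner (?k i) (F m) = cnj (H2_inner (F m) (?k i))" by (rule H2_inner_commute[OF FH k])
    also have "H2_inner (F m) (?k i) = F m (w (r i))"
      using FV V(2) by (intro model_kernel_reproducing \<theta> w) auto
    finally show "a i * H2_inner (?k i) (F m) = 0" using zero \<open>i \<in> {..<m}\<close> by simp
  qed
  finally have p0: "H2_inner ?p (F m) = 0" .
  let ?e = "\<lambda>z. F m z - h0 z"
  have eH: "?e \<in> H2" by (intro H2_diff FH hH)
  have e: "H2_norm ?e \<le> \<delta> / 2"
  proof -
    have "\<delta> / 2 * (1 - (1/2) ^ m) \<le> \<delta> / 2 * 1" using \<delta> by (intro mult_left_mono) auto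
    then show ?thesis using F(2)[of m] by simp
  qed
  have Fe: "F m = (\<lambda>z. h0 z + ?e z)" by auto
  have nF: "H2_norm (F m) \<le> 3 / 2 * \<delta>"
    using H2_norm_triangle[OF hH eH] e by (simp add: \<delta>_def)
  have "H2_inner (\<lambda>z. h0 z + (-1) * ?p z) (F m) = H2_inner h0 (F m)"
    by (simp only: H2_inner_add_left[OF hH H2_cmult[OF pH] FH] H2_inner_cmult_left[OF pH FH] p0) simp
  then have "cmod (H2_inner h0 (F m)) \<le> H2_norm (\<lambda>z. h0 z - ?p z) * H2_norm (F m)"
    using H2_cauchy_schwarz[OF H2_diff[OF hH pH] FH] by simp
  also have "\<dots> \<le> \<delta> / 4 * (3 / 2 * \<delta>)"
    using app nF H2_norm_nonneg[OF H2_diff[OF hH pH]] H2_norm_nonneg[OF FH] \<delta> by (intro mult_mono) auto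
  finally have up: "cmod (H2_inner h0 (F m)) \<le> 3 / 8 * \<delta>\<^sup>2" by (simp add: power2_eq_square)
  have "H2_inner h0 (F m) = H2_inner h0 h0 + H2_inner h0 ?e"
    using H2_inner_add_right[OF hH eH hH] by simp
  also have "H2_inner h0 h0 = of_real (\<delta>\<^sup>2)" by (simp only: H2_inner_self[OF hH] \<delta>_def)
  finally have eq: "H2_inner h0 (F m) = of_real (\<delta>\<^sup>2) + H2_inner h0 ?e" .
  have "cmod (H2_inner h0 ?e) \<le> \<delta> * (\<delta> / 2)"
    using H2_cauchy_schwarz[OF hH eH] mult_left_mono[OF e, of \<delta>] \<delta>
    unfolding \<delta>_def[symmetric] by linarith
  moreover have "\<delta>\<^sup>2 \<le> cmod (H2_inner h0 (F m)) + cmod (H2_inner h0 ?e)"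
    using norm_triangle_ineq4[of "H2_inner h0 (F m)" "H2_inner h0 ?e"] by (simp add: eq norm_power)
  ultimately have "\<delta>\<^sup>2 \<le> 3 / 8 * \<delta>\<^sup>2 + \<delta>\<^sup>2 / 2" using up by (simp add: power2_eq_square)
  then show False using \<delta> by simp
qed

section \<open>Derivatives at the boundary point\<close>

definition analytic_model_functions :: "(complex \<Rightarrow> complex) \<Rightarrow> complex \<Rightarrow> nat \<Rightarrow> (complex \<Rightarrow> complex) set" where
  "analytic_model_functions \<theta> \<zeta> N =
     {f \<in> model_space \<theta>. f analytic_on {\<zeta>} \<and> (\<forall>j<N. (deriv ^^ j) f \<zeta> = 0)}"

lemma higher_deriv_comb_at:
  fixes f :: "complex \<Rightarrow> complex"
  assumes "f analytic_on {x}" "g analytic_on {x}"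
  shows "(deriv ^^ j) (\<lambda>z. f z + c * g z) x = (deriv ^^ j) f x + c * (deriv ^^ j) g x"
  using assms by (simp add: higher_deriv_add_at higher_deriv_cmult' analytic_on_mult)

lemma analytic_model_functions_subspace:
  assumes "\<theta> holomorphic_on disc" "\<And>z. z \<in> disc \<Longrightarrow> cmod (\<theta> z) \<le> 1"
  shows "H2_subspace (analytic_model_functions \<theta> \<zeta> N)"
  using model_space_subspace[OF assms] model_space_H2[of \<theta>]
  unfolding H2_subspace_def analytic_model_functions_def
  by (auto simp: higher_deriv_comb_at intro!: analytic_intros)

text \<open>
  The power series of \<open>f\<close> at \<open>\<zeta>\<close> starts with the term of degree \<open>N\<close>; dividing it by
  \<open>(z - \<zeta>) ^ N\<close> leaves a function that is continuous at \<open>\<zeta>\<close>. The convergence of \<open>w\<close> may be tangential.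
\<close>

lemma quotient_tendsto_higher_deriv:
  fixes f :: "complex \<Rightarrow> complex"
  assumes f: "f analytic_on {\<zeta>}" "\<And>j. j < N \<Longrightarrow> (deriv ^^ j) f \<zeta> = 0"
    and w: "w \<longlonglongrightarrow> \<zeta>" "\<And>n. w n \<noteq> \<zeta>"
  shows "(\<lambda>n. 1 / (w n - \<zeta>) ^ N * f (w n)) \<longlonglongrightarrow> (deriv ^^ N) f \<zeta> / fact N"
proof -
  obtain r where r: "r > 0" "f holomorphic_on ball \<zeta> r"
    using f(1) by (auto simp: analytic_on_def)
  define a where "a n = (deriv ^^ n) f \<zeta> / fact n" for n
  have s: "(\<lambda>n. a n * (z - \<zeta>) ^ n) sums f z" if "z \<in> ball \<zeta> r" for z
    using holomorphic_power_series[OF r(2) that] by (simp add: a_def)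
  define g where "g z = (\<Sum>n. a (n + N) * (z - \<zeta>) ^ n)" for z
  have g: "(\<lambda>n. a (n + N) * (z - \<zeta>) ^ n) sums g z \<and> f z = (z - \<zeta>) ^ N * g z" if z: "z \<in> ball \<zeta> r" for z
  proof (cases "z = \<zeta>")
    case True
    have "(\<lambda>n. a (n + N) * (z - \<zeta>) ^ n) sums a N" using True powser_sums_zero[of "\<lambda>n. a (n + N)"] by simp
    moreover have "f \<zeta> = 0 ^ N * a N"
    proof (cases N)
      case 0 then show ?thesis by (simp add: a_def)
    next
      case (Suc k) then show ?thesis using f(2)[of 0] by simp
    qed
    ultimately show ?thesis using True by (simp add: g_def sums_iff)
  next
    case False
    have "(\<lambda>n. a (n + N) * (z - \<zeta>) ^ (n + N)) sums (f z - (\<Sum>n<N. a n * (z - \<zeta>) ^ n))"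
      by (rule sums_split_initial_segment[OF s[OF z]])
    moreover have "(\<Sum>n<N. a n * (z - \<zeta>) ^ n) = 0" using f(2) by (intro sum.neutral) (auto simp: a_def)
    ultimately have "(\<lambda>n. a (n + N) * (z - \<zeta>) ^ (n + N)) sums f z" by simp
    from sums_divide[OF this, of "(z - \<zeta>) ^ N"]
    have "(\<lambda>n. a (n + N) * (z - \<zeta>) ^ n) sums (f z / (z - \<zeta>) ^ N)"
      using False by (simp add: power_add)
    then show ?thesis using False by (auto simp: g_def sums_iff)
  qed
  have "g holomorphic_on ball \<zeta> r" using power_series_holomorphic[of \<zeta> r "\<lambda>n. a (n + N)" g] g by blast
  then have "isCont g \<zeta>"
    using r by (meson centre_in_ball continuous_on_eq_continuous_at holomorphic_on_imp_continuous_on open_ball)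
  then have "(\<lambda>n. g (w n)) \<longlonglongrightarrow> g \<zeta>" using w(1) by (rule isCont_tendsto_compose)
  moreover have "g \<zeta> = a N" using powser_sums_zero[of "\<lambda>n. a (n + N)"] by (simp add: g_def sums_iff)
  moreover have "\<forall>\<^sub>F n in sequentially. g (w n) = 1 / (w n - \<zeta>) ^ N * f (w n)"
  proof -
    have "\<forall>\<^sub>F n in sequentially. w n \<in> ball \<zeta> r" using w(1) r by (intro topological_tendstoD) auto
    then show ?thesis by eventually_elim (use g w(2) in auto)
  qed
  ultimately show ?thesis using Lim_transform_eventually by (fastforce simp: a_def)
qed

text \<open>
  On the functions that vanish to order \<open>N\<close> at \<open>\<zeta>\<close>, the \<open>N\<close>-th derivative is, up to a factorial, the
  limit of the scaled evaluations at the points \<open>w n\<close>, to which uniform boundedness applies. The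
  functions vanishing to order \<open>m + 1\<close> are the kernel of the \<open>m\<close>-th derivative on those vanishing to
  order \<open>m\<close>, and there this functional is bounded by the same argument; so the bound for the \<open>N\<close>-th
  derivative descends from \<open>m + 1\<close> to \<open>m\<close>, down to 0.
\<close>

lemma overcomplete_boundary_derivative_bound:
  assumes \<theta>: "\<theta> holomorphic_on disc" "\<And>z. z \<in> disc \<Longrightarrow> cmod (\<theta> z) \<le> 1"
    and w: "\<And>n. w n \<in> disc" "w \<longlonglongrightarrow> \<zeta>" "\<zeta> \<in> sphere 0 1"
    and oc: "overcomplete_in (model_space \<theta>) (\<lambda>n. model_kernel \<theta> (w n))"
  obtains C where "\<And>f. f \<in> model_space \<theta> \<Longrightarrow> f analytic_on {\<zeta>} \<Longrightarrow> cmod ((deriv ^^ N) f \<zeta>) \<le> C * H2_norm f"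
proof -
  let ?V = "analytic_model_functions \<theta> \<zeta>"
  let ?\<psi> = "\<lambda>N f. (deriv ^^ N) f \<zeta>"
  note sub = analytic_model_functions_subspace[OF \<theta>, of \<zeta>]
  have VH: "f \<in> H2" if "f \<in> ?V N" for f N using sub that by (auto simp: H2_subspace_def)
  have wn: "w n \<noteq> \<zeta>" for n using w(1)[of n] w(3) by auto
  have lin: "linear_functional_on (?V N) (?\<psi> M)" for N M
    unfolding linear_functional_on_def analytic_model_functions_def by (auto simp: higher_deriv_comb_at)
  have top: "\<exists>C. \<forall>f\<in>?V N. cmod (?\<psi> N f) \<le> C * H2_norm f" for N
  proof -
    have lim: "(\<lambda>n. 1 / (w n - \<zeta>) ^ N * f (w n)) \<longlonglongrightarrow> ?\<psi> N f / fact N" if "f \<in> ?V N" for f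
      using that w wn by (intro quotient_tendsto_higher_deriv) (auto simp: analytic_model_functions_def)
    have "equibounded_on (?V N) (\<lambda>n f. 1 / (w n - \<zeta>) ^ N * f (w n))"
    proof (rule overcomplete_equibounded[OF \<theta> w(1) oc sub])
      show "?V N \<subseteq> model_space \<theta>" by (auto simp: analytic_model_functions_def)
      fix f assume "f \<in> ?V N"
      from lim[OF this] have "Bseq (\<lambda>n. 1 / (w n - \<zeta>) ^ N * f (w n))" by (rule convergent_imp_Bseq[OF convergentI])
      then show "\<exists>K. \<forall>n. cmod (1 / (w n - \<zeta>) ^ N * f (w n)) \<le> K" by (auto simp: Bseq_def)
    qed
    then obtain C where C: "\<And>n f. f \<in> ?V N \<Longrightarrow> cmod (1 / (w n - \<zeta>) ^ N * f (w n)) \<le> C * H2_norm f"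
      by (auto simp: equibounded_on_def)
    have "cmod (?\<psi> N f) \<le> fact N * C * H2_norm f" if f: "f \<in> ?V N" for f
    proof -
      have "cmod (?\<psi> N f / fact N) \<le> C * H2_norm f"
        using C[OF f] by (intro LIMSEQ_le_const2[OF tendsto_norm[OF lim[OF f]]]) auto
      then show ?thesis by (simp add: norm_divide field_simps)
    qed
    then show ?thesis by blast
  qed
  have "equibounded_on (?V (N - k)) (\<lambda>_::unit. ?\<psi> N)" if "k \<le> N" for k
    using that
  proof (induction k)
    case 0
    then show ?case using top[of N] by (auto simp: equibounded_on_def)
  next
    case (Suc k)
    define m where "m = N - Suc k"
    have m: "N - k = Suc m" using Suc.prems by (simp add: m_def)
    obtain B where B: "\<And>f. f \<in> ?V m \<Longrightarrow> cmod (?\<psi> m f) \<le> B * H2_norm f" using top by blast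
    have "?V (Suc m) = {f \<in> ?V m. ?\<psi> m f = 0}"
      by (auto simp: analytic_model_functions_def less_Suc_eq)
    then have ker: "equibounded_on {f \<in> ?V m. ?\<psi> m f = 0} (\<lambda>_::unit. ?\<psi> N)"
      using Suc m by simp
    show ?case unfolding m_def[symmetric]
      by (rule equibounded_on_from_kernel[OF sub lin B lin _ ker]) auto
  qed
  from this[of N] obtain C where "\<And>f. f \<in> ?V 0 \<Longrightarrow> cmod (?\<psi> N f) \<le> C * H2_norm f"
    by (auto simp: equibounded_on_def)
  then show ?thesis using that by (auto simp: analytic_model_functions_def)
qed

text \<open>
  Evaluations are pointwise bounded on the bounded functions of the model space, hence uniformly
  bounded there by some \<open>C\<close>. The kernel at \<open>w n\<close> is such a function, and its value at \<open>w n\<close> is the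
  square of its norm; so its norm is at most \<open>C\<close>.
\<close>

lemma overcomplete_kernel_norm_bound:
  assumes \<theta>: "\<theta> holomorphic_on disc" "\<And>z. z \<in> disc \<Longrightarrow> cmod (\<theta> z) \<le> 1"
    and w: "\<And>n. w n \<in> disc"
    and oc: "overcomplete_in (model_space \<theta>) (\<lambda>n. model_kernel \<theta> (w n))"
  obtains C where "\<And>n. 1 - (cmod (\<theta> (w n)))\<^sup>2 \<le> C * (1 - (cmod (w n))\<^sup>2)"
proof -
  let ?V = "{f \<in> model_space \<theta>. \<exists>K. \<forall>z\<in>disc. cmod (f z) \<le> K}"
  let ?k = "\<lambda>n. model_kernel \<theta> (w n)"
  have sub: "H2_subspace ?V"
  proof -
    have "\<exists>K. \<forall>z\<in>disc. cmod (f z + c * g z) \<le> K"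
      if "\<forall>z\<in>disc. cmod (f z) \<le> K" "\<forall>z\<in>disc. cmod (g z) \<le> L" for f g c K L
    proof (intro exI ballI)
      fix z assume z: "z \<in> disc"
      have "cmod (f z + c * g z) \<le> cmod (f z) + cmod c * cmod (g z)"
        by (metis norm_mult norm_triangle_ineq)
      also have "\<dots> \<le> K + cmod c * L" using that z by (intro add_mono mult_left_mono) auto
      finally show "cmod (f z + c * g z) \<le> K + cmod c * L" .
    qed
    then show ?thesis using model_space_subspace[OF \<theta>] unfolding H2_subspace_def by blast
  qed
  have "equibounded_on ?V (\<lambda>n f. 1 * f (w n))"
  proof (rule overcomplete_equibounded[OF \<theta> w oc sub])
    fix f assume "f \<in> ?V"
    then obtain K where "\<forall>z\<in>disc. cmod (f z) \<le> K" by blast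
    then have "\<forall>n. cmod (1 * f (w n)) \<le> K" using w by auto
    then show "\<exists>K. \<forall>n. cmod (1 * f (w n)) \<le> K" by blast
  qed auto
  then obtain C where C: "\<And>n f. f \<in> ?V \<Longrightarrow> cmod (f (w n)) \<le> C * H2_norm f"
    unfolding equibounded_on_def mult_1 by blast
  have "1 - (cmod (\<theta> (w n)))\<^sup>2 \<le> C\<^sup>2 * (1 - (cmod (w n))\<^sup>2)" for n
  proof -
    have kM: "?k n \<in> model_space \<theta>" using oc by (simp add: overcomplete_in_def)
    then have kH: "?k n \<in> H2" using model_space_H2 by blast
    define q where "q = 1 - (cmod (w n))\<^sup>2"
    have wn: "cmod (w n) < 1" using w[of n] by simp
    have q: "q > 0" using wn by (simp add: q_def abs_square_less_1)
    have kb: "cmod (?k n z) \<le> 2 / (1 - cmod (w n))" if z: "z \<in> disc" for z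
    proof -
      have "cmod (1 - cnj (\<theta> (w n)) * \<theta> z) \<le> 1 + cmod (\<theta> (w n)) * cmod (\<theta> z)"
        using norm_triangle_ineq4[of 1 "cnj (\<theta> (w n)) * \<theta> z"] by (simp add: norm_mult)
      also have "\<dots> \<le> 2" using mult_le_one[OF \<theta>(2)[OF w[of n]] _ \<theta>(2)[OF z]] by simp
      finally have num: "cmod (1 - cnj (\<theta> (w n)) * \<theta> z) \<le> 2" .
      have "cmod (w n) * cmod z \<le> cmod (w n)" using z by (intro mult_left_le) auto
      moreover have "1 - cmod (w n) * cmod z \<le> cmod (1 - cnj (w n) * z)"
        using norm_triangle_ineq2[of 1 "cnj (w n) * z"] by (simp add: norm_mult)
      ultimately have den: "1 - cmod (w n) \<le> cmod (1 - cnj (w n) * z)" by simp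
      show ?thesis unfolding model_kernel_def norm_divide
        using num den wn by (intro frac_le) auto
    qed
    have kV: "?k n \<in> ?V" using kM kb by blast
    have e': "?k n (w n) = complex_of_real ((H2_norm (?k n))\<^sup>2)"
      using model_kernel_reproducing[OF \<theta> w kM] H2_inner_self[OF kH] by simp
    have "?k n (w n) = complex_of_real ((1 - (cmod (\<theta> (w n)))\<^sup>2) / q)"
      by (simp add: model_kernel_def q_def mult.commute flip: complex_norm_square)
    with e' have e: "(H2_norm (?k n))\<^sup>2 = (1 - (cmod (\<theta> (w n)))\<^sup>2) / q"
      by (simp only: of_real_eq_iff)
    have "(H2_norm (?k n))\<^sup>2 \<le> C * H2_norm (?k n)"
      using C[OF kV, of n] unfolding e' norm_of_real by simp
    then have "H2_norm (?k n) \<le> C \<or> H2_norm (?k n) = 0"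
      using H2_norm_nonneg[OF kH] by (auto simp: power2_eq_square mult_le_cancel_right)
    then have "(H2_norm (?k n))\<^sup>2 \<le> C\<^sup>2" using H2_norm_nonneg[OF kH] by (auto intro: power_mono)
    then show ?thesis using q unfolding e q_def[symmetric] by (simp add: field_simps)
  qed
  then show ?thesis using that by blast
qed

section \<open>Test functions from divisors\<close>

text \<open>
  For bounded \<open>\<theta>\<close> the inequality \<open>cmod (\<theta> z) \<le> cmod (t z)\<close> is divisibility: the quotient is
  bounded, and as \<open>t\<close> has only finitely many zeros its singularities are removable.
\<close>

definition divides_inner :: "(complex \<Rightarrow> complex) \<Rightarrow> (complex \<Rightarrow> complex) \<Rightarrow> bool" where
  "divides_inner t \<theta> \<longleftrightarrow> t holomorphic_on disc \<and> finite {z \<in> disc. t z = 0} \<and>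
     (\<forall>z\<in>disc. cmod (\<theta> z) \<le> cmod (t z) \<and> cmod (t z) \<le> 1)"

lemma divides_inner_cofactor:
  assumes \<theta>: "\<theta> holomorphic_on disc" and t: "divides_inner t \<theta>"
  obtains u where "u holomorphic_on disc" "\<And>z. z \<in> disc \<Longrightarrow> cmod (u z) \<le> 1"
    "\<And>z. z \<in> disc \<Longrightarrow> \<theta> z = t z * u z"
proof -
  define X where "X = {z \<in> disc. t z = 0}"
  have X: "finite X" "X \<subseteq> disc" and hol: "t holomorphic_on disc"
    and le: "\<And>z. z \<in> disc \<Longrightarrow> cmod (\<theta> z) \<le> cmod (t z)"
    using t by (auto simp: X_def divides_inner_def)
  have q: "cmod (\<theta> z / t z) \<le> 1" if "z \<in> disc" for z
    using le[OF that] by (cases "t z = 0") (auto simp: norm_divide divide_le_eq_1)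
  have "\<exists>u. u holomorphic_on disc \<and> (\<forall>z\<in>disc - X. u z = \<theta> z / t z)"
  proof (rule removable_singularities)
    show "(\<lambda>z. \<theta> z / t z) holomorphic_on disc - X"
      by (intro holomorphic_intros holomorphic_on_subset[OF \<theta>] holomorphic_on_subset[OF hol]) (auto simp: X_def)
    fix z assume "z \<in> X"
    then have "\<forall>\<^sub>F x in at z. x \<in> disc" using X(2) by (intro eventually_at_in_open') auto
    then show "(\<lambda>z. \<theta> z / t z) \<in> O[at z](\<lambda>_. 1)"
      by (intro bigoI[of _ 1]) (use q in \<open>auto elim!: eventually_mono simp del: norm_divide\<close>)
  qed (use X in auto)
  then obtain u where u: "u holomorphic_on disc" "\<And>z. z \<in> disc - X \<Longrightarrow> u z = \<theta> z / t z" by blast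
  have "\<theta> z = t z * u z" if z: "z \<in> disc" for z
    using u(2)[of z] le[OF z] z by (cases "z \<in> X") (auto simp: X_def)
  moreover have "cmod (u z) \<le> 1" if z: "z \<in> disc" for z
  proof -
    have "isCont u z" using u(1) z
      by (meson continuous_on_eq_continuous_at holomorphic_on_imp_continuous_on open_ball)
    then have "(u \<longlongrightarrow> u z) (at z)" by (simp add: isCont_def)
    moreover have "\<forall>\<^sub>F x in at z. cmod (u x) \<le> 1"
    proof -
      have "open (disc - (X - {z}))" using X(1) by (intro open_Diff finite_imp_closed) auto
      then have "\<forall>\<^sub>F x in at z. x \<in> disc - (X - {z}) - {z}" using z by (intro eventually_at_in_open) auto
      then show ?thesis by eventually_elim (use u(2) q in auto)
    qed
    ultimately show ?thesis by (intro Lim_norm_ubound[of "at z" u]) auto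
  qed
  ultimately show ?thesis using that u(1) by blast
qed

text \<open>
  If \<open>\<theta> = t * u\<close>, then \<open>1 = H2_norm \<theta> \<le> H2_norm t \<le> 1\<close>, since multiplication by \<open>u\<close> is a
  contraction. In this integrated form \<open>t\<close> inherits the unimodular boundary values of \<open>\<theta>\<close>.
\<close>

lemma divides_inner_norm:
  assumes \<theta>: "\<theta> holomorphic_on disc" "H2_norm \<theta> = 1" and t: "divides_inner t \<theta>"
  shows "t \<in> H2" "H2_norm t = 1"
proof -
  have hol: "t holomorphic_on disc" and le: "\<And>z. z \<in> disc \<Longrightarrow> cmod (t z) \<le> 1"
    using t by (auto simp: divides_inner_def)
  note t2 = H2_bounded[OF hol le]
  show "t \<in> H2" by (rule t2(1))
  obtain u where u: "u holomorphic_on disc" "\<And>z. z \<in> disc \<Longrightarrow> cmod (u z) \<le> 1"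
    "\<And>z. z \<in> disc \<Longrightarrow> \<theta> z = t z * u z" using divides_inner_cofactor[OF \<theta>(1) t] by blast
  have "taylor_coeff \<theta> = taylor_coeff (\<lambda>z. u z * t z)"
    using u by (intro taylor_coeff_cong holomorphic_intros hol) (auto simp: mult.commute)
  then have "H2_norm \<theta> = H2_norm (\<lambda>z. u z * t z)" by (simp add: H2_norm_def)
  also have "\<dots> \<le> 1 * H2_norm t" by (rule H2_mult_bounded(2)[OF u(1,2) t2(1)])
  finally show "H2_norm t = 1" using \<theta>(2) t2(2) by simp
qed

text \<open>
  Multiplication by \<open>t\<close> is a contraction that preserves the norm of the constant 1, so it must preserve
  the inner product of 1 with \<open>h\<close>, which is zero. Concretely, comparing the norms of \<open>t * (1 + a * h)\<close>
  and \<open>1 + a * h\<close> for \<open>a = s * q\<close>, where \<open>q\<close> is the inner product in question, gives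
  \<open>2 * s * (cmod q)\<^sup>2 \<le> O(s\<^sup>2)\<close> as \<open>s\<close> tends to 0.
\<close>

lemma inner_multiplier_orthogonal:
  assumes t: "t holomorphic_on disc" "\<And>z. z \<in> disc \<Longrightarrow> cmod (t z) \<le> 1" "H2_norm t = 1"
    and h: "h \<in> H2" "h 0 = 0"
  shows "H2_inner t (\<lambda>z. t z * h z) = 0"
proof (rule ccontr)
  assume nz: "H2_inner t (\<lambda>z. t z * h z) \<noteq> 0"
  define q where "q = H2_inner t (\<lambda>z. t z * h z)"
  have tH: "t \<in> H2" by (rule H2_bounded[OF t(1,2)])
  have thH: "(\<lambda>z. t z * h z) \<in> H2" by (rule H2_mult_bounded[OF t(1,2) h(1)])
  have main: "2 * s * (cmod q)\<^sup>2 \<le> s\<^sup>2 * (cmod q)\<^sup>2 * (H2_norm h)\<^sup>2" if s: "s > 0" for s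
  proof -
    define a where "a = of_real s * q"
    have aH: "(\<lambda>z. a * h z) \<in> H2" and athH: "(\<lambda>z. a * (t z * h z)) \<in> H2"
      using h(1) thH by (auto intro: H2_cmult)
    have oneH: "(\<lambda>z. 1 + a * h z) \<in> H2" by (intro H2_add H2_const aH)
    have "H2_norm (\<lambda>z. t z * (1 + a * h z)) \<le> 1 * H2_norm (\<lambda>z. 1 + a * h z)"
      by (rule H2_mult_bounded(2)[OF t(1,2) oneH])
    moreover have "(\<lambda>z. t z * (1 + a * h z)) = (\<lambda>z. t z + a * (t z * h z))" by (auto simp: algebra_simps)
    ultimately have "H2_norm (\<lambda>z. t z + a * (t z * h z)) \<le> H2_norm (\<lambda>z. 1 + a * h z)" by simp
    then have "(H2_norm (\<lambda>z. t z + a * (t z * h z)))\<^sup>2 \<le> (H2_norm (\<lambda>z. 1 + a * h z))\<^sup>2"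
      by (intro power_mono H2_norm_nonneg H2_add tH athH)
    moreover have "(H2_norm (\<lambda>z. t z + a * (t z * h z)))\<^sup>2
        = 1 + (H2_norm (\<lambda>z. a * (t z * h z)))\<^sup>2 + 2 * (s * (cmod q)\<^sup>2)"
    proof -
      have "H2_inner t (\<lambda>z. a * (t z * h z)) = cnj a * q"
        using H2_inner_cmult_right[OF thH tH] by (simp add: q_def)
      also have "\<dots> = of_real (s * (cmod q)\<^sup>2)"
        by (simp add: a_def mult.commute flip: complex_norm_square)
      finally show ?thesis by (simp add: H2_norm_power2_add[OF tH athH] t(3))
    qed
    moreover have "(H2_norm (\<lambda>z. 1 + a * h z))\<^sup>2 = 1 + s\<^sup>2 * (cmod q)\<^sup>2 * (H2_norm h)\<^sup>2"
    proof -
      have "H2_inner (\<lambda>z. 1) (\<lambda>z. a * h z) = 0"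
        using sums_finite[of "{0::nat}" "\<lambda>n. taylor_coeff (\<lambda>z. 1) n * cnj (taylor_coeff (\<lambda>z. a * h z) n)"]
        by (simp add: H2_inner_def taylor_coeff_const taylor_coeff_0 h(2) sums_iff)
      moreover have "cmod a = s * cmod q" using s by (simp add: a_def norm_mult)
      ultimately show ?thesis
        by (simp add: H2_norm_power2_add[OF H2_const aH] H2_norm_const H2_norm_cmult[OF h(1)]
            power_mult_distrib)
    qed
    moreover have "0 \<le> (H2_norm (\<lambda>z. a * (t z * h z)))\<^sup>2" by simp
    ultimately show ?thesis by linarith
  qed
  have p: "(cmod q)\<^sup>2 > 0" using nz by (simp add: q_def)
  have ge: "2 \<le> s * (H2_norm h)\<^sup>2" if s: "s > 0" for s
  proof -
    have "(s * (cmod q)\<^sup>2) * 2 \<le> (s * (cmod q)\<^sup>2) * (s * (H2_norm h)\<^sup>2)"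
      using main[OF s] by (simp add: power2_eq_square algebra_simps)
    then show ?thesis using p s mult_le_cancel_left_pos[of "s * (cmod q)\<^sup>2"] by simp
  qed
  (* Any s with s * (H2_norm h)^2 < 2 contradicts ge. *)
  define s where "s = 1 / (1 + (H2_norm h)\<^sup>2)"
  have "1 + (H2_norm h)\<^sup>2 > 0" by (simp add: add_pos_nonneg)
  then have "s > 0" "s * (H2_norm h)\<^sup>2 \<le> 1" by (auto simp: s_def divide_le_eq_1)
  then show False using ge[of s] by simp
qed

text \<open>
  The derivative at 0 is that of \<open>t z - t 0\<close>, the form in which the removable singularity theorem
  for quotients supplies it.
\<close>

definition backward_shift :: "(complex \<Rightarrow> complex) \<Rightarrow> complex \<Rightarrow> complex" where
  "backward_shift t z = (if z = 0 then deriv (\<lambda>z. t z - t 0) 0 else (t z - t 0) / z)"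

lemma backward_shift_eq: "(\<lambda>z. t 0 + z * backward_shift t z) = t"
  by (auto simp: backward_shift_def)

lemma backward_shift_holomorphic:
  assumes "t holomorphic_on S" "open S"
  shows "backward_shift t holomorphic_on S"
  by (rule pole_theorem_open_0[of "\<lambda>z. t z - t 0" S 0])
     (use assms in \<open>auto simp: backward_shift_def intro!: holomorphic_intros\<close>)

lemma taylor_coeff_backward_shift:
  assumes "t holomorphic_on disc"
  shows "taylor_coeff (backward_shift t) n = taylor_coeff t (Suc n)"
proof -
  have b: "backward_shift t holomorphic_on disc" using assms by (rule backward_shift_holomorphic) simp
  have "taylor_coeff t (Suc n) = taylor_coeff (\<lambda>z. t 0 + z * backward_shift t z) (Suc n)"
    by (simp only: backward_shift_eq)
  also have "\<dots> = taylor_coeff (backward_shift t) n"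
    using b by (subst taylor_coeff_add) (auto simp: taylor_coeff_const taylor_coeff_times_z intro!: holomorphic_intros)
  finally show ?thesis by simp
qed

text \<open>
  Passing the shift to the other side, the inner product of \<open>backward_shift t\<close> with \<open>\<theta> * g\<close> is that of
  \<open>t\<close> with \<open>z * \<theta> * g = t * h\<close>, where \<open>h = z * u * g\<close> vanishes at 0.
\<close>

lemma backward_shift_in_model_space:
  assumes \<theta>: "\<theta> holomorphic_on disc" "\<And>z. z \<in> disc \<Longrightarrow> cmod (\<theta> z) \<le> 1" "H2_norm \<theta> = 1"
    and t: "divides_inner t \<theta>"
  shows "backward_shift t \<in> model_space \<theta>" "H2_norm (backward_shift t) \<le> 1"
proof -
  have hol: "t holomorphic_on disc" and le: "\<And>z. z \<in> disc \<Longrightarrow> cmod (t z) \<le> 1"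
    using t by (auto simp: divides_inner_def)
  note t1 = divides_inner_norm[OF \<theta>(1,3) t]
  have b: "backward_shift t holomorphic_on disc" using hol by (rule backward_shift_holomorphic) simp
  have c: "taylor_coeff (backward_shift t) n = taylor_coeff t (Suc n)" for n
    by (rule taylor_coeff_backward_shift[OF hol])
  have "(\<Sum>n<N. (cmod (taylor_coeff (backward_shift t) n))\<^sup>2) \<le> 1\<^sup>2" for N
  proof -
    have "(\<Sum>n<N. (cmod (taylor_coeff (backward_shift t) n))\<^sup>2) = (\<Sum>n\<in>Suc ` {..<N}. (cmod (taylor_coeff t n))\<^sup>2)"
      by (simp add: sum.reindex c)
    also have "\<dots> \<le> (H2_norm t)\<^sup>2" by (rule H2_sum_le[OF t1(1)]) simp
    finally show ?thesis by (simp add: t1(2))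
  qed
  from H2I_bounded_sums[OF b this]
  have bH: "backward_shift t \<in> H2" and "H2_norm (backward_shift t) \<le> 1" by simp_all
  then show "H2_norm (backward_shift t) \<le> 1" by simp
  obtain u where u: "u holomorphic_on disc" "\<And>z. z \<in> disc \<Longrightarrow> cmod (u z) \<le> 1"
    "\<And>z. z \<in> disc \<Longrightarrow> \<theta> z = t z * u z" using divides_inner_cofactor[OF \<theta>(1) t] by blast
  have "H2_inner (backward_shift t) (\<lambda>z. \<theta> z * g z) = 0" if g: "g \<in> H2" for g
  proof -
    define h where "h = (\<lambda>z. z * (u z * g z))"
    have hH: "h \<in> H2" unfolding h_def
      by (rule H2_mult_bounded(1)[of _ 1]) (auto intro!: holomorphic_intros H2_mult_bounded(1)[OF u(1,2) g])
    have \<theta>g: "(\<lambda>z. \<theta> z * g z) \<in> H2" by (rule H2_mult_bounded(1)[OF \<theta>(1,2) g])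
    have th: "(\<lambda>z. t z * h z) \<in> H2" by (rule H2_mult_bounded(1)[OF hol le hH])
    have "taylor_coeff (\<lambda>z. z * (\<theta> z * g z)) = taylor_coeff (\<lambda>z. t z * h z)"
      using u(3) by (intro taylor_coeff_cong H2_holomorphic th) (auto simp: h_def)
    then have c': "taylor_coeff (\<lambda>z. \<theta> z * g z) n = taylor_coeff (\<lambda>z. t z * h z) (Suc n)" for n
      using taylor_coeff_times_z[OF H2_holomorphic[OF \<theta>g], of n] by simp
    have "H2_inner (backward_shift t) (\<lambda>z. \<theta> z * g z)
        = (\<Sum>n. taylor_coeff t (Suc n) * cnj (taylor_coeff (\<lambda>z. t z * h z) (Suc n)))"
      by (simp add: H2_inner_def c c')
    also have "\<dots> = H2_inner t (\<lambda>z. t z * h z)"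
      unfolding H2_inner_def using suminf_split_head[OF H2_inner_summable[OF t1(1) th]]
      by (simp add: taylor_coeff_0 h_def)
    also have "\<dots> = 0"
      by (rule inner_multiplier_orthogonal[OF hol le t1(2) hH]) (auto simp: h_def)
    finally show ?thesis .
  qed
  then show "backward_shift t \<in> model_space \<theta>" using bH by (simp add: model_space_def)
qed

text \<open>
  The divisor \<open>t\<close> is recovered from its backward shift \<open>b\<close> as \<open>t 0 + z * b z\<close>, and the derivatives of \<open>b\<close>
  are bounded by those of a unit vector of the model space.
\<close>

lemma divisor_derivative_bound:
  assumes \<theta>: "\<theta> holomorphic_on disc" "\<And>z. z \<in> disc \<Longrightarrow> cmod (\<theta> z) \<le> 1" "H2_norm \<theta> = 1"
    and w: "\<And>n. w n \<in> disc" "w \<longlonglongrightarrow> \<zeta>" "\<zeta> \<in> sphere 0 1"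
    and oc: "overcomplete_in (model_space \<theta>) (\<lambda>n. model_kernel \<theta> (w n))"
  shows "\<exists>C. \<forall>t. divides_inner t \<theta> \<longrightarrow> t analytic_on {\<zeta>} \<longrightarrow> cmod ((deriv ^^ m) t \<zeta>) \<le> C"
proof -
  have "\<exists>C. \<forall>f. f \<in> model_space \<theta> \<longrightarrow> f analytic_on {\<zeta>} \<longrightarrow> cmod ((deriv ^^ N) f \<zeta>) \<le> C * H2_norm f" for N
    using overcomplete_boundary_derivative_bound[OF \<theta>(1,2) w oc, of N] by metis
  then obtain C where C: "\<And>N f. f \<in> model_space \<theta> \<Longrightarrow> f analytic_on {\<zeta>} \<Longrightarrow> cmod ((deriv ^^ N) f \<zeta>) \<le> C N * H2_norm f"
    by metis
  define D where "D = 1 + (\<Sum>i=0..m. real (m choose i) * \<bar>C (m - i)\<bar>)"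
  have "cmod ((deriv ^^ m) t \<zeta>) \<le> D" if t: "divides_inner t \<theta>" "t analytic_on {\<zeta>}" for t
  proof -
    let ?b = "backward_shift t"
    note b = backward_shift_in_model_space[OF \<theta> t(1)]
    obtain S where S: "open S" "\<zeta> \<in> S" "t holomorphic_on S" using t(2) analytic_at by blast
    have ban: "?b analytic_on {\<zeta>}" using backward_shift_holomorphic[OF S(3,1)] S analytic_at by blast
    have zan: "(\<lambda>z. z) analytic_on {\<zeta>}" by (rule analytic_on_ident)
    have bd: "cmod ((deriv ^^ i) ?b \<zeta>) \<le> \<bar>C i\<bar>" for i
    proof -
      have "cmod ((deriv ^^ i) ?b \<zeta>) \<le> C i * H2_norm ?b" by (rule C[OF b(1) ban])
      also have "\<dots> \<le> \<bar>C i\<bar> * 1"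
        using b model_space_H2[of \<theta>] by (intro mult_mono) auto
      finally show ?thesis by simp
    qed
    have idb: "cmod ((deriv ^^ i) (\<lambda>z. z) \<zeta>) \<le> 1" for i
      using w(3) by (simp add: higher_deriv_ident)
    have "(deriv ^^ m) t \<zeta> = (deriv ^^ m) (\<lambda>z. t 0 + z * ?b z) \<zeta>"
      by (simp only: backward_shift_eq)
    also have "\<dots> = (deriv ^^ m) (\<lambda>z. t 0) \<zeta> + (deriv ^^ m) (\<lambda>z. z * ?b z) \<zeta>"
      by (intro higher_deriv_add_at analytic_intros zan ban)
    also have "(deriv ^^ m) (\<lambda>z. z * ?b z) \<zeta>
        = (\<Sum>i=0..m. of_nat (m choose i) * (deriv ^^ i) (\<lambda>z. z) \<zeta> * (deriv ^^ (m - i)) ?b \<zeta>)"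
      by (rule higher_deriv_mult_at[OF zan ban])
    also have "cmod ((deriv ^^ m) (\<lambda>z. t 0) \<zeta> + \<dots>) \<le> D"
      unfolding D_def
    proof (intro norm_triangle_mono sum_norm_le)
      have "cmod (t 0) \<le> 1" using t(1) by (auto simp: divides_inner_def)
      then show "cmod ((deriv ^^ m) (\<lambda>z. t 0) \<zeta>) \<le> 1" by (simp add: higher_deriv_const)
      fix i assume "i \<in> {0..m}"
      have "cmod ((deriv ^^ i) (\<lambda>z. z) \<zeta>) * cmod ((deriv ^^ (m - i)) ?b \<zeta>) \<le> 1 * \<bar>C (m - i)\<bar>"
        by (intro mult_mono idb bd) auto
      then show "cmod (of_nat (m choose i) * (deriv ^^ i) (\<lambda>z. z) \<zeta> * (deriv ^^ (m - i)) ?b \<zeta>)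
          \<le> real (m choose i) * \<bar>C (m - i)\<bar>"
        by (simp add: norm_mult mult.assoc mult_left_mono)
    qed
    finally show ?thesis .
  qed
  then show ?thesis by blast
qed

text \<open>
  Differentiating \<open>t' = L * t\<close> with the Leibniz rule expresses the \<open>m\<close>-th derivative of \<open>L\<close>, times \<open>t\<close>,
  through derivatives of \<open>t\<close> and lower derivatives of \<open>L\<close>; at \<open>\<zeta>\<close> the factor \<open>t\<close> is unimodular. The
  set \<open>A\<close> of pairs \<open>(t, L)\<close> makes the bound uniform over a family.
\<close>

lemma log_derivative_bound:
  fixes A :: "((complex \<Rightarrow> complex) \<times> (complex \<Rightarrow> complex)) set"
  assumes an: "\<And>t L. (t, L) \<in> A \<Longrightarrow> t analytic_on {\<zeta>} \<and> L analytic_on {\<zeta>}"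
    and eq: "\<And>t L. (t, L) \<in> A \<Longrightarrow> \<forall>\<^sub>F z in nhds \<zeta>. deriv t z = L z * t z"
    and one: "\<And>t L. (t, L) \<in> A \<Longrightarrow> cmod (t \<zeta>) = 1"
    and bd: "\<And>m. \<exists>C. \<forall>(t, L)\<in>A. cmod ((deriv ^^ m) t \<zeta>) \<le> C"
  shows "\<exists>C. \<forall>(t, L)\<in>A. cmod ((deriv ^^ m) L \<zeta>) \<le> C"
proof -
  obtain C where C: "\<And>m t L. (t, L) \<in> A \<Longrightarrow> cmod ((deriv ^^ m) t \<zeta>) \<le> C m"
    using bd by (metis (mono_tags, lifting) case_prodD)
  show ?thesis
  proof (induction m rule: less_induct)
    case (less m)
    have "\<exists>D. \<forall>t L. (t, L) \<in> A \<longrightarrow> cmod ((deriv ^^ i) L \<zeta>) \<le> D" if "i < m" for i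
      using less[OF that] by blast
    then obtain D where D: "\<And>i t L. i < m \<Longrightarrow> (t, L) \<in> A \<Longrightarrow> cmod ((deriv ^^ i) L \<zeta>) \<le> D i" by metis
    have "cmod ((deriv ^^ m) L \<zeta>) \<le> C (Suc m) + (\<Sum>i<m. real (m choose i) * (\<bar>D i\<bar> * \<bar>C (m - i)\<bar>))"
      if A: "(t, L) \<in> A" for t L
    proof -
      have "(deriv ^^ Suc m) t \<zeta> = (deriv ^^ m) (deriv t) \<zeta>" by (simp only: funpow_Suc_right o_apply)
      also have "\<dots> = (deriv ^^ m) (\<lambda>z. L z * t z) \<zeta>" by (rule higher_deriv_cong_ev[OF eq[OF A] refl])
      also have "\<dots> = (\<Sum>i=0..m. of_nat (m choose i) * (deriv ^^ i) L \<zeta> * (deriv ^^ (m - i)) t \<zeta>)"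
        using an[OF A] by (intro higher_deriv_mult_at) auto
      also have "\<dots> = (\<Sum>i<m. of_nat (m choose i) * (deriv ^^ i) L \<zeta> * (deriv ^^ (m - i)) t \<zeta>)
          + (deriv ^^ m) L \<zeta> * t \<zeta>"
        by (simp add: atLeast0AtMost lessThan_Suc_atMost[symmetric])
      finally have "(deriv ^^ m) L \<zeta> * t \<zeta> = (deriv ^^ Suc m) t \<zeta>
          - (\<Sum>i<m. of_nat (m choose i) * (deriv ^^ i) L \<zeta> * (deriv ^^ (m - i)) t \<zeta>)" by (simp add: algebra_simps)
      then have "cmod ((deriv ^^ m) L \<zeta>) = cmod ((deriv ^^ Suc m) t \<zeta>
          - (\<Sum>i<m. of_nat (m choose i) * (deriv ^^ i) L \<zeta> * (deriv ^^ (m - i)) t \<zeta>))"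
        using one[OF A] by (metis norm_mult mult.right_neutral)
      also have "\<dots> \<le> cmod ((deriv ^^ Suc m) t \<zeta>)
          + cmod (\<Sum>i<m. of_nat (m choose i) * (deriv ^^ i) L \<zeta> * (deriv ^^ (m - i)) t \<zeta>)"
        by (rule norm_triangle_ineq4)
      also have "\<dots> \<le> C (Suc m) + (\<Sum>i<m. real (m choose i) * (\<bar>D i\<bar> * \<bar>C (m - i)\<bar>))"
      proof (intro add_mono C[OF A] sum_norm_le)
        fix i assume "i \<in> {..<m}"
        then have "cmod ((deriv ^^ i) L \<zeta>) * cmod ((deriv ^^ (m - i)) t \<zeta>) \<le> \<bar>D i\<bar> * \<bar>C (m - i)\<bar>"
          using D[OF _ A, of i] C[OF A, of "m - i"] by (intro mult_mono) auto
        then show "cmod (of_nat (m choose i) * (deriv ^^ i) L \<zeta> * (deriv ^^ (m - i)) t \<zeta>)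
            \<le> real (m choose i) * (\<bar>D i\<bar> * \<bar>C (m - i)\<bar>)"
          by (simp add: norm_mult mult.assoc mult_left_mono)
      qed
      finally show ?thesis .
    qed
    then show ?case by blast
  qed
qed

section \<open>The canonical factorization\<close>

lemma disc_identity:
  "(cmod (1 - cnj a * z))\<^sup>2 - (cmod (a - z))\<^sup>2 = (1 - (cmod a)\<^sup>2) * (1 - (cmod z)\<^sup>2)"
  by (simp add: cmod_power2) algebra

lemma blaschke_denominator_nonzero:
  assumes "a \<in> disc" "cmod z \<le> 1" shows "1 - cnj a * z \<noteq> 0"
proof
  assume "1 - cnj a * z = 0"
  then have "cmod (cnj a * z) = 1" by simp
  moreover have "cmod a * cmod z \<le> cmod a" using assms by (intro mult_left_le) auto
  ultimately show False using assms by (simp add: norm_mult)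
qed

lemma norm_blaschke_factor:
  "cmod (blaschke_factor a z) = cmod ((a - z) / (1 - cnj a * z))"
  by (simp add: blaschke_factor_def norm_mult norm_divide)

lemma norm_blaschke_factor_le_1:
  assumes "a \<in> disc" "z \<in> disc" shows "cmod (blaschke_factor a z) \<le> 1"
proof -
  have "0 \<le> (1 - (cmod a)\<^sup>2) * (1 - (cmod z)\<^sup>2)"
    using assms by (intro mult_nonneg_nonneg) (auto simp: abs_square_le_1)
  then have "(cmod (a - z))\<^sup>2 \<le> (cmod (1 - cnj a * z))\<^sup>2" using disc_identity[of a z] by linarith
  then have "cmod (a - z) \<le> cmod (1 - cnj a * z)" by (rule power2_le_imp_le) simp
  then show ?thesis unfolding norm_blaschke_factor norm_divide by (simp add: divide_le_eq_1)
qed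

lemma norm_blaschke_factor_circle:
  assumes "a \<in> disc" "cmod z = 1" shows "cmod (blaschke_factor a z) = 1"
proof -
  have "(cmod (a - z))\<^sup>2 = (cmod (1 - cnj a * z))\<^sup>2" using disc_identity[of a z] assms by simp
  then have "cmod (a - z) = cmod (1 - cnj a * z)" by (simp add: power2_eq_iff_nonneg)
  then show ?thesis unfolding norm_blaschke_factor norm_divide
    using blaschke_denominator_nonzero[of a z] assms by simp
qed

lemma blaschke_factor_eq_0_iff:
  assumes "a \<in> disc" "z \<in> disc" shows "blaschke_factor a z = 0 \<longleftrightarrow> z = a"
  using assms blaschke_denominator_nonzero[of a z] by (auto simp: blaschke_factor_def)

lemma blaschke_factor_has_derivative:
  assumes "z \<noteq> a" "1 - cnj a * z \<noteq> 0"
  shows "(blaschke_factor a has_field_derivative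
     (1 / (z - a) + cnj a / (1 - cnj a * z)) * blaschke_factor a z) (at z)"
proof (cases "a = 0")
  case True
  then have "blaschke_factor a = (\<lambda>z. z)" by (auto simp: blaschke_factor_def)
  then show ?thesis using True assms by (auto intro!: derivative_eq_intros)
next
  case False
  have "((\<lambda>z. (a - z) / (1 - cnj a * z)) has_field_derivative
     (- 1 * (1 - cnj a * z) - (a - z) * (- cnj a)) / ((1 - cnj a * z) * (1 - cnj a * z))) (at z)"
    using assms by (auto intro!: derivative_eq_intros)
  moreover have "(- 1 * (1 - cnj a * z) - (a - z) * (- cnj a)) / ((1 - cnj a * z) * (1 - cnj a * z))
      = (1 / (z - a) + cnj a / (1 - cnj a * z)) * ((a - z) / (1 - cnj a * z))"
    using assms by (simp add: divide_simps) (simp add: algebra_simps)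
  ultimately have "((\<lambda>z. (a - z) / (1 - cnj a * z)) has_field_derivative
     (1 / (z - a) + cnj a / (1 - cnj a * z)) * ((a - z) / (1 - cnj a * z))) (at z)" by simp
  from DERIV_cmult[OF this, of "of_real (cmod a) / a"]
  show ?thesis using False by (simp only: blaschke_factor_def[abs_def] mult.left_commute if_False)
qed

text \<open>
  The real part of the Herglotz kernel is the Poisson kernel.
\<close>

lemma Re_herglotz_kernel:
  assumes "cmod \<xi> = 1" "cmod z < 1"
  shows "Re ((\<xi> + z) / (\<xi> - z)) = (1 - (cmod z)\<^sup>2) / (cmod (\<xi> - z))\<^sup>2"
proof -
  have "(Re \<xi>)\<^sup>2 + (Im \<xi>)\<^sup>2 = 1" using assms by (simp flip: cmod_power2)
  then show ?thesis
    unfolding Re_divide cmod_power2 by (simp add: power2_eq_square algebra_simps)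
qed

lemma Re_herglotz_kernel_nonneg:
  assumes "cmod \<xi> = 1" "cmod z < 1"
  shows "0 \<le> Re ((\<xi> + z) / (\<xi> - z))"
  unfolding Re_herglotz_kernel[OF assms] using assms by (auto simp: abs_square_le_1)

lemma continuous_on_herglotz_kernel:
  assumes "cmod z < 1" shows "continuous_on (sphere 0 1) (\<lambda>\<xi>. (\<xi> + z) / (\<xi> - z))"
  using assms by (intro continuous_intros) auto

lemma norm_singular_inner:
  assumes "sets \<nu> = sets (restrict_space borel (sphere 0 1))" "finite_measure \<nu>" "cmod z < 1"
  shows "cmod (singular_inner \<nu> z) = exp (- (LINT \<xi>|\<nu>. Re ((\<xi> + z) / (\<xi> - z))))"
  unfolding singular_inner_def
  by (simp add: integral_Re integrable_on_circle[OF assms(1,2) continuous_on_herglotz_kernel[OF assms(3)]])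

lemma norm_singular_inner_le_1:
  assumes "sets \<nu> = sets (restrict_space borel (sphere 0 1))" "finite_measure \<nu>" "cmod z < 1"
  shows "cmod (singular_inner \<nu> z) \<le> 1"
proof -
  have "0 \<le> (LINT \<xi>|\<nu>. Re ((\<xi> + z) / (\<xi> - z)))"
    using Re_herglotz_kernel_nonneg[OF _ assms(3)] space_on_circle[OF assms(1)]
    by (intro integral_nonneg_AE AE_I2) auto
  then show ?thesis by (simp add: norm_singular_inner[OF assms])
qed

text \<open>
  The factors occur with the multiplicities of \<open>\<theta>\<close>, so these are the products whose limit is the
  Blaschke product in the canonical factorization.
\<close>

definition partial_blaschke :: "(complex \<Rightarrow> complex) \<Rightarrow> complex set \<Rightarrow> complex \<Rightarrow> complex" where
  "partial_blaschke \<theta> F z = (\<Prod>a\<in>F. blaschke_factor a z ^ zero_mult \<theta> a)"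

lemma norm_partial_blaschke_le_1:
  assumes "F \<subseteq> disc_zeros \<theta>" "z \<in> disc" shows "cmod (partial_blaschke \<theta> F z) \<le> 1"
  unfolding partial_blaschke_def prod_norm[symmetric] norm_power
  using assms norm_blaschke_factor_le_1
  by (intro prod_le_1) (auto simp: disc_zeros_def intro!: power_le_one)

text \<open>
  The full Blaschke product is a limit of products over larger sets of zeros, each of modulus at most
  that of the product over \<open>F\<close>.
\<close>

lemma norm_factorization_le:
  assumes gen: "generates_singular_factor \<nu> \<theta>" and F: "finite F" "F \<subseteq> disc_zeros \<theta>" and z: "z \<in> disc"
  shows "cmod (\<theta> z) \<le> cmod (partial_blaschke \<theta> F z) * cmod (singular_inner \<nu> z)"
proof -
  obtain \<gamma> B where \<gamma>: "cmod \<gamma> = 1" and lim: "((\<lambda>F. partial_blaschke \<theta> F z) \<longlongrightarrow> B z) (finite_subsets_at_top (disc_zeros \<theta>))"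
    and eq: "\<theta> z = \<gamma> * B z * singular_inner \<nu> z"
    using gen z unfolding generates_singular_factor_def partial_blaschke_def by blast
  have "cmod (B z) \<le> cmod (partial_blaschke \<theta> F z)"
  proof (rule tendsto_upperbound[OF tendsto_norm[OF lim]])
    show "\<forall>\<^sub>F G in finite_subsets_at_top (disc_zeros \<theta>). cmod (partial_blaschke \<theta> G z) \<le> cmod (partial_blaschke \<theta> F z)"
      unfolding eventually_finite_subsets_at_top
    proof (intro exI[of _ F] conjI F allI impI)
      fix G assume G: "finite G \<and> F \<subseteq> G \<and> G \<subseteq> disc_zeros \<theta>"
      have "partial_blaschke \<theta> G z = partial_blaschke \<theta> (G - F) z * partial_blaschke \<theta> F z"
        unfolding partial_blaschke_def using G by (intro prod.subset_diff) auto
      moreover have "cmod (partial_blaschke \<theta> (G - F) z) \<le> 1"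
        using G z by (intro norm_partial_blaschke_le_1) auto
      ultimately show "cmod (partial_blaschke \<theta> G z) \<le> cmod (partial_blaschke \<theta> F z)"
        by (simp add: norm_mult mult_left_le_one_le)
    qed
  qed simp
  then show ?thesis using \<gamma> eq by (simp add: norm_mult mult_right_mono)
qed

lemma partial_blaschke_divides:
  assumes gen: "generates_singular_factor \<nu> \<theta>" and F: "finite F" "F \<subseteq> disc_zeros \<theta>"
  shows "divides_inner (partial_blaschke \<theta> F) \<theta>"
  unfolding divides_inner_def
proof (intro conjI ballI)
  have S: "cmod (singular_inner \<nu> z) \<le> 1" if "z \<in> disc" for z
    using norm_singular_inner_le_1[of \<nu> z] gen that by (auto simp: generates_singular_factor_def)
  have a: "a \<in> disc" if "a \<in> F" for a using F that by (auto simp: disc_zeros_def)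
  have "blaschke_factor a holomorphic_on disc" if "a \<in> disc" for a
    using blaschke_denominator_nonzero[OF that]
    unfolding blaschke_factor_def[abs_def] by (cases "a = 0") (auto intro!: holomorphic_intros)
  then show "partial_blaschke \<theta> F holomorphic_on disc"
    unfolding partial_blaschke_def[abs_def] using a by (intro holomorphic_on_prod holomorphic_on_power) auto
  have "{z \<in> disc. partial_blaschke \<theta> F z = 0} \<subseteq> F"
    using F(1) blaschke_factor_eq_0_iff[OF a] by (auto simp: partial_blaschke_def)
  then show "finite {z \<in> disc. partial_blaschke \<theta> F z = 0}" using F(1) by (rule finite_subset)
  fix z assume z: "z \<in> disc"
  show "cmod (partial_blaschke \<theta> F z) \<le> 1" by (rule norm_partial_blaschke_le_1[OF F(2) z])
  have "cmod (partial_blaschke \<theta> F z) * cmod (singular_inner \<nu> z) \<le> cmod (partial_blaschke \<theta> F z)"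
    using S[OF z] by (intro mult_left_le) auto
  then show "cmod (\<theta> z) \<le> cmod (partial_blaschke \<theta> F z)"
    using norm_factorization_le[OF gen F z] by linarith
qed

section \<open>The zeros\<close>

definition blaschke_log_deriv :: "(complex \<Rightarrow> complex) \<Rightarrow> complex set \<Rightarrow> complex \<Rightarrow> complex" where
  "blaschke_log_deriv \<theta> F z = (\<Sum>a\<in>F. of_nat (zero_mult \<theta> a) * (1 / (z - a) + cnj a / (1 - cnj a * z)))"

lemma partial_blaschke_has_derivative:
  assumes "finite F" "\<And>a. a \<in> F \<Longrightarrow> z \<noteq> a \<and> 1 - cnj a * z \<noteq> 0"
  shows "(partial_blaschke \<theta> F has_field_derivative blaschke_log_deriv \<theta> F z * partial_blaschke \<theta> F z) (at z)"
  using assms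
proof (induction F rule: finite_induct)
  case empty
  then show ?case by (simp add: partial_blaschke_def[abs_def] blaschke_log_deriv_def)
next
  case (insert a F)
  let ?m = "zero_mult \<theta> a" and ?l = "1 / (z - a) + cnj a / (1 - cnj a * z)"
  have b: "(blaschke_factor a has_field_derivative ?l * blaschke_factor a z) (at z)"
    using insert.prems by (intro blaschke_factor_has_derivative) auto
  have p: "((\<lambda>z. blaschke_factor a z ^ ?m) has_field_derivative of_nat ?m * ?l * blaschke_factor a z ^ ?m) (at z)"
  proof (cases ?m)
    case (Suc k)
    then show ?thesis using DERIV_power[OF b, of "Suc k"] by (simp add: mult_ac)
  qed simp
  have e: "partial_blaschke \<theta> (insert a F) = (\<lambda>z. blaschke_factor a z ^ ?m * partial_blaschke \<theta> F z)"
    using insert.hyps by (auto simp: partial_blaschke_def)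
  have F: "(partial_blaschke \<theta> F has_field_derivative blaschke_log_deriv \<theta> F z * partial_blaschke \<theta> F z) (at z)"
    using insert by auto
  show ?case unfolding e
    by (rule DERIV_cong[OF DERIV_mult[OF p F]])
       (use insert.hyps in \<open>simp add: blaschke_log_deriv_def algebra_simps\<close>)
qed

text \<open>
  Both parts \<open>1 / (z - a)\<close> and \<open>cnj a / (1 - cnj a * z)\<close> of the logarithmic derivative of a Blaschke
  factor are of this form up to sign, including the case \<open>a = 0\<close>, where \<open>\<alpha> = 0\<close> in the second.
\<close>

lemma higher_deriv_linear_quotient:
  fixes \<alpha> \<beta> :: complex
  assumes "\<alpha> * \<zeta> + \<beta> \<noteq> 0"
  shows "(\<lambda>z. \<alpha> / (\<alpha> * z + \<beta>)) analytic_on {\<zeta>}"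
    and "(deriv ^^ m) (\<lambda>z. \<alpha> / (\<alpha> * z + \<beta>)) \<zeta> = fact m * ((-1) ^ m * (\<alpha> / (\<alpha> * \<zeta> + \<beta>)) ^ Suc m)"
proof -
  define d where "d = \<alpha> * \<zeta> + \<beta>"
  define r where "r = cmod d / (cmod \<alpha> + 1)"
  have d: "d \<noteq> 0" using assms by (simp add: d_def)
  then have r: "r > 0" by (simp add: r_def add_nonneg_pos)
  have s: "(\<lambda>n. ((-1) ^ n * (\<alpha> / d) ^ Suc n) * (z - \<zeta>) ^ n) sums (\<alpha> / (\<alpha> * z + \<beta>))"
    if z: "z \<in> ball \<zeta> r" for z
  proof -
    define q where "q = - (\<alpha> / d * (z - \<zeta>))"
    have "cmod \<alpha> * cmod (z - \<zeta>) \<le> (cmod \<alpha> + 1) * cmod (z - \<zeta>)" by (intro mult_right_mono) auto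
    also have "\<dots> < (cmod \<alpha> + 1) * r"
      using z by (intro mult_strict_left_mono) (auto simp: dist_norm norm_minus_commute add_nonneg_pos)
    also have "\<dots> = cmod d" using norm_ge_zero[of \<alpha>] by (simp add: r_def del: norm_ge_zero)
    finally have "cmod q < 1" using d by (simp add: q_def norm_mult norm_divide)
    from sums_mult[OF geometric_sums[OF this], of "\<alpha> / d"]
    have "(\<lambda>n. \<alpha> / d * q ^ n) sums (\<alpha> / d * (1 / (1 - q)))" .
    moreover have "\<alpha> / d * (1 / (1 - q)) = \<alpha> / (\<alpha> * z + \<beta>)"
    proof -
      have "d * (1 - q) = \<alpha> * z + \<beta>" using d by (simp add: q_def d_def field_simps)
      then show ?thesis by (metis mult.right_neutral times_divide_times_eq)
    qed
    moreover have "\<alpha> / d * q ^ n = ((-1) ^ n * (\<alpha> / d) ^ Suc n) * (z - \<zeta>) ^ n" for n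
    proof -
      have "q ^ n = (-1) ^ n * (\<alpha> / d) ^ n * (z - \<zeta>) ^ n"
        unfolding q_def by (subst power_minus) (simp only: power_mult_distrib mult.assoc)
      then show ?thesis by (simp add: mult_ac)
    qed
    ultimately show ?thesis by (simp only:)
  qed
  show "(deriv ^^ m) (\<lambda>z. \<alpha> / (\<alpha> * z + \<beta>)) \<zeta> = fact m * ((-1) ^ m * (\<alpha> / (\<alpha> * \<zeta> + \<beta>)) ^ Suc m)"
    using higher_deriv_eq_power_series_coeff[OF r s, of m] by (simp only: d_def)
  have "(\<lambda>z. \<alpha> / (\<alpha> * z + \<beta>)) holomorphic_on ball \<zeta> r" by (rule power_series_holomorphic[OF s])
  then show "(\<lambda>z. \<alpha> / (\<alpha> * z + \<beta>)) analytic_on {\<zeta>}" using r by (auto simp: analytic_on_def)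
qed

lemma higher_deriv_sum_at:
  fixes g :: "'a \<Rightarrow> complex \<Rightarrow> complex"
  assumes "finite F" "\<And>a. a \<in> F \<Longrightarrow> g a analytic_on {\<zeta>}"
  shows "(\<lambda>z. \<Sum>a\<in>F. c a * g a z) analytic_on {\<zeta>} \<and>
    (deriv ^^ m) (\<lambda>z. \<Sum>a\<in>F. c a * g a z) \<zeta> = (\<Sum>a\<in>F. c a * (deriv ^^ m) (g a) \<zeta>)"
  using assms
proof (induction F rule: finite_induct)
  case empty
  then show ?case by (auto simp: higher_deriv_const)
next
  case (insert a F)
  then have a: "(\<lambda>z. c a * g a z) analytic_on {\<zeta>}" by (auto intro!: analytic_intros)
  have "(deriv ^^ m) (\<lambda>z. c a * g a z + (\<Sum>a\<in>F. c a * g a z)) \<zeta>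
     = c a * (deriv ^^ m) (g a) \<zeta> + (\<Sum>a\<in>F. c a * (deriv ^^ m) (g a) \<zeta>)"
    using insert a by (subst higher_deriv_add_at) (auto simp: higher_deriv_cmult')
  then show ?case using insert a by (auto intro!: analytic_intros)
qed

text \<open>
  The map \<open>a \<mapsto> \<i> * cnj ((\<zeta> + a) / (2 * (\<zeta> - a)))\<close>. It takes the disc to the upper half-plane and \<open>\<zeta>\<close>
  to infinity, and its imaginary part is half the Poisson kernel.
\<close>

definition boundary_cayley :: "complex \<Rightarrow> complex \<Rightarrow> complex" where
  "boundary_cayley \<zeta> a = \<i> * cnj (\<zeta> / (\<zeta> - a) - 1 / 2)"

text \<open>
  On the circle \<open>cnj a * \<zeta> / (1 - cnj a * \<zeta>) = cnj (\<zeta> / (\<zeta> - a)) - 1\<close>, so both parts of the logarithmic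
  derivative are expressed through powers of \<open>u = \<zeta> / (\<zeta> - a)\<close> and of its reflection.
\<close>

lemma blaschke_log_deriv_higher_deriv:
  assumes \<zeta>: "cmod \<zeta> = 1" and F: "finite F" "F \<subseteq> disc"
  shows "blaschke_log_deriv \<theta> F analytic_on {\<zeta>}"
    and "(\<Sum>a\<in>F. of_nat (zero_mult \<theta> a) * ((cnj (\<zeta> / (\<zeta> - a)) - 1) ^ Suc m - (- (\<zeta> / (\<zeta> - a))) ^ Suc m))
       = \<zeta> ^ Suc m / fact m * (deriv ^^ m) (blaschke_log_deriv \<theta> F) \<zeta>"
proof -
  let ?g = "\<lambda>a z. 1 / (1 * z + (- a)) + (-1) * (- cnj a / (- cnj a * z + 1))"
  have eq: "blaschke_log_deriv \<theta> F = (\<lambda>z. \<Sum>a\<in>F. of_nat (zero_mult \<theta> a) * ?g a z)"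
    by (auto simp: blaschke_log_deriv_def fun_eq_iff)
  have nz: "1 * \<zeta> + (- a) \<noteq> 0" "- cnj a * \<zeta> + 1 \<noteq> 0" if "a \<in> F" for a
    using that F \<zeta> blaschke_denominator_nonzero[of a \<zeta>] by auto
  have an: "?g a analytic_on {\<zeta>}" if "a \<in> F" for a
    by (intro analytic_on_add analytic_on_mult analytic_on_const higher_deriv_linear_quotient nz that)
  have g: "\<zeta> ^ Suc m / fact m * (deriv ^^ m) (?g a) \<zeta>
     = (cnj (\<zeta> / (\<zeta> - a)) - 1) ^ Suc m - (- (\<zeta> / (\<zeta> - a))) ^ Suc m" if a: "a \<in> F" for a
  proof -
    have "(deriv ^^ m) (?g a) \<zeta> = fact m * ((-1) ^ m * (1 / (1 * \<zeta> + (- a))) ^ Suc m)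
        + (-1) * (fact m * ((-1) ^ m * (- cnj a / (- cnj a * \<zeta> + 1)) ^ Suc m))"
      using higher_deriv_linear_quotient[OF nz(1)[OF a]] higher_deriv_linear_quotient[OF nz(2)[OF a]]
      by (subst higher_deriv_comb_at) simp_all
    then have "\<zeta> ^ Suc m / fact m * (deriv ^^ m) (?g a) \<zeta>
        = \<zeta> ^ Suc m * ((-1) ^ m * (1 / (\<zeta> - a)) ^ Suc m) - \<zeta> ^ Suc m * ((-1) ^ m * (- cnj a / (1 - cnj a * \<zeta>)) ^ Suc m)"
      by (simp add: algebra_simps)
    also have "\<zeta> ^ Suc m * ((-1) ^ m * (1 / (\<zeta> - a)) ^ Suc m) = - ((- (\<zeta> / (\<zeta> - a))) ^ Suc m)"
      by (subst (2) power_minus) (simp add: power_divide)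
    also have "\<zeta> ^ Suc m * ((-1) ^ m * (- cnj a / (1 - cnj a * \<zeta>)) ^ Suc m)
        = - ((cnj a * \<zeta> / (1 - cnj a * \<zeta>)) ^ Suc m)"
      by (subst minus_divide_left[symmetric], subst (2) power_minus) (simp add: power_divide power_mult_distrib)
    also have "cnj a * \<zeta> / (1 - cnj a * \<zeta>) = cnj (\<zeta> / (\<zeta> - a)) - 1"
    proof -
      have "\<zeta> * cnj \<zeta> = 1" using \<zeta> by (simp flip: complex_norm_square)
      then have "\<zeta> * (cnj \<zeta> - cnj a) = 1 - cnj a * \<zeta>" by (simp add: algebra_simps)
      moreover have "\<zeta> \<noteq> 0" using \<zeta> by auto
      ultimately have "cnj (\<zeta> / (\<zeta> - a)) = (\<zeta> * cnj \<zeta>) / (1 - cnj a * \<zeta>)"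
        by (metis complex_cnj_diff complex_cnj_divide mult_divide_mult_cancel_left)
      then have "cnj (\<zeta> / (\<zeta> - a)) = 1 / (1 - cnj a * \<zeta>)" using \<open>\<zeta> * cnj \<zeta> = 1\<close> by simp
      then show ?thesis using nz(2)[OF a] by (simp add: field_simps)
    qed
    finally show ?thesis by simp
  qed
  have sum: "(\<lambda>z. \<Sum>a\<in>F. of_nat (zero_mult \<theta> a) * ?g a z) analytic_on {\<zeta>} \<and>
    (deriv ^^ m) (\<lambda>z. \<Sum>a\<in>F. of_nat (zero_mult \<theta> a) * ?g a z) \<zeta>
      = (\<Sum>a\<in>F. of_nat (zero_mult \<theta> a) * (deriv ^^ m) (?g a) \<zeta>)"
    by (rule higher_deriv_sum_at[OF F(1)]) (rule an)
  show "blaschke_log_deriv \<theta> F analytic_on {\<zeta>}"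
    unfolding eq using sum by blast
  have "(deriv ^^ m) (blaschke_log_deriv \<theta> F) \<zeta> = (\<Sum>a\<in>F. of_nat (zero_mult \<theta> a) * (deriv ^^ m) (?g a) \<zeta>)"
    unfolding eq using sum by blast
  then have "\<zeta> ^ Suc m / fact m * (deriv ^^ m) (blaschke_log_deriv \<theta> F) \<zeta>
     = (\<Sum>a\<in>F. of_nat (zero_mult \<theta> a) * (\<zeta> ^ Suc m / fact m * (deriv ^^ m) (?g a) \<zeta>))"
    by (simp only: sum_distrib_left mult.left_commute)
  also have "\<dots> = (\<Sum>a\<in>F. of_nat (zero_mult \<theta> a) * ((cnj (\<zeta> / (\<zeta> - a)) - 1) ^ Suc m - (- (\<zeta> / (\<zeta> - a))) ^ Suc m))"
    by (rule sum.cong[OF refl]) (simp only: g)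
  finally show "(\<Sum>a\<in>F. of_nat (zero_mult \<theta> a) * ((cnj (\<zeta> / (\<zeta> - a)) - 1) ^ Suc m - (- (\<zeta> / (\<zeta> - a))) ^ Suc m))
       = \<zeta> ^ Suc m / fact m * (deriv ^^ m) (blaschke_log_deriv \<theta> F) \<zeta>" by simp
qed

lemma Im_boundary_cayley:
  assumes "cmod \<zeta> = 1" "a \<noteq> \<zeta>"
  shows "Im (boundary_cayley \<zeta> a) = (1 - (cmod a)\<^sup>2) / (2 * (cmod (\<zeta> - a))\<^sup>2)"
proof -
  have 1: "(Re \<zeta>)\<^sup>2 + (Im \<zeta>)\<^sup>2 = 1" using assms by (simp flip: cmod_power2)
  have 2: "(Re (\<zeta> - a))\<^sup>2 + (Im (\<zeta> - a))\<^sup>2 \<noteq> 0"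
    using assms(2) by (metis cmod_power2 norm_eq_zero power_eq_0_iff right_minus_eq)
  have "Im (\<i> * cnj y) = Re y" for y by simp
  from this[of "\<zeta> / (\<zeta> - a) - 1 / 2"]
  have "Im (boundary_cayley \<zeta> a) = Re (\<zeta> / (\<zeta> - a)) - 1 / 2" by (simp add: boundary_cayley_def)
  also have "\<dots> = (2 * (Re \<zeta> * Re (\<zeta> - a) + Im \<zeta> * Im (\<zeta> - a)) - ((Re (\<zeta> - a))\<^sup>2 + (Im (\<zeta> - a))\<^sup>2))
      / (2 * ((Re (\<zeta> - a))\<^sup>2 + (Im (\<zeta> - a))\<^sup>2))"
    unfolding Re_divide using 2 by (simp add: field_simps)
  also have "2 * (Re \<zeta> * Re (\<zeta> - a) + Im \<zeta> * Im (\<zeta> - a)) - ((Re (\<zeta> - a))\<^sup>2 + (Im (\<zeta> - a))\<^sup>2) = 1 - (cmod a)\<^sup>2"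
    using 1 unfolding cmod_power2 by (simp add: power2_eq_square algebra_simps)
  finally show ?thesis by (simp add: cmod_power2)
qed

text \<open>
  With \<open>x = \<omega> ^ (k + 1)\<close> and \<open>y = \<omega> ^ (k + 2)\<close> one has \<open>Im (y * cnj x) = Im \<omega> * cmod x ^ 2\<close>, so the
  imaginary parts of two consecutive powers cannot both be small compared with \<open>Im \<omega> * cmod \<omega> ^ k\<close>.
  For \<open>cmod \<omega> \<le> 1\<close> the first term on the right suffices.
\<close>

lemma Im_power_lower_bound:
  fixes \<omega> :: complex
  assumes "0 \<le> Im \<omega>"
  shows "Im \<omega> * cmod \<omega> ^ k \<le> Im \<omega> + \<bar>Im (\<omega> ^ Suc k)\<bar> + \<bar>Im (\<omega> ^ Suc (Suc k))\<bar>"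
proof (cases "cmod \<omega> \<le> 1")
  case True
  then have "Im \<omega> * cmod \<omega> ^ k \<le> Im \<omega>" using assms by (intro mult_left_le) (auto simp: power_le_one)
  then show ?thesis by linarith
next
  case False
  define R where "R = cmod \<omega>"
  have R: "R > 1" using False by (simp add: R_def)
  define x y where "x = \<omega> ^ Suc k" and "y = \<omega> ^ Suc (Suc k)"
  have nx: "cmod x = R ^ Suc k" and ny: "cmod y = R * R ^ Suc k" by (auto simp: x_def y_def R_def norm_mult norm_power)
  have "y * cnj x = \<omega> * of_real ((R ^ Suc k)\<^sup>2)"
    unfolding nx[symmetric] complex_norm_square by (simp add: x_def y_def)
  then have "Im (y * cnj x) = Im \<omega> * (R ^ Suc k)\<^sup>2" by simp
  then have "Im \<omega> * (R ^ Suc k)\<^sup>2 = Im y * Re x - Re y * Im x" by simp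
  also have "\<dots> \<le> \<bar>Im y\<bar> * \<bar>Re x\<bar> + \<bar>Re y\<bar> * \<bar>Im x\<bar>"
    using abs_ge_self[of "Im y * Re x"] abs_ge_minus_self[of "Re y * Im x"] by (simp add: abs_mult)
  also have "\<dots> \<le> \<bar>Im y\<bar> * R ^ Suc k + (R * R ^ Suc k) * \<bar>Im x\<bar>"
    using abs_Re_le_cmod[of x] abs_Re_le_cmod[of y] by (intro add_mono mult_left_mono mult_right_mono) (auto simp: nx ny)
  also have "\<dots> = R ^ Suc k * (\<bar>Im y\<bar> + R * \<bar>Im x\<bar>)" by (simp add: algebra_simps)
  finally have "R ^ Suc k * (Im \<omega> * R ^ Suc k) \<le> R ^ Suc k * (\<bar>Im y\<bar> + R * \<bar>Im x\<bar>)"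
    by (simp add: power2_eq_square mult_ac)
  then have "Im \<omega> * R ^ Suc k \<le> \<bar>Im y\<bar> + R * \<bar>Im x\<bar>" using R by (subst (asm) mult_le_cancel_left_pos) auto
  also have "\<dots> \<le> R * \<bar>Im y\<bar> + R * \<bar>Im x\<bar>" using R by (intro add_right_mono) (simp add: mult_le_cancel_right1)
  finally have "R * (Im \<omega> * R ^ k) \<le> R * (\<bar>Im y\<bar> + \<bar>Im x\<bar>)" by (simp add: algebra_simps)
  then have "Im \<omega> * R ^ k \<le> \<bar>Im y\<bar> + \<bar>Im x\<bar>" using R by (subst (asm) mult_le_cancel_left_pos) auto
  then show ?thesis using assms unfolding R_def x_def y_def by linarith
qed

lemma partial_blaschke_analytic:
  assumes F: "finite F" "F \<subseteq> disc" and \<zeta>: "cmod \<zeta> = 1"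
  shows "partial_blaschke \<theta> F analytic_on {\<zeta>}"
    and "\<forall>\<^sub>F z in nhds \<zeta>. deriv (partial_blaschke \<theta> F) z = blaschke_log_deriv \<theta> F z * partial_blaschke \<theta> F z"
proof -
  define U where "U = (\<Inter>a\<in>F. {z. z \<noteq> a} \<inter> {z. 1 - cnj a * z \<noteq> 0})"
  have U: "open U" unfolding U_def
    using F(1) by (intro open_INT ballI open_Int open_Collect_neq continuous_intros)
  have \<zeta>U: "\<zeta> \<in> U" using F(2) \<zeta> blaschke_denominator_nonzero[of _ \<zeta>] by (auto simp: U_def)
  have d: "(partial_blaschke \<theta> F has_field_derivative blaschke_log_deriv \<theta> F z * partial_blaschke \<theta> F z) (at z)"
    if "z \<in> U" for z
    using that by (intro partial_blaschke_has_derivative F(1)) (auto simp: U_def)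
  then have "partial_blaschke \<theta> F holomorphic_on U"
    using U by (auto simp: holomorphic_on_open)
  then show "partial_blaschke \<theta> F analytic_on {\<zeta>}" using U \<zeta>U analytic_at by blast
  have "\<forall>\<^sub>F z in nhds \<zeta>. z \<in> U" using U \<zeta>U by (rule eventually_nhds_in_open)
  then show "\<forall>\<^sub>F z in nhds \<zeta>. deriv (partial_blaschke \<theta> F) z = blaschke_log_deriv \<theta> F z * partial_blaschke \<theta> F z"
    by eventually_elim (rule DERIV_imp_deriv[OF d])
qed

text \<open>
  All that overcompleteness contributes to the sum over the zeros and to the integral over the
  punctured circle.
\<close>

definition bounded_divisor_derivatives :: "(complex \<Rightarrow> complex) \<Rightarrow> complex \<Rightarrow> bool" where
  "bounded_divisor_derivatives \<theta> \<zeta> \<longleftrightarrow>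
     (\<forall>m. \<exists>C. \<forall>t. divides_inner t \<theta> \<longrightarrow> t analytic_on {\<zeta>} \<longrightarrow> cmod ((deriv ^^ m) t \<zeta>) \<le> C)"

lemma blaschke_log_deriv_bound:
  assumes gen: "generates_singular_factor \<nu> \<theta>" and \<zeta>: "cmod \<zeta> = 1" and bd: "bounded_divisor_derivatives \<theta> \<zeta>"
  shows "\<exists>C. \<forall>F. finite F \<longrightarrow> F \<subseteq> disc_zeros \<theta> \<longrightarrow> cmod ((deriv ^^ m) (blaschke_log_deriv \<theta> F) \<zeta>) \<le> C"
proof -
  define A where "A = {(partial_blaschke \<theta> F, blaschke_log_deriv \<theta> F) |F. finite F \<and> F \<subseteq> disc_zeros \<theta>}"
  have dz: "F \<subseteq> disc" if "F \<subseteq> disc_zeros \<theta>" for F using that by (auto simp: disc_zeros_def)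
  have "\<exists>C. \<forall>(t, L)\<in>A. cmod ((deriv ^^ m) L \<zeta>) \<le> C"
  proof (rule log_derivative_bound)
    fix t L assume "(t, L) \<in> A"
    then obtain F where F: "finite F" "F \<subseteq> disc_zeros \<theta>" and tL: "t = partial_blaschke \<theta> F" "L = blaschke_log_deriv \<theta> F"
      by (auto simp: A_def)
    show "t analytic_on {\<zeta>} \<and> L analytic_on {\<zeta>}"
      using partial_blaschke_analytic(1)[OF F(1) dz[OF F(2)] \<zeta>] blaschke_log_deriv_higher_deriv(1)[OF \<zeta> F(1) dz[OF F(2)]]
      by (simp add: tL)
    show "\<forall>\<^sub>F z in nhds \<zeta>. deriv t z = L z * t z"
      unfolding tL by (rule partial_blaschke_analytic(2)[OF F(1) dz[OF F(2)] \<zeta>])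
    show "cmod (t \<zeta>) = 1"
      unfolding tL partial_blaschke_def prod_norm[symmetric] norm_power
      using dz[OF F(2)] \<zeta> by (intro prod.neutral) (auto simp: norm_blaschke_factor_circle)
  next
    fix m
    obtain C where C: "\<And>t. divides_inner t \<theta> \<Longrightarrow> t analytic_on {\<zeta>} \<Longrightarrow> cmod ((deriv ^^ m) t \<zeta>) \<le> C"
      using bd unfolding bounded_divisor_derivatives_def by blast
    have "cmod ((deriv ^^ m) (partial_blaschke \<theta> F) \<zeta>) \<le> C" if F: "finite F" "F \<subseteq> disc_zeros \<theta>" for F
      by (rule C[OF partial_blaschke_divides[OF gen F] partial_blaschke_analytic(1)[OF F(1) dz[OF F(2)] \<zeta>]])
    then show "\<exists>C. \<forall>(t, L)\<in>A. cmod ((deriv ^^ m) t \<zeta>) \<le> C" by (auto simp: A_def)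
  qed
  then obtain C where "\<forall>(t, L)\<in>A. cmod ((deriv ^^ m) L \<zeta>) \<le> C" ..
  then show ?thesis unfolding A_def by blast
qed

text \<open>
  The derivatives of the logarithmic derivatives bound the sums \<open>T F k\<close> of
  \<open>(cnj u - 1) ^ k - (- u) ^ k\<close>. By the binomial theorem, both bases may be shifted by \<open>1 / 2\<close>; they
  then become \<open>- \<i> * \<omega>\<close> and \<open>- \<i> * cnj \<omega>\<close>, and the difference of their \<open>p\<close>-th powers is a unimodular
  multiple of \<open>2 * Im (\<omega> ^ p)\<close>.
\<close>

lemma sum_Im_boundary_cayley_bound:
  assumes gen: "generates_singular_factor \<nu> \<theta>" and \<zeta>: "cmod \<zeta> = 1" and bd: "bounded_divisor_derivatives \<theta> \<zeta>"
  shows "\<exists>C. \<forall>F. finite F \<longrightarrow> F \<subseteq> disc_zeros \<theta> \<longrightarrow>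
     \<bar>\<Sum>a\<in>F. real (zero_mult \<theta> a) * Im (boundary_cayley \<zeta> a ^ p)\<bar> \<le> C"
proof -
  define u where "u a = \<zeta> / (\<zeta> - a)" for a
  define T where "T F k = (\<Sum>a\<in>F. of_nat (zero_mult \<theta> a) * ((cnj (u a) - 1) ^ k - (- u a) ^ k))" for F k
  have "\<exists>C. \<forall>F. finite F \<longrightarrow> F \<subseteq> disc_zeros \<theta> \<longrightarrow> cmod (T F k) \<le> C" for k
  proof (cases k)
    case 0
    then show ?thesis by (intro exI[of _ 0]) (simp add: T_def)
  next
    case (Suc m)
    obtain C where C: "\<And>F. finite F \<Longrightarrow> F \<subseteq> disc_zeros \<theta> \<Longrightarrow> cmod ((deriv ^^ m) (blaschke_log_deriv \<theta> F) \<zeta>) \<le> C"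
      using blaschke_log_deriv_bound[OF assms, of m] by blast
    have "cmod (T F k) \<le> C / fact m" if F: "finite F" "F \<subseteq> disc_zeros \<theta>" for F
    proof -
      have "F \<subseteq> disc" using F by (auto simp: disc_zeros_def)
      then have "T F k = \<zeta> ^ Suc m / fact m * (deriv ^^ m) (blaschke_log_deriv \<theta> F) \<zeta>"
        unfolding T_def u_def Suc using blaschke_log_deriv_higher_deriv(2)[OF \<zeta> F(1)] by blast
      then have "cmod (T F k) = cmod ((deriv ^^ m) (blaschke_log_deriv \<theta> F) \<zeta>) / fact m"
        using \<zeta> by (simp add: norm_mult norm_divide norm_power)
      then show ?thesis using C[OF F] by (simp add: divide_right_mono)
    qed
    then show ?thesis by blast
  qed
  then obtain C where C: "\<And>k F. finite F \<Longrightarrow> F \<subseteq> disc_zeros \<theta> \<Longrightarrow> cmod (T F k) \<le> C k" by metis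
  define D where "D = (\<Sum>k\<le>p. real (p choose k) * (1 / 2) ^ (p - k) * C k)"
  have "\<bar>\<Sum>a\<in>F. real (zero_mult \<theta> a) * Im (boundary_cayley \<zeta> a ^ p)\<bar> \<le> D / 2"
    if F: "finite F" "F \<subseteq> disc_zeros \<theta>" for F
  proof -
    let ?\<omega> = "boundary_cayley \<zeta>"
    have shift: "(cnj (u a) - 1 / 2) ^ p - (1 / 2 - u a) ^ p
        = (\<Sum>k\<le>p. of_nat (p choose k) * (1 / 2) ^ (p - k) * ((cnj (u a) - 1) ^ k - (- u a) ^ k))" for a
    proof -
      have "((cnj (u a) - 1) + 1 / 2) ^ p = (\<Sum>k\<le>p. of_nat (p choose k) * (cnj (u a) - 1) ^ k * (1 / 2) ^ (p - k))"
        by (rule binomial_ring)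
      moreover have "((- u a) + 1 / 2) ^ p = (\<Sum>k\<le>p. of_nat (p choose k) * (- u a) ^ k * (1 / 2) ^ (p - k))"
        by (rule binomial_ring)
      ultimately show ?thesis by (simp add: sum_subtractf[symmetric] algebra_simps)
    qed
    have conj: "(cnj (u a) - 1 / 2) ^ p - (1 / 2 - u a) ^ p = (- \<i>) ^ p * (2 * \<i> * of_real (Im (?\<omega> a ^ p)))" for a
    proof -
      have "cnj (u a) - 1 / 2 = - \<i> * ?\<omega> a" "1 / 2 - u a = - \<i> * cnj (?\<omega> a)"
        by (simp_all add: boundary_cayley_def u_def)
      then have "(cnj (u a) - 1 / 2) ^ p - (1 / 2 - u a) ^ p = (- \<i>) ^ p * (?\<omega> a ^ p - cnj (?\<omega> a ^ p))"
        by (simp only: power_mult_distrib complex_cnj_power right_diff_distrib)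
      also have "?\<omega> a ^ p - cnj (?\<omega> a ^ p) = 2 * \<i> * of_real (Im (?\<omega> a ^ p))"
        by (simp only: complex_diff_cnj) simp
      finally show ?thesis .
    qed
    have "(- \<i>) ^ p * (2 * \<i>) * of_real (\<Sum>a\<in>F. real (zero_mult \<theta> a) * Im (?\<omega> a ^ p))
        = (\<Sum>a\<in>F. of_nat (zero_mult \<theta> a) * ((cnj (u a) - 1 / 2) ^ p - (1 / 2 - u a) ^ p))"
      unfolding conj by (simp add: sum_distrib_left mult_ac)
    also have "\<dots> = (\<Sum>k\<le>p. of_nat (p choose k) * (1 / 2) ^ (p - k) * T F k)"
      unfolding shift T_def sum_distrib_left by (subst sum.swap) (simp add: mult_ac)
    finally have "cmod ((- \<i>) ^ p * (2 * \<i>) * of_real (\<Sum>a\<in>F. real (zero_mult \<theta> a) * Im (?\<omega> a ^ p)))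
        \<le> (\<Sum>k\<le>p. cmod (of_nat (p choose k) * (1 / 2) ^ (p - k) * T F k))"
      by (simp only:) (rule norm_sum)
    also have "\<dots> \<le> D"
      unfolding D_def using C[OF F] by (intro sum_mono) (simp add: norm_mult norm_power norm_divide mult_left_mono)
    finally show ?thesis
      by (simp only: norm_mult norm_power norm_of_real norm_minus_cancel norm_ii norm_numeral power_one mult_1)
  qed
  then show ?thesis by blast
qed

lemma sum_abs_le_of_subset_sums:
  fixes f :: "'a \<Rightarrow> real"
  assumes "finite F" "\<And>G. G \<subseteq> F \<Longrightarrow> \<bar>sum f G\<bar> \<le> C"
  shows "(\<Sum>a\<in>F. \<bar>f a\<bar>) \<le> 2 * C"
proof -
  let ?P = "{a \<in> F. 0 \<le> f a}"
  have "(\<Sum>a\<in>F. \<bar>f a\<bar>) = (\<Sum>a\<in>F - ?P. \<bar>f a\<bar>) + (\<Sum>a\<in>?P. \<bar>f a\<bar>)"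
    by (rule sum.subset_diff) (use assms(1) in auto)
  also have "(\<Sum>a\<in>?P. \<bar>f a\<bar>) = sum f ?P" by (rule sum.cong) auto
  also have "(\<Sum>a\<in>F - ?P. \<bar>f a\<bar>) = - sum f (F - ?P)"
    unfolding sum_negf[symmetric] by (rule sum.cong) auto
  finally show ?thesis using assms(2)[of ?P] assms(2)[of "F - ?P"] by auto
qed

text \<open>
  The summand of order \<open>N\<close> is \<open>2 * Im \<omega> / cmod (\<zeta> - a) ^ (2 * N)\<close>, and \<open>1 / cmod (\<zeta> - a)\<close> is at most
  \<open>cmod \<omega> + 1 / 2\<close>.
\<close>

lemma ahern_clark_zeros:
  assumes gen: "generates_singular_factor \<nu> \<theta>" and \<zeta>: "cmod \<zeta> = 1" and bd: "bounded_divisor_derivatives \<theta> \<zeta>"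
  shows "(\<lambda>a. real (zero_mult \<theta> a) * ((1 - (cmod a)\<^sup>2) / cmod (\<zeta> - a) ^ (2 * N + 2))) summable_on disc_zeros \<theta>"
proof -
  let ?\<omega> = "boundary_cayley \<zeta>" and ?m = "\<lambda>a. real (zero_mult \<theta> a)"
  have "\<exists>C. \<forall>F. finite F \<longrightarrow> F \<subseteq> disc_zeros \<theta> \<longrightarrow> (\<Sum>a\<in>F. ?m a * \<bar>Im (?\<omega> a ^ p)\<bar>) \<le> C" for p
  proof -
    obtain C where C: "\<And>F. finite F \<Longrightarrow> F \<subseteq> disc_zeros \<theta> \<Longrightarrow> \<bar>\<Sum>a\<in>F. ?m a * Im (?\<omega> a ^ p)\<bar> \<le> C"
      using sum_Im_boundary_cayley_bound[OF assms, of p] by blast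
    have "(\<Sum>a\<in>F. \<bar>?m a * Im (?\<omega> a ^ p)\<bar>) \<le> 2 * C" if F: "finite F" "F \<subseteq> disc_zeros \<theta>" for F
      using F by (intro sum_abs_le_of_subset_sums C) (auto intro: finite_subset)
    then show ?thesis by (auto simp: abs_mult)
  qed
  then obtain C where C: "\<And>p F. finite F \<Longrightarrow> F \<subseteq> disc_zeros \<theta> \<Longrightarrow> (\<Sum>a\<in>F. ?m a * \<bar>Im (?\<omega> a ^ p)\<bar>) \<le> C p"
    by metis
  define K where "K = 2 * 2 ^ (2 * N) * (2 * C 1 + C (2 * N + 1) + C (2 * N + 2))"
  have pt: "(1 - (cmod a)\<^sup>2) / cmod (\<zeta> - a) ^ (2 * N + 2)
      \<le> 2 * 2 ^ (2 * N) * (2 * \<bar>Im (?\<omega> a ^ 1)\<bar> + \<bar>Im (?\<omega> a ^ (2 * N + 1))\<bar> + \<bar>Im (?\<omega> a ^ (2 * N + 2))\<bar>)"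
    if a: "a \<in> disc_zeros \<theta>" for a
  proof -
    have a1: "cmod a < 1" using a by (auto simp: disc_zeros_def)
    then have ne: "a \<noteq> \<zeta>" using \<zeta> by auto
    then have d: "cmod (\<zeta> - a) > 0" by simp
    define R where "R = cmod (?\<omega> a)"
    have Im: "Im (?\<omega> a) = (1 - (cmod a)\<^sup>2) / (2 * (cmod (\<zeta> - a))\<^sup>2)" by (rule Im_boundary_cayley[OF \<zeta> ne])
    have Im0: "0 \<le> Im (?\<omega> a)" unfolding Im using a1 by (intro divide_nonneg_nonneg) (auto simp: abs_square_le_1)
    have "cmod (\<zeta> / (\<zeta> - a)) \<le> cmod (\<zeta> / (\<zeta> - a) - 1 / 2) + cmod (1 / 2)"
      using norm_triangle_ineq[of "\<zeta> / (\<zeta> - a) - 1 / 2" "1 / 2"] by simp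
    also have "cmod (\<zeta> / (\<zeta> - a) - 1 / 2) = R" by (simp only: R_def boundary_cayley_def norm_mult complex_mod_cnj norm_ii mult_1)
    finally have "1 / cmod (\<zeta> - a) \<le> R + 1 / 2" using \<zeta> by (simp add: norm_divide)
    then have inv: "1 / cmod (\<zeta> - a) \<le> 2 * max R 1" by simp
    have "(1 - (cmod a)\<^sup>2) / cmod (\<zeta> - a) ^ (2 * N + 2) = 2 * Im (?\<omega> a) * (1 / cmod (\<zeta> - a)) ^ (2 * N)"
    proof -
      have "2 * ((1 - (cmod a)\<^sup>2) / (2 * (cmod (\<zeta> - a))\<^sup>2)) = (1 - (cmod a)\<^sup>2) / (cmod (\<zeta> - a))\<^sup>2"
        by (subst mult_divide_mult_cancel_left[of 2, symmetric]) auto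
      then show ?thesis unfolding Im power_add power_one_over by (simp add: mult.commute)
    qed
    also have "\<dots> \<le> 2 * Im (?\<omega> a) * (2 * max R 1) ^ (2 * N)"
      using inv d Im0 by (intro mult_left_mono power_mono) auto
    also have "\<dots> \<le> 2 * Im (?\<omega> a) * (2 ^ (2 * N) * (R ^ (2 * N) + 1))"
    proof (intro mult_left_mono)
      have "max R 1 ^ (2 * N) \<le> R ^ (2 * N) + 1" by (cases "R \<le> 1") (auto simp: max_def)
      then show "(2 * max R 1) ^ (2 * N) \<le> 2 ^ (2 * N) * (R ^ (2 * N) + 1)"
        unfolding power_mult_distrib by (intro mult_left_mono) auto
    qed (use Im0 in auto)
    also have "\<dots> = 2 * 2 ^ (2 * N) * (Im (?\<omega> a) * R ^ (2 * N) + Im (?\<omega> a))" by (simp add: algebra_simps)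
    also have "\<dots> \<le> 2 * 2 ^ (2 * N) * (2 * \<bar>Im (?\<omega> a ^ 1)\<bar> + \<bar>Im (?\<omega> a ^ (2 * N + 1))\<bar> + \<bar>Im (?\<omega> a ^ (2 * N + 2))\<bar>)"
      using Im_power_lower_bound[OF Im0, of "2 * N"] Im0 unfolding R_def[symmetric]
      by (intro mult_left_mono) (simp_all add: numeral_2_eq_2)
    finally show ?thesis .
  qed
  show ?thesis
  proof (rule nonneg_bdd_above_summable_on)
    show "0 \<le> ?m a * ((1 - (cmod a)\<^sup>2) / cmod (\<zeta> - a) ^ (2 * N + 2))" if "a \<in> disc_zeros \<theta>" for a
      using that by (intro mult_nonneg_nonneg divide_nonneg_nonneg) (auto simp: disc_zeros_def abs_square_le_1)
    have "(\<Sum>a\<in>F. ?m a * ((1 - (cmod a)\<^sup>2) / cmod (\<zeta> - a) ^ (2 * N + 2))) \<le> K"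
      if F: "finite F" "F \<subseteq> disc_zeros \<theta>" for F
    proof -
      have "(\<Sum>a\<in>F. ?m a * ((1 - (cmod a)\<^sup>2) / cmod (\<zeta> - a) ^ (2 * N + 2)))
          \<le> (\<Sum>a\<in>F. ?m a * (2 * 2 ^ (2 * N) * (2 * \<bar>Im (?\<omega> a ^ 1)\<bar> + \<bar>Im (?\<omega> a ^ (2 * N + 1))\<bar> + \<bar>Im (?\<omega> a ^ (2 * N + 2))\<bar>)))"
        using pt F(2) by (intro sum_mono mult_left_mono) auto
      also have "\<dots> = 2 * 2 ^ (2 * N) * (2 * (\<Sum>a\<in>F. ?m a * \<bar>Im (?\<omega> a ^ 1)\<bar>)
          + (\<Sum>a\<in>F. ?m a * \<bar>Im (?\<omega> a ^ (2 * N + 1))\<bar>) + (\<Sum>a\<in>F. ?m a * \<bar>Im (?\<omega> a ^ (2 * N + 2))\<bar>))"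
        by (simp only: sum_distrib_left sum.distrib[symmetric] distrib_left mult_ac)
      also have "\<dots> \<le> K" unfolding K_def using C[OF F, of 1] C[OF F, of "2 * N + 1"] C[OF F, of "2 * N + 2"]
        by (intro mult_left_mono add_mono) auto
      finally show ?thesis .
    qed
    then show "bdd_above (sum (\<lambda>a. ?m a * ((1 - (cmod a)\<^sup>2) / cmod (\<zeta> - a) ^ (2 * N + 2))) ` {F. F \<subseteq> disc_zeros \<theta> \<and> finite F})"
      by (intro bdd_aboveI[of _ K]) auto
  qed
qed

section \<open>The singular measure\<close>

text \<open>
  The singular inner function of the restriction of \<open>\<nu>\<close> to \<open>A\<close>.
\<close>

definition singular_factor :: "complex measure \<Rightarrow> complex set \<Rightarrow> complex \<Rightarrow> complex" where
  "singular_factor \<nu> A z = exp (- (LINT \<xi>|\<nu>. indicator A \<xi> * ((\<xi> + z) / (\<xi> - z))))"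

lemma herglotz_integrand_measurable:
  assumes \<nu>: "sets \<nu> = sets (restrict_space borel (sphere 0 1))" and A: "A \<in> sets \<nu>"
    and f: "f \<in> borel_measurable borel"
  shows "(\<lambda>\<xi>. indicator A \<xi> * f \<xi> :: complex) \<in> borel_measurable \<nu>"
proof -
  have "f \<in> borel_measurable (restrict_space borel (sphere 0 1))" using f by (rule measurable_restrict_space1)
  then have "f \<in> borel_measurable \<nu>" by (simp add: measurable_cong_sets[OF \<nu> refl])
  then show ?thesis using A by simp
qed

text \<open>
  Since \<open>(\<xi> + z) / (\<xi> - z) = 2 * \<xi> / (\<xi> - z) - 1\<close>, the integrand has a geometric expansion around \<open>c\<close>,
  which is dominated uniformly in \<open>\<xi>\<close> as long as \<open>A\<close> keeps the distance \<open>\<epsilon>\<close> from \<open>c\<close>. The centre 0 with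
  \<open>\<epsilon> = 1\<close> covers the disc, the centre \<open>\<zeta>\<close> the behaviour at the boundary point. The summand \<open>of_bool\<close>
  carries the constant 1.
\<close>

lemma herglotz_integral_power_series:
  assumes \<nu>: "sets \<nu> = sets (restrict_space borel (sphere 0 1))" "finite_measure \<nu>"
    and A: "A \<in> sets \<nu>" "\<And>\<xi>. \<xi> \<in> A \<Longrightarrow> \<epsilon> \<le> cmod (\<xi> - c)" and \<epsilon>: "\<epsilon> > 0" and z: "z \<in> ball c \<epsilon>"
  shows "(\<lambda>n. (LINT \<xi>|\<nu>. indicator A \<xi> * (2 * \<xi> / (\<xi> - c) ^ Suc n - of_bool (n = 0))) * (z - c) ^ n)
     sums (LINT \<xi>|\<nu>. indicator A \<xi> * ((\<xi> + z) / (\<xi> - z)))" (is ?sums)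
    and "integrable \<nu> (\<lambda>\<xi>. indicator A \<xi> * ((\<xi> + z) / (\<xi> - z)))" (is ?int)
proof -
  interpret finite_measure \<nu> by fact
  define q where "q = cmod (z - c) / \<epsilon>"
  have zc: "cmod (z - c) < \<epsilon>" using z by (simp add: dist_norm norm_minus_commute)
  then have q: "0 \<le> q" "q < 1" using \<epsilon> by (auto simp: q_def)
  have AS: "cmod \<xi> = 1" if "\<xi> \<in> A" for \<xi>
    using sets.sets_into_space[OF A(1)] that by (auto simp: space_on_circle[OF \<nu>(1)])
  define k where "k n \<xi> = indicator A \<xi> * (2 * \<xi> / (\<xi> - c) ^ Suc n - of_bool (n = 0))" for n \<xi>
  define b where "b n = (2 / \<epsilon> + of_bool (n = 0)) * q ^ n" for n :: nat
  have k_meas: "k n \<in> borel_measurable \<nu>" for n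
    unfolding k_def by (rule herglotz_integrand_measurable[OF \<nu>(1) A(1)]) measurable
  have k_bound: "cmod (k n \<xi> * (z - c) ^ n) \<le> b n" for n \<xi>
  proof (cases "\<xi> \<in> A")
    case True
    have "cmod (2 * \<xi> / (\<xi> - c) ^ Suc n * (z - c) ^ n) = 2 / cmod (\<xi> - c) * (cmod (z - c) / cmod (\<xi> - c)) ^ n"
      using AS[OF True] by (simp add: norm_mult norm_divide norm_power power_divide)
    also have "\<dots> \<le> 2 / \<epsilon> * q ^ n"
      unfolding q_def using A(2)[OF True] \<epsilon> by (intro mult_mono power_mono frac_le) auto
    finally have 1: "cmod (2 * \<xi> / (\<xi> - c) ^ Suc n * (z - c) ^ n) \<le> 2 / \<epsilon> * q ^ n" .
    have 2: "cmod (of_bool (n = 0) * (z - c) ^ n) \<le> of_bool (n = 0) * q ^ n" by (cases n) auto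
    have "k n \<xi> * (z - c) ^ n = 2 * \<xi> / (\<xi> - c) ^ Suc n * (z - c) ^ n - of_bool (n = 0) * (z - c) ^ n"
      using True by (simp add: k_def left_diff_distrib)
    also have "cmod \<dots> \<le> 2 / \<epsilon> * q ^ n + of_bool (n = 0) * q ^ n"
      using norm_triangle_ineq4 1 2 by (rule order_trans[OF _ add_mono])
    finally show ?thesis by (simp add: b_def distrib_right)
  next
    case False
    then show ?thesis using \<epsilon> q by (simp add: k_def b_def)
  qed
  have b: "summable b"
  proof -
    have "summable (\<lambda>n. 2 / \<epsilon> * q ^ n + of_bool (n = 0) * q ^ n)"
      using q by (intro summable_add summable_mult summable_geometric summable_finite[of "{0}"]) auto
    then show ?thesis by (simp add: b_def[abs_def] distrib_right)
  qed
  have b0: "0 \<le> b n" for n using \<epsilon> q by (simp add: b_def)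
  have int: "integrable \<nu> (\<lambda>\<xi>. k n \<xi> * (z - c) ^ n)" for n
    by (rule integrable_const_bound[of _ "b n"]) (use k_bound k_meas in auto)
  have sm: "AE \<xi> in \<nu>. summable (\<lambda>n. norm (k n \<xi> * (z - c) ^ n))"
    by (intro AE_I2 summable_comparison_test'[OF b]) (use k_bound in auto)
  have si: "summable (\<lambda>n. LINT \<xi>|\<nu>. norm (k n \<xi> * (z - c) ^ n))"
  proof (rule summable_comparison_test'[OF summable_mult2[OF b, of "measure \<nu> (space \<nu>)"]])
    fix n
    have "(LINT \<xi>|\<nu>. norm (k n \<xi> * (z - c) ^ n)) \<le> (LINT \<xi>|\<nu>. b n)"
      using k_bound by (intro integral_mono integrable_norm int) auto
    then show "norm (LINT \<xi>|\<nu>. norm (k n \<xi> * (z - c) ^ n)) \<le> b n * measure \<nu> (space \<nu>)"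
      by (simp add: mult.commute)
  qed
  have pt: "(\<Sum>n. k n \<xi> * (z - c) ^ n) = indicator A \<xi> * ((\<xi> + z) / (\<xi> - z))" for \<xi>
  proof (cases "\<xi> \<in> A")
    case True
    define d where "d = \<xi> - c"
    have d: "cmod (z - c) < cmod d" using zc A(2)[OF True] by (simp add: d_def)
    then have d0: "d \<noteq> 0" by auto
    have "cmod ((z - c) / d) < 1" using d d0 by (simp add: norm_divide)
    from sums_mult[OF geometric_sums[OF this], of "2 * \<xi> / d"]
    have "(\<lambda>n. 2 * \<xi> / d * ((z - c) / d) ^ n) sums (2 * \<xi> / d * (1 / (1 - (z - c) / d)))" .
    moreover have "2 * \<xi> / d * (1 / (1 - (z - c) / d)) = 2 * \<xi> / (\<xi> - z)"
    proof -
      have "d * (1 - (z - c) / d) = \<xi> - z" using d0 by (simp add: field_simps d_def)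
      then show ?thesis by (metis mult.right_neutral times_divide_times_eq)
    qed
    moreover have "2 * \<xi> / d * ((z - c) / d) ^ n = 2 * \<xi> / d ^ Suc n * (z - c) ^ n" for n
      by (simp add: power_divide)
    ultimately have 1: "(\<lambda>n. 2 * \<xi> / d ^ Suc n * (z - c) ^ n) sums (2 * \<xi> / (\<xi> - z))" by (simp only:)
    have 2: "(\<lambda>n. of_bool (n = 0) * (z - c) ^ n) sums 1"
      using sums_finite[of "{0::nat}" "\<lambda>n. of_bool (n = 0) * (z - c) ^ n"] by simp
    have "(\<lambda>n. k n \<xi> * (z - c) ^ n) sums (2 * \<xi> / (\<xi> - z) - 1)"
      using sums_diff[OF 1 2] True by (simp add: k_def d_def left_diff_distrib)
    moreover have "2 * \<xi> / (\<xi> - z) - 1 = (\<xi> + z) / (\<xi> - z)"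
    proof -
      have "\<xi> - z \<noteq> 0" using d by (auto simp: d_def)
      then show ?thesis by (simp add: field_simps)
    qed
    ultimately show ?thesis using True by (simp add: sums_iff)
  next
    case False
    then show ?thesis by (simp add: k_def)
  qed
  have "(\<lambda>n. LINT \<xi>|\<nu>. k n \<xi> * (z - c) ^ n) sums (LINT \<xi>|\<nu>. (\<Sum>n. k n \<xi> * (z - c) ^ n))"
    by (rule sums_integral[OF int sm si])
  then show ?sums unfolding pt by (simp add: k_def)
  have "integrable \<nu> (\<lambda>\<xi>. (\<Sum>n. k n \<xi> * (z - c) ^ n))" by (rule integrable_suminf[OF int sm si])
  then show ?int unfolding pt .
qed

lemma singular_factor_divides:
  assumes gen: "generates_singular_factor \<nu> \<theta>" and A: "A \<in> sets \<nu>"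
  shows "divides_inner (singular_factor \<nu> A) \<theta>"
proof -
  have \<nu>: "sets \<nu> = sets (restrict_space borel (sphere 0 1))" "finite_measure \<nu>"
    using gen by (auto simp: generates_singular_factor_def)
  have AS: "cmod \<xi> = 1" if "\<xi> \<in> A" for \<xi>
    using sets.sets_into_space[OF A] that by (auto simp: space_on_circle[OF \<nu>(1)])
  note ps = herglotz_integral_power_series[OF \<nu> A, of 1 0]
  have hol: "singular_factor \<nu> A holomorphic_on disc"
    unfolding singular_factor_def[abs_def]
    by (intro holomorphic_on_compose_gen[OF holomorphic_on_minus[OF power_series_holomorphic[OF ps(1)]] holomorphic_on_exp, unfolded o_def])
       (auto simp: AS)
  have norms: "cmod (\<theta> z) \<le> cmod (singular_factor \<nu> A z) \<and> cmod (singular_factor \<nu> A z) \<le> 1" if z: "z \<in> disc" for z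
  proof -
    let ?P = "\<lambda>\<xi>. Re ((\<xi> + z) / (\<xi> - z))"
    have z1: "cmod z < 1" using z by simp
    have int: "integrable \<nu> (\<lambda>\<xi>. indicator A \<xi> * ((\<xi> + z) / (\<xi> - z)))"
      using ps(2) z AS by simp
    have "(LINT \<xi>|\<nu>. Re (indicator A \<xi> * ((\<xi> + z) / (\<xi> - z)))) = (LINT \<xi>|\<nu>. indicator A \<xi> * ?P \<xi>)"
      by (intro Bochner_Integration.integral_cong refl) (auto simp: indicator_def)
    then have e: "cmod (singular_factor \<nu> A z) = exp (- (LINT \<xi>|\<nu>. indicator A \<xi> * ?P \<xi>))"
      unfolding singular_factor_def norm_exp_eq_Re using integral_Re[OF int] by simp
    have Pint: "integrable \<nu> ?P"
      by (intro integrable_Re integrable_on_circle[OF \<nu>] continuous_on_herglotz_kernel z1)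
    have P0: "0 \<le> ?P \<xi>" if "\<xi> \<in> space \<nu>" for \<xi>
      using that Re_herglotz_kernel_nonneg[OF _ z1] by (simp add: space_on_circle[OF \<nu>(1)])
    have "(LINT \<xi>|\<nu>. indicator A \<xi> * ?P \<xi>) \<le> (LINT \<xi>|\<nu>. ?P \<xi>)"
    proof (rule integral_mono)
      show "integrable \<nu> (\<lambda>\<xi>. indicator A \<xi> * ?P \<xi>)"
        using integrable_mult_indicator[OF A Pint] by simp
    qed (use Pint P0 in \<open>auto simp: indicator_def\<close>)
    moreover have "0 \<le> (LINT \<xi>|\<nu>. indicator A \<xi> * ?P \<xi>)"
      using P0 by (intro integral_nonneg_AE AE_I2) (auto simp: indicator_def)
    moreover have "cmod (\<theta> z) \<le> cmod (singular_inner \<nu> z)"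
      using norm_factorization_le[OF gen _ _ z, of "{}"] by (simp add: partial_blaschke_def)
    ultimately show ?thesis unfolding e norm_singular_inner[OF \<nu> z1]
      by (auto intro: order_trans)
  qed
  have "finite {z \<in> disc. singular_factor \<nu> A z = 0}" by (simp add: singular_factor_def)
  then show ?thesis unfolding divides_inner_def using hol norms by blast
qed

text \<open>
  The logarithmic derivative of \<open>singular_factor \<nu> A\<close> is the derivative of its exponent \<open>- H A\<close>, and
  the Taylor coefficients of \<open>H A\<close> at \<open>\<zeta>\<close> are the moments in question. At \<open>\<zeta>\<close> the factor is
  unimodular because the Poisson kernel vanishes there.
\<close>

lemma singular_moment_bound:
  assumes gen: "generates_singular_factor \<nu> \<theta>" and \<zeta>: "cmod \<zeta> = 1" and bd: "bounded_divisor_derivatives \<theta> \<zeta>"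
  shows "\<exists>C. \<forall>A \<epsilon>. A \<in> sets \<nu> \<longrightarrow> \<epsilon> > 0 \<longrightarrow> (\<forall>\<xi>\<in>A. \<epsilon> \<le> cmod (\<xi> - \<zeta>)) \<longrightarrow>
     cmod (LINT \<xi>|\<nu>. indicator A \<xi> * (2 * \<xi> / (\<xi> - \<zeta>) ^ (m + 2))) \<le> C"
proof -
  have \<nu>: "sets \<nu> = sets (restrict_space borel (sphere 0 1))" "finite_measure \<nu>"
    using gen by (auto simp: generates_singular_factor_def)
  define H where "H A z = (LINT \<xi>|\<nu>. indicator A \<xi> * ((\<xi> + z) / (\<xi> - z)))" for A z
  define Q where "Q A \<longleftrightarrow> A \<in> sets \<nu> \<and> (\<exists>\<epsilon>>0. \<forall>\<xi>\<in>A. \<epsilon> \<le> cmod (\<xi> - \<zeta>))" for A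
  have t: "singular_factor \<nu> A = (\<lambda>z. exp (- H A z))" for A
    by (auto simp: singular_factor_def H_def)
  have Hol: "\<exists>\<epsilon>>0. H A holomorphic_on ball \<zeta> \<epsilon>" if Q: "Q A" for A
  proof -
    obtain \<epsilon> where \<epsilon>: "\<epsilon> > 0" "\<And>\<xi>. \<xi> \<in> A \<Longrightarrow> \<epsilon> \<le> cmod (\<xi> - \<zeta>)" and A: "A \<in> sets \<nu>"
      using Q unfolding Q_def by blast
    have "H A holomorphic_on ball \<zeta> \<epsilon>"
      unfolding H_def[abs_def] by (rule power_series_holomorphic[OF herglotz_integral_power_series(1)[OF \<nu> A \<epsilon>(2,1)]])
    then show ?thesis using \<epsilon>(1) by blast
  qed
  have Han: "H A analytic_on {\<zeta>}" if "Q A" for A using Hol[OF that] by (auto simp: analytic_on_def)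
  have Hder: "(deriv ^^ Suc n) (H A) \<zeta> = fact (Suc n) * (LINT \<xi>|\<nu>. indicator A \<xi> * (2 * \<xi> / (\<xi> - \<zeta>) ^ (n + 2)))"
    if Q: "Q A" for A n
  proof -
    obtain \<epsilon> where \<epsilon>: "\<epsilon> > 0" "\<And>\<xi>. \<xi> \<in> A \<Longrightarrow> \<epsilon> \<le> cmod (\<xi> - \<zeta>)" and A: "A \<in> sets \<nu>"
      using Q unfolding Q_def by blast
    from higher_deriv_eq_power_series_coeff[OF \<epsilon>(1) herglotz_integral_power_series(1)[OF \<nu> A \<epsilon>(2,1)], of "Suc n"]
    show ?thesis by (simp add: H_def[abs_def])
  qed
  define P where "P = {(singular_factor \<nu> A, \<lambda>z. (-1) * deriv (H A) z) |A. Q A}"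
  have tan: "singular_factor \<nu> A analytic_on {\<zeta>}" if "Q A" for A
    unfolding t using Han[OF that] by (intro analytic_intros)
  have dan: "deriv (H A) analytic_on {\<zeta>}" if "Q A" for A
    using Han[OF that] by (rule analytic_deriv)
  have "\<exists>C. \<forall>(t, L)\<in>P. cmod ((deriv ^^ m) L \<zeta>) \<le> C"
  proof (rule log_derivative_bound)
    fix t L assume "(t, L) \<in> P"
    then obtain A where Q: "Q A" and tL: "t = singular_factor \<nu> A" "L = (\<lambda>z. (-1) * deriv (H A) z)"
      by (auto simp: P_def)
    show "t analytic_on {\<zeta>} \<and> L analytic_on {\<zeta>}"
      unfolding tL by (intro conjI tan[OF Q] analytic_on_mult analytic_on_const dan[OF Q])
    obtain \<epsilon> where \<epsilon>: "\<epsilon> > 0" "H A holomorphic_on ball \<zeta> \<epsilon>" using Hol[OF Q] by blast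
    have "\<forall>\<^sub>F z in nhds \<zeta>. z \<in> ball \<zeta> \<epsilon>" using \<epsilon> by (intro eventually_nhds_in_open) auto
    then show "\<forall>\<^sub>F z in nhds \<zeta>. deriv t z = L z * t z"
    proof eventually_elim
      case (elim z)
      have "(H A has_field_derivative deriv (H A) z) (at z)"
        using \<epsilon>(2) elim by (intro holomorphic_derivI[of _ "ball \<zeta> \<epsilon>"]) auto
      then have "(t has_field_derivative (- deriv (H A) z) * exp (- H A z)) (at z)"
        unfolding tL(1) t by (auto intro!: derivative_eq_intros)
      then show ?case by (simp add: DERIV_imp_deriv tL t)
    qed
    obtain \<delta> where \<delta>: "\<delta> > 0" "\<And>\<xi>. \<xi> \<in> A \<Longrightarrow> \<delta> \<le> cmod (\<xi> - \<zeta>)" and A: "A \<in> sets \<nu>"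
      using Q unfolding Q_def by blast
    have AS: "cmod \<xi> = 1" if "\<xi> \<in> A" for \<xi>
      using sets.sets_into_space[OF A] that by (auto simp: space_on_circle[OF \<nu>(1)])
    have int: "integrable \<nu> (\<lambda>\<xi>. indicator A \<xi> * ((\<xi> + \<zeta>) / (\<xi> - \<zeta>)))"
      by (rule herglotz_integral_power_series(2)[OF \<nu> A \<delta>(2,1)]) (use \<delta> in auto)
    have "Re (indicator A \<xi> * ((\<xi> + \<zeta>) / (\<xi> - \<zeta>))) = 0" for \<xi>
    proof (cases "\<xi> \<in> A")
      case True
      have "(Re \<xi>)\<^sup>2 + (Im \<xi>)\<^sup>2 = (Re \<zeta>)\<^sup>2 + (Im \<zeta>)\<^sup>2" using AS[OF True] \<zeta> by (simp flip: cmod_power2)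
      then have "Re (\<xi> + \<zeta>) * Re (\<xi> - \<zeta>) + Im (\<xi> + \<zeta>) * Im (\<xi> - \<zeta>) = 0"
        by (simp add: power2_eq_square algebra_simps)
      then show ?thesis using True unfolding Re_divide by (simp add: Re_divide)
    qed simp
    then have "Re (H A \<zeta>) = 0" unfolding H_def by (subst integral_Re[OF int, symmetric]) simp
    then show "cmod (t \<zeta>) = 1" unfolding tL t norm_exp_eq_Re by simp
  next
    fix m
    obtain C where C: "\<And>t. divides_inner t \<theta> \<Longrightarrow> t analytic_on {\<zeta>} \<Longrightarrow> cmod ((deriv ^^ m) t \<zeta>) \<le> C"
      using bd unfolding bounded_divisor_derivatives_def by blast
    have "cmod ((deriv ^^ m) (singular_factor \<nu> A) \<zeta>) \<le> C" if Q: "Q A" for A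
      using Q by (intro C tan singular_factor_divides[OF gen]) (auto simp: Q_def)
    then show "\<exists>C. \<forall>(t, L)\<in>P. cmod ((deriv ^^ m) t \<zeta>) \<le> C" by (auto simp: P_def)
  qed
  then obtain C where C: "\<And>A. Q A \<Longrightarrow> cmod ((deriv ^^ m) (\<lambda>z. (-1) * deriv (H A) z) \<zeta>) \<le> C"
    unfolding P_def by blast
  have "cmod (LINT \<xi>|\<nu>. indicator A \<xi> * (2 * \<xi> / (\<xi> - \<zeta>) ^ (m + 2))) \<le> C / fact (Suc m)" if Q: "Q A" for A
  proof -
    have "(deriv ^^ m) (\<lambda>z. (-1) * deriv (H A) z) \<zeta> = (-1) * (deriv ^^ Suc m) (H A) \<zeta>"
      unfolding funpow_Suc_right o_apply by (rule higher_deriv_cmult'[OF dan[OF Q]])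
    then have "fact (Suc m) * cmod (LINT \<xi>|\<nu>. indicator A \<xi> * (2 * \<xi> / (\<xi> - \<zeta>) ^ (m + 2)))
        = cmod ((deriv ^^ m) (\<lambda>z. (-1) * deriv (H A) z) \<zeta>)"
      by (simp only: Hder[OF Q] norm_mult norm_minus_cancel norm_one mult_1 norm_fact)
    then show ?thesis using C[OF Q] by (simp add: pos_le_divide_eq mult.commute del: fact_Suc)
  qed
  then show ?thesis unfolding Q_def by (intro exI[of _ "C / fact (Suc m)"]) blast
qed

text \<open>
  On the circle \<open>(\<xi> - \<zeta>) ^ 2 = - \<xi> * \<zeta> * cmod (\<xi> - \<zeta>) ^ 2\<close>. Up to a constant phase, the moment
  integrand is thus a positive multiple of \<open>(\<zeta> * cnj \<xi>) ^ N\<close>, which is close to 1 for \<open>\<xi>\<close> near \<open>\<zeta>\<close>.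
\<close>

lemma circle_difference_power:
  assumes "cmod \<xi> = 1" "cmod \<zeta> = 1" "\<xi> \<noteq> \<zeta>"
  shows "(-1) ^ Suc N * \<zeta> ^ (2 * N + 1) * (2 * \<xi> / (\<xi> - \<zeta>) ^ (2 * N + 2))
     = 2 * (\<zeta> * cnj \<xi>) ^ N / of_real (cmod (\<xi> - \<zeta>) ^ (2 * N + 2))"
proof -
  have x: "\<xi> * cnj \<xi> = 1" "\<zeta> * cnj \<zeta> = 1" using assms by (simp_all flip: complex_norm_square)
  have nz: "\<xi> \<noteq> 0" "\<zeta> \<noteq> 0" "\<xi> - \<zeta> \<noteq> 0" using assms by auto
  define D where "D = complex_of_real ((cmod (\<xi> - \<zeta>))\<^sup>2)"
  have D: "D = (\<xi> - \<zeta>) * (cnj \<xi> - cnj \<zeta>)" unfolding D_def complex_norm_square by simp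
  have D0: "D \<noteq> 0" using nz by (simp add: D_def)
  have c: "cnj \<xi> = 1 / \<xi>" "cnj \<zeta> = 1 / \<zeta>" using x nz by (simp_all add: field_simps)
  have "(\<xi> - \<zeta>)\<^sup>2 = - (\<xi> * \<zeta> * D)" unfolding D c using nz by (simp add: field_simps power2_eq_square)
  then have "((\<xi> - \<zeta>)\<^sup>2) ^ Suc N = (-1) ^ Suc N * (\<xi> * \<zeta>) ^ Suc N * D ^ Suc N"
    by (simp only: power_minus[of "\<xi> * \<zeta> * D"]) (simp only: power_mult_distrib mult.assoc)
  then have e: "(\<xi> - \<zeta>) ^ (2 * N + 2) = (-1) ^ Suc N * (\<xi> * \<zeta>) ^ Suc N * D ^ Suc N"
    using power_mult[of "\<xi> - \<zeta>" 2 "Suc N"] by simp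
  have D': "of_real (cmod (\<xi> - \<zeta>) ^ (2 * N + 2)) = D ^ Suc N"
    unfolding D_def of_real_power[symmetric] power_mult[symmetric] by simp
  have cancel: "s * (b * b * \<zeta>) * (2 * \<xi> / (s * (\<xi> * a * (\<zeta> * b)) * E)) = 2 * (b / a) / E"
    if "s \<noteq> 0" "a \<noteq> 0" "b \<noteq> 0" "E \<noteq> 0" for s a b E :: complex
    using nz that by (simp add: field_simps)
  have "\<zeta> ^ (2 * N + 1) = \<zeta> ^ N * \<zeta> ^ N * \<zeta>" by (simp add: mult_2 power_add)
  moreover have "(\<xi> * \<zeta>) ^ Suc N = \<xi> * \<xi> ^ N * (\<zeta> * \<zeta> ^ N)" by (simp add: power_mult_distrib)
  moreover have "(\<zeta> * (1 / \<xi>)) ^ N = \<zeta> ^ N / \<xi> ^ N" by (simp add: power_divide)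
  ultimately have "(-1) ^ Suc N * \<zeta> ^ (2 * N + 1) * (2 * \<xi> / ((-1) ^ Suc N * (\<xi> * \<zeta>) ^ Suc N * D ^ Suc N))
     = 2 * (\<zeta> * (1 / \<xi>)) ^ N / D ^ Suc N"
    using cancel[of "(-1) ^ Suc N" "\<xi> ^ N" "\<zeta> ^ N" "D ^ Suc N"] nz D0
    by (simp only: power_not_zero times_divide_eq_right) simp
  then show ?thesis unfolding e D' c .
qed

text \<open>
  On the punctured arc \<open>0 < cmod (\<xi> - \<zeta>) < \<delta>\<close> the phase of the moment integrand is controlled, and the
  arc is exhausted by sets \<open>A k\<close> at positive distance from \<open>\<zeta>\<close>. Farther away the integrand is bounded
  and \<open>\<nu>\<close> is finite.
\<close>

lemma ahern_clark_singular:
  assumes gen: "generates_singular_factor \<nu> \<theta>" and \<zeta>: "cmod \<zeta> = 1" and bd: "bounded_divisor_derivatives \<theta> \<zeta>"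
    and atom: "emeasure \<nu> {\<zeta>} = 0"
  shows "(\<integral>\<^sup>+ \<xi>. 1 / ennreal (cmod (\<zeta> - \<xi>) ^ (2 * N + 2)) \<partial>\<nu>) < \<infinity>"
proof -
  have \<nu>: "sets \<nu> = sets (restrict_space borel (sphere 0 1))" "finite_measure \<nu>"
    using gen by (auto simp: generates_singular_factor_def)
  interpret finite_measure \<nu> by (rule \<nu>(2))
  define p where "p = 2 * N + 2"
  define d where "d \<xi> = cmod (\<xi> - \<zeta>)" for \<xi>
  have sets: "{\<xi> \<in> sphere 0 1. P \<xi>} \<in> sets \<nu>" if "{\<xi>. P \<xi>} \<in> sets borel" for P
  proof -
    have "{\<xi> \<in> sphere 0 1. P \<xi>} = sphere 0 1 \<inter> {\<xi>. P \<xi>}" by auto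
    then show ?thesis unfolding \<nu>(1) sets_restrict_space by (simp only:) (rule imageI[OF that])
  qed
  obtain \<delta> where \<delta>: "\<delta> > 0" "\<And>\<xi>. cmod \<xi> = 1 \<Longrightarrow> d \<xi> < \<delta> \<Longrightarrow> 1 / 2 \<le> Re ((\<zeta> * cnj \<xi>) ^ N)"
  proof -
    have "isCont (\<lambda>\<xi>. Re ((\<zeta> * cnj \<xi>) ^ N)) \<zeta>" by simp
    then obtain \<delta> where \<delta>: "\<delta> > 0" "\<And>\<xi>. d \<xi> < \<delta> \<Longrightarrow> \<bar>Re ((\<zeta> * cnj \<xi>) ^ N) - Re ((\<zeta> * cnj \<zeta>) ^ N)\<bar> < 1 / 2"
    proof -
      assume *: "\<And>\<delta>. \<delta> > 0 \<Longrightarrow> (\<And>\<xi>. d \<xi> < \<delta> \<Longrightarrow> \<bar>Re ((\<zeta> * cnj \<xi>) ^ N) - Re ((\<zeta> * cnj \<zeta>) ^ N)\<bar> < 1 / 2) \<Longrightarrow> thesis"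
      have "(0::real) < 1 / 2" by simp
      with \<open>isCont (\<lambda>\<xi>. Re ((\<zeta> * cnj \<xi>) ^ N)) \<zeta>\<close> obtain \<delta> where "\<delta> > 0"
        "\<forall>\<xi>. dist \<xi> \<zeta> < \<delta> \<longrightarrow> dist (Re ((\<zeta> * cnj \<xi>) ^ N)) (Re ((\<zeta> * cnj \<zeta>) ^ N)) < 1 / 2"
        unfolding continuous_at_eps_delta dist_norm real_norm_def by blast
      then show thesis by (intro *[of \<delta>]) (simp_all add: d_def dist_norm)
    qed
    have "\<zeta> * cnj \<zeta> = 1" using \<zeta> by (simp flip: complex_norm_square)
    then have "\<bar>Re ((\<zeta> * cnj \<xi>) ^ N) - 1\<bar> < 1 / 2" if "d \<xi> < \<delta>" for \<xi> using \<delta>(2)[OF that] by simp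
    then have "1 / 2 \<le> Re ((\<zeta> * cnj \<xi>) ^ N)" if "d \<xi> < \<delta>" for \<xi>
      using abs_ge_minus_self[of "Re ((\<zeta> * cnj \<xi>) ^ N) - 1"] that by force
    then show ?thesis using that \<delta>(1) by blast
  qed
  obtain C where C': "\<forall>A \<epsilon>. A \<in> sets \<nu> \<longrightarrow> \<epsilon> > 0 \<longrightarrow> (\<forall>\<xi>\<in>A. \<epsilon> \<le> cmod (\<xi> - \<zeta>)) \<longrightarrow>
     cmod (LINT \<xi>|\<nu>. indicator A \<xi> * (2 * \<xi> / (\<xi> - \<zeta>) ^ (2 * N + 2))) \<le> C"
    using singular_moment_bound[OF gen \<zeta> bd, of "2 * N"] by (rule exE)
  have C: "cmod (LINT \<xi>|\<nu>. indicator A \<xi> * (2 * \<xi> / (\<xi> - \<zeta>) ^ p)) \<le> C"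
    if "A \<in> sets \<nu>" "\<epsilon> > 0" "\<And>\<xi>. \<xi> \<in> A \<Longrightarrow> \<epsilon> \<le> d \<xi>" for A \<epsilon>
    unfolding p_def using that unfolding d_def by (intro C'[rule_format])
  define A where "A k = {\<xi> \<in> sphere 0 1. 1 / real (Suc k) \<le> d \<xi> \<and> d \<xi> < \<delta>}" for k
  have A: "A k \<in> sets \<nu>" for k unfolding A_def d_def by (rule sets) measurable
  define G where "G k \<xi> = ennreal (indicator (A k) \<xi> * (1 / d \<xi> ^ p))" for k \<xi>
  have dm: "(\<lambda>\<xi>. 1 / d \<xi> ^ p) \<in> borel_measurable \<nu>"
    unfolding d_def measurable_cong_sets[OF \<nu>(1) refl] by (rule measurable_restrict_space1) measurable
  have gm: "(\<lambda>\<xi>. indicator (A k) \<xi> * (1 / d \<xi> ^ p)) \<in> borel_measurable \<nu>" for k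
    by (intro borel_measurable_times borel_measurable_indicator A dm)
  have Gm: "G k \<in> borel_measurable \<nu>" for k
    unfolding G_def by (rule measurable_compose[OF gm measurable_ennreal])
  have Gk: "(\<integral>\<^sup>+ \<xi>. G k \<xi> \<partial>\<nu>) \<le> ennreal C" for k
  proof -
    have lower: "1 / real (Suc k) \<le> d \<xi>" if "\<xi> \<in> A k" for \<xi> using that by (simp add: A_def)
    let ?f = "\<lambda>\<xi>. indicator (A k) \<xi> * (2 * \<xi> / (\<xi> - \<zeta>) ^ p)"
    let ?u = "(-1) ^ Suc N * \<zeta> ^ (2 * N + 1)"
    have rb: "1 / d \<xi> ^ p \<le> real (Suc k) ^ p" if "\<xi> \<in> A k" for \<xi>
    proof -
      have "(1 / real (Suc k)) ^ p \<le> d \<xi> ^ p" using lower[OF that] by (intro power_mono) auto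
      moreover have "0 < (1 / real (Suc k)) ^ p" by simp
      ultimately have "1 / d \<xi> ^ p \<le> 1 / (1 / real (Suc k)) ^ p" by (intro frac_le) auto
      then show ?thesis by (simp add: power_divide)
    qed
    have fint: "integrable \<nu> ?f"
    proof (rule integrable_const_bound[of _ "2 * real (Suc k) ^ p"])
      show "?f \<in> borel_measurable \<nu>" by (rule herglotz_integrand_measurable[OF \<nu>(1) A]) measurable
      show "AE \<xi> in \<nu>. norm (?f \<xi>) \<le> 2 * real (Suc k) ^ p"
      proof (intro AE_I2)
        fix \<xi> show "norm (?f \<xi>) \<le> 2 * real (Suc k) ^ p"
        proof (cases "\<xi> \<in> A k")
          case True
          then have "norm (?f \<xi>) = 2 * (1 / d \<xi> ^ p)" by (simp add: norm_mult norm_divide norm_power A_def d_def)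
          then show ?thesis using rb[OF True] by simp
        qed simp
      qed
    qed
    have gint: "integrable \<nu> (\<lambda>\<xi>. indicator (A k) \<xi> * (1 / d \<xi> ^ p))"
    proof (rule integrable_const_bound[of _ "real (Suc k) ^ p"])
      show "(\<lambda>\<xi>. indicator (A k) \<xi> * (1 / d \<xi> ^ p)) \<in> borel_measurable \<nu>" by (rule gm)
      show "AE \<xi> in \<nu>. norm (indicator (A k) \<xi> * (1 / d \<xi> ^ p)) \<le> real (Suc k) ^ p"
        using rb by (intro AE_I2) (auto simp: indicator_def d_def)
    qed
    have pt: "indicator (A k) \<xi> * (1 / d \<xi> ^ p) \<le> Re (?u * ?f \<xi>)" for \<xi>
    proof (cases "\<xi> \<in> A k")
      case True
      then have \<xi>: "cmod \<xi> = 1" "d \<xi> < \<delta>" by (auto simp: A_def)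
      have "0 < 1 / real (Suc k)" by simp
      then have d0: "d \<xi> > 0" using lower[OF True] by linarith
      then have ne: "\<xi> \<noteq> \<zeta>" by (auto simp: d_def)
      have "?u * ?f \<xi> = 2 * (\<zeta> * cnj \<xi>) ^ N / of_real (d \<xi> ^ p)"
        using circle_difference_power[OF \<xi>(1) \<zeta> ne, of N] True by (simp add: p_def d_def)
      then have "Re (?u * ?f \<xi>) = 2 * Re ((\<zeta> * cnj \<xi>) ^ N) / d \<xi> ^ p"
        by (simp only: Re_divide_of_real) simp
      moreover have "1 / d \<xi> ^ p \<le> 2 * Re ((\<zeta> * cnj \<xi>) ^ N) / d \<xi> ^ p"
        using \<delta>(2)[OF \<xi>] d0 by (intro divide_right_mono) auto
      ultimately show ?thesis using True by simp
    qed simp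
    have "(LINT \<xi>|\<nu>. indicator (A k) \<xi> * (1 / d \<xi> ^ p)) \<le> (LINT \<xi>|\<nu>. Re (?u * ?f \<xi>))"
      by (rule integral_mono[OF gint _ pt]) (intro integrable_Re integrable_mult_right fint)
    also have "\<dots> = Re (?u * (LINT \<xi>|\<nu>. ?f \<xi>))"
      by (subst integral_Re) (simp_all only: integrable_mult_right[OF fint] integral_mult_right_zero)
    also have "\<dots> \<le> cmod (?u * (LINT \<xi>|\<nu>. ?f \<xi>))" by (rule complex_Re_le_cmod)
    also have "\<dots> = cmod (LINT \<xi>|\<nu>. ?f \<xi>)" using \<zeta> by (simp add: norm_mult norm_power)
    also have "\<dots> \<le> C" by (rule C[OF A _ lower]) auto
    finally have le: "(LINT \<xi>|\<nu>. indicator (A k) \<xi> * (1 / d \<xi> ^ p)) \<le> C" .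
    have "(\<integral>\<^sup>+ \<xi>. G k \<xi> \<partial>\<nu>) = ennreal (LINT \<xi>|\<nu>. indicator (A k) \<xi> * (1 / d \<xi> ^ p))"
      unfolding G_def by (rule nn_integral_eq_integral[OF gint]) (auto simp: d_def indicator_def)
    then show ?thesis using le by (simp add: ennreal_leI)
  qed
  have "incseq G"
  proof (intro incseq_SucI le_funI)
    fix k \<xi>
    have "1 / real (Suc (Suc k)) \<le> 1 / real (Suc k)" by (intro frac_le) auto
    then have "A k \<subseteq> A (Suc k)" by (auto simp: A_def)
    then show "G k \<xi> \<le> G (Suc k) \<xi>" unfolding G_def
      by (intro ennreal_leI mult_right_mono) (auto simp: indicator_def d_def)
  qed
  then have "(\<integral>\<^sup>+ \<xi>. (SUP k. G k \<xi>) \<partial>\<nu>) = (SUP k. \<integral>\<^sup>+ \<xi>. G k \<xi> \<partial>\<nu>)"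
    by (rule nn_integral_monotone_convergence_SUP) (rule Gm)
  also have "\<dots> \<le> ennreal C" using Gk by (intro SUP_least)
  finally have near: "(\<integral>\<^sup>+ \<xi>. (SUP k. G k \<xi>) \<partial>\<nu>) \<le> ennreal C" .
  have "AE \<xi> in \<nu>. \<xi> \<noteq> \<zeta>"
  proof (rule AE_I[of _ _ "{\<zeta>}"])
    show "{\<zeta>} \<in> sets \<nu>" using sets[of "\<lambda>\<xi>. \<xi> = \<zeta>"] \<zeta> by (simp cong: conj_cong)
  qed (use atom in auto)
  then have "AE \<xi> in \<nu>. 1 / ennreal (cmod (\<zeta> - \<xi>) ^ p) \<le> (SUP k. G k \<xi>) + ennreal (1 / \<delta> ^ p)"
    using AE_space
  proof eventually_elim
    case (elim \<xi>)
    have \<xi>: "cmod \<xi> = 1" using elim by (simp add: space_on_circle[OF \<nu>(1)])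
    have d0: "d \<xi> > 0" using elim by (simp add: d_def)
    have "1 / ennreal (cmod (\<zeta> - \<xi>) ^ p) = ennreal 1 / ennreal (d \<xi> ^ p)"
      by (simp add: d_def norm_minus_commute)
    also have "\<dots> = ennreal (1 / d \<xi> ^ p)" using d0 by (intro divide_ennreal) auto
    finally have e: "1 / ennreal (cmod (\<zeta> - \<xi>) ^ p) = ennreal (1 / d \<xi> ^ p)" .
    show ?case
    proof (cases "d \<xi> < \<delta>")
      case True
      obtain k where "inverse (real (Suc k)) < d \<xi>" using reals_Archimedean[OF d0] by blast
      then have "\<xi> \<in> A k" using True \<xi> by (simp add: A_def inverse_eq_divide)
      then have "ennreal (1 / d \<xi> ^ p) = G k \<xi>" by (simp add: G_def)
      also have "\<dots> \<le> (SUP k. G k \<xi>)" by (rule SUP_upper) simp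
      finally show ?thesis unfolding e by (rule order_trans) simp
    next
      case False
      then have "1 / d \<xi> ^ p \<le> 1 / \<delta> ^ p" using \<delta>(1) by (intro frac_le power_mono) auto
      then have "ennreal (1 / d \<xi> ^ p) \<le> ennreal (1 / \<delta> ^ p)" by (rule ennreal_leI)
      then show ?thesis unfolding e by (rule order_trans) simp
    qed
  qed
  then have "(\<integral>\<^sup>+ \<xi>. 1 / ennreal (cmod (\<zeta> - \<xi>) ^ p) \<partial>\<nu>)
      \<le> (\<integral>\<^sup>+ \<xi>. (SUP k. G k \<xi>) + ennreal (1 / \<delta> ^ p) \<partial>\<nu>)"
    by (rule nn_integral_mono_AE)
  also have "\<dots> = (\<integral>\<^sup>+ \<xi>. (SUP k. G k \<xi>) \<partial>\<nu>) + ennreal (1 / \<delta> ^ p) * emeasure \<nu> (space \<nu>)"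
    using Gm by (subst nn_integral_add) (auto intro!: borel_measurable_SUP)
  also have "\<dots> \<le> ennreal C + ennreal (1 / \<delta> ^ p) * emeasure \<nu> (space \<nu>)"
    using near by (rule add_right_mono)
  also have "\<dots> < \<infinity>"
    by (simp add: less_top[symmetric] ennreal_mult_eq_top_iff)
  finally show ?thesis unfolding p_def .
qed

text \<open>
  An atom of mass \<open>c\<close> forces \<open>cmod (\<theta> z) \<le> exp (- c * P z)\<close> with \<open>P z = x / D\<close>, where
  \<open>x = 1 - (cmod z)\<^sup>2\<close> and \<open>D = (cmod (\<zeta> - z))\<^sup>2\<close>. By \<open>exp (- s) \<le> 1 / (1 + s)\<close> the hypothesis becomes
  \<open>2 * c \<le> C * (D + 2 * c * x)\<close> at the points \<open>w n\<close>, and the right-hand side tends to 0.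
\<close>

lemma overcomplete_no_atom:
  assumes gen: "generates_singular_factor \<nu> \<theta>"
    and w: "\<And>n. w n \<in> disc" "w \<longlonglongrightarrow> \<zeta>" "cmod \<zeta> = 1"
    and C: "\<And>n. 1 - (cmod (\<theta> (w n)))\<^sup>2 \<le> C * (1 - (cmod (w n))\<^sup>2)"
  shows "emeasure \<nu> {\<zeta>} = 0"
proof -
  have \<nu>: "sets \<nu> = sets (restrict_space borel (sphere 0 1))" "finite_measure \<nu>"
    using gen by (auto simp: generates_singular_factor_def)
  interpret finite_measure \<nu> by (rule \<nu>(2))
  have \<zeta>s: "{\<zeta>} \<in> sets \<nu>" unfolding \<nu>(1) using w(3) by (auto simp: sets_restrict_space image_iff intro!: exI[of _ "{\<zeta>}"])
  define c where "c = measure \<nu> {\<zeta>}"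
  define x where "x n = 1 - (cmod (w n))\<^sup>2" for n
  define D where "D n = (cmod (\<zeta> - w n))\<^sup>2" for n
  have c: "0 \<le> c" by (simp add: c_def)
  have main: "2 * c \<le> C * (D n + 2 * c * x n)" for n
  proof -
    have w1: "cmod (w n) < 1" using w(1)[of n] by simp
    then have x: "x n > 0" by (simp add: x_def abs_square_less_1)
    have "w n \<noteq> \<zeta>" using w1 w(3) by auto
    then have D: "D n > 0" by (simp add: D_def)
    let ?P = "\<lambda>\<xi>. Re ((\<xi> + w n) / (\<xi> - w n))"
    have P\<zeta>: "?P \<zeta> = x n / D n" unfolding x_def D_def by (rule Re_herglotz_kernel[OF w(3) w1])
    have Pint: "integrable \<nu> ?P"
      by (intro integrable_Re integrable_on_circle[OF \<nu>] continuous_on_herglotz_kernel w1)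
    have P0: "0 \<le> ?P \<xi>" if "\<xi> \<in> space \<nu>" for \<xi>
      using that Re_herglotz_kernel_nonneg[OF _ w1] by (simp add: space_on_circle[OF \<nu>(1)])
    have "(LINT \<xi>|\<nu>. indicator {\<zeta>} \<xi> * (x n / D n)) \<le> (LINT \<xi>|\<nu>. ?P \<xi>)"
    proof (rule integral_mono)
      show "integrable \<nu> (\<lambda>\<xi>. indicator {\<zeta>} \<xi> * (x n / D n))"
        using \<zeta>s by (intro integrable_mult_left integrable_real_indicator) (auto simp: less_top[symmetric])
      show "indicator {\<zeta>} \<xi> * (x n / D n) \<le> ?P \<xi>" if "\<xi> \<in> space \<nu>" for \<xi>
        using P0[OF that] P\<zeta> by (cases "\<xi> = \<zeta>") auto
    qed (rule Pint)
    then have "c * (x n / D n) \<le> (LINT \<xi>|\<nu>. ?P \<xi>)" using \<zeta>s sets.sets_into_space[OF \<zeta>s] by (simp add: c_def Int_absorb2)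
    then have "cmod (singular_inner \<nu> (w n)) \<le> exp (- (c * (x n / D n)))"
      unfolding norm_singular_inner[OF \<nu> w1] by simp
    moreover have "cmod (\<theta> (w n)) \<le> cmod (singular_inner \<nu> (w n))"
      using norm_factorization_le[OF gen _ _ w(1), of "{}"] by (simp add: partial_blaschke_def)
    ultimately have "cmod (\<theta> (w n)) \<le> exp (- (c * (x n / D n)))" by linarith
    then have "(cmod (\<theta> (w n)))\<^sup>2 \<le> (exp (- (c * (x n / D n))))\<^sup>2" by (intro power_mono) auto
    also have "\<dots> = exp (- (2 * c * x n / D n))" by (simp flip: exp_double)
    also have "\<dots> \<le> 1 / (1 + 2 * c * x n / D n)"
    proof -
      have s: "0 \<le> 2 * c * x n / D n" using c x D by simp
      have "1 + 2 * c * x n / D n \<le> exp (2 * c * x n / D n)" by (rule exp_ge_add_one_self)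
      then show ?thesis using s unfolding exp_minus inverse_eq_divide by (intro frac_le) auto
    qed
    also have "\<dots> = D n / (D n + 2 * c * x n)" using D by (simp add: field_simps)
    finally have "1 - D n / (D n + 2 * c * x n) \<le> C * x n" using C[of n] by (simp add: x_def)
    moreover have pos: "D n + 2 * c * x n > 0" using D c x by (simp add: add_pos_nonneg)
    moreover have "1 - D n / (D n + 2 * c * x n) = 2 * c * x n / (D n + 2 * c * x n)"
      using pos by (simp add: field_simps)
    ultimately have "2 * c * x n \<le> C * x n * (D n + 2 * c * x n)" by (simp add: pos_divide_le_eq)
    then have "x n * (2 * c) \<le> x n * (C * (D n + 2 * c * x n))" by (simp add: mult_ac)
    then show ?thesis using x by (simp only: mult_le_cancel_left_pos)
  qed
  have "(\<lambda>n. C * (D n + 2 * c * x n)) \<longlonglongrightarrow> C * ((cmod (\<zeta> - \<zeta>))\<^sup>2 + 2 * c * (1 - (cmod \<zeta>)\<^sup>2))"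
    unfolding D_def x_def by (intro tendsto_intros w(2))
  then have "(\<lambda>n. C * (D n + 2 * c * x n)) \<longlonglongrightarrow> 0" using w(3) by simp
  then have "2 * c \<le> 0" using main by (intro LIMSEQ_le_const) auto
  then have "c = 0" using c by simp
  then show ?thesis by (simp add: c_def emeasure_eq_measure)
qed

theorem theorem1p3:
  fixes \<theta> :: "complex \<Rightarrow> complex" and \<nu> :: "complex measure"
    and w :: "nat \<Rightarrow> complex" and \<zeta> :: complex
  assumes "inner_function \<theta>"
    and "generates_singular_factor \<nu> \<theta>"
    and "\<And>n. w n \<in> ball 0 1"
    and "w \<longlonglongrightarrow> \<zeta>"
    and "\<zeta> \<in> sphere 0 1"
    and "overcomplete_in (model_space \<theta>) (\<lambda>n. model_kernel \<theta> (w n))"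
  shows "\<zeta> \<in> (\<Inter>n. ahern_clark \<theta> \<nu> n)"
proof -
  note inner = assms(1) and gen = assms(2) and w = assms(3,4,5) and oc = assms(6)
  have \<nu>: "sets \<nu> = sets (restrict_space borel (sphere 0 1))" "finite_measure \<nu>"
    using gen by (auto simp: generates_singular_factor_def)
  have \<zeta>: "cmod \<zeta> = 1" using w(3) by simp
  have hol: "\<theta> holomorphic_on disc" using inner by (simp add: inner_function_def)
  have le: "cmod (\<theta> z) \<le> 1" if z: "z \<in> disc" for z
    using norm_factorization_le[OF gen _ _ z, of "{}"] norm_singular_inner_le_1[OF \<nu>, of z] z
    by (simp add: partial_blaschke_def)
  have one: "H2_norm \<theta> = 1" using inner le by (rule inner_H2_norm)
  have bd: "bounded_divisor_derivatives \<theta> \<zeta>"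
    unfolding bounded_divisor_derivatives_def using divisor_derivative_bound[OF hol le one w oc] by blast
  obtain C where "\<And>n. 1 - (cmod (\<theta> (w n)))\<^sup>2 \<le> C * (1 - (cmod (w n))\<^sup>2)"
    using overcomplete_kernel_norm_bound[OF hol le w(1) oc] by blast
  then have atom: "emeasure \<nu> {\<zeta>} = 0" by (rule overcomplete_no_atom[OF gen w(1,2) \<zeta>])
  show ?thesis
    unfolding ahern_clark_def
    using w(3) ahern_clark_zeros[OF gen \<zeta> bd] ahern_clark_singular[OF gen \<zeta> bd atom] by blast
qed

end
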